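(* Let $n\ge4$ and $f=x^2+y^2z+z^{n-1}\in\mathbb{C}[[x,y,z]]$. Then the limit $h$-function of $f$ is given, for $x\in[0,1]$, by $$h_{f,\infty}(x)=\begin{cases}-\dfrac{(n-1)^2}{3(n-2)}x^3+\left(2-\dfrac1{4(n-2)}\right)x & x\in\left[0,\dfrac1{2(n-1)}\right],\\[8pt] \dfrac1{6(n-1)(n-2)}\left((1-n)x-\dfrac12\right)^3+2x & x\in\left[\dfrac1{2(n-1)},\dfrac1{2(n-3)}\right],\\[8pt] -\dfrac23x^3-\dfrac12x^2+2x-\dfrac1{24(n-1)(n-3)} & x\in\left[\dfrac1{2(n-3)},\dfrac12\right],\\[8pt] h_{f,\infty}(1-x)+2x-1 & x\in\left[\dfrac12,1\right].\end{cases}$$ In particular, $h_{f,\infty}$ is continuous and $\mathcal C^2$ on $(0,1)$.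
   Context: For a field $k$ of characteristic $p>0$ and $f$ in the maximal ideal of $S=k[[x_1,\dots,x_m]]$, the $h$-function is $h_f(t)=\lim_{e\to\infty}\frac1{p^{em}}\ell\bigl(S/(f^{\lceil tp^e\rceil},x_1^{p^e},\dots,x_m^{p^e})\bigr)$, where a non-positive power of an ideal is the unit ideal. For $f$ with integer coefficients, the limit $h$-function is $h_{f,\infty}(t)=\lim_{p\to\infty}h_{f_p}(t)$, with $f_p\in\mathbb{F}_p[[x_1,\dots,x_m]]$ the reduction of $f$ mod $p$ (existence of the limit is part of the claim). In the formula the letter $x$ on the right denotes the real argument of the function. *)

theory Defs
  imports
    "HOL-Analysis.Derivative"
    "HOL-Library.Extended_Real"
    "HOL-Library.Numeral_Type"
    "HOL-Algebra.Algebraic_Closure_Type"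
    "HOL-Number_Theory.Residues"
begin

subsection \<open>Formal power series in finitely many variables\<close>

text \<open>
  The variables are indexed by a finite type \<open>'v\<close>; a series is the function sending an
  exponent vector \<open>a :: 'v \<Rightarrow> nat\<close> to the coefficient of the corresponding monomial. Order and
  subtraction of exponent vectors are the pointwise ones.
\<close>

definition mpowser_ring :: "('a, 'm) ring_scheme \<Rightarrow> (('v::finite \<Rightarrow> nat) \<Rightarrow> 'a) ring"
  where "mpowser_ring R =
    \<lparr>carrier = {f. \<forall>a. f a \<in> carrier R},
     monoid.mult = (\<lambda>f g a. \<Oplus>\<^bsub>R\<^esub>b\<in>{b. b \<le> a}. f b \<otimes>\<^bsub>R\<^esub> g (a - b)),
     one = (\<lambda>a. if a = (\<lambda>_. 0) then \<one>\<^bsub>R\<^esub> else \<zero>\<^bsub>R\<^esub>),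
     zero = (\<lambda>_. \<zero>\<^bsub>R\<^esub>),
     add = (\<lambda>f g a. f a \<oplus>\<^bsub>R\<^esub> g a)\<rparr>"

definition mvar :: "('a, 'm) ring_scheme \<Rightarrow> 'v::finite \<Rightarrow> ('v \<Rightarrow> nat) \<Rightarrow> 'a"
  where "mvar R i = (\<lambda>a. if a = (\<lambda>j. if j = i then 1 else 0) then \<one>\<^bsub>R\<^esub> else \<zero>\<^bsub>R\<^esub>)"


subsection \<open>Length of a module\<close>

definition module_length :: "('a, 'm) ring_scheme \<Rightarrow> ('a, 'b) module \<Rightarrow> enat"
  where "module_length R M =
    Sup {enat n | n. \<exists>N :: nat \<Rightarrow> 'b set.
           (\<forall>i\<le>n. submodule (N i) R M) \<and> (\<forall>i<n. N i \<subset> N (Suc i))}"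

text \<open>\<open>S Quot I\<close>, regarded as an \<open>S\<close>-module.\<close>

definition quot_module :: "('a, 'm) ring_scheme \<Rightarrow> 'a set \<Rightarrow> ('a, 'a set) module"
  where "quot_module S I =
    ring.extend (S Quot I) (module.fields (\<lambda>r A. rcoset_mult S I (I +>\<^bsub>S\<^esub> r) A))"


subsection \<open>The \<open>h\<close>-function\<close>

text \<open>
  The ideal \<open>(f\<^sup>k, x\<^sub>1\<^sup>q, \<dots>, x\<^sub>m\<^sup>q)\<close> with \<open>q = p\<^sup>e\<close> and \<open>k = \<lceil>t q\<rceil>\<close>. For \<open>t \<le> 0\<close> the truncation of
  \<open>nat\<close> gives \<open>k = 0\<close>, hence the unit ideal, which is the convention for non-positive powers.
\<close>

definition h_ideal :: "('a, 'm) ring_scheme \<Rightarrow> nat \<Rightarrow> (('v::finite \<Rightarrow> nat) \<Rightarrow> 'a) \<Rightarrow> real \<Rightarrow> nat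
    \<Rightarrow> (('v \<Rightarrow> nat) \<Rightarrow> 'a) set"
  where "h_ideal R p f t e =
    (let S = mpowser_ring R in
     Idl\<^bsub>S\<^esub> (insert (f [^]\<^bsub>S\<^esub> nat \<lceil>t * real p ^ e\<rceil>) (range (\<lambda>i. mvar R i [^]\<^bsub>S\<^esub> (p ^ e)))))"

text \<open>
  \<open>is_h_function R p f h\<close>: all the limits defining the \<open>h\<close>-function of \<open>f\<close> exist and their values
  are given by \<open>h\<close>. Here \<open>R\<close> is a field of characteristic \<open>p > 0\<close> and \<open>f\<close> lies in the maximal ideal.
\<close>

definition is_h_function :: "('a, 'm) ring_scheme \<Rightarrow> nat \<Rightarrow> (('v::finite \<Rightarrow> nat) \<Rightarrow> 'a)
    \<Rightarrow> (real \<Rightarrow> real) \<Rightarrow> bool"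
  where "is_h_function R p f h \<longleftrightarrow>
    (\<forall>t. ((\<lambda>e. ereal_of_enat
                  (module_length (mpowser_ring R) (quot_module (mpowser_ring R) (h_ideal R p f t e)))
                / ereal (real p ^ (e * CARD('v))))
           \<longlongrightarrow> ereal (h t)) sequentially)"

text \<open>
  For a complex power series \<open>f\<close> with integer coefficients \<open>F\<close>, the limit over the primes of the
  \<open>h\<close>-functions of the reductions modulo \<open>p\<close>.
\<close>

definition is_limit_h_function :: "(('v::finite \<Rightarrow> nat) \<Rightarrow> complex) \<Rightarrow> (real \<Rightarrow> real) \<Rightarrow> bool"
  where "is_limit_h_function f h \<longleftrightarrow>
    (\<exists>F :: ('v \<Rightarrow> nat) \<Rightarrow> int. \<exists>H :: nat \<Rightarrow> real \<Rightarrow> real.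
       (\<forall>a. f a = of_int (F a)) \<and>
       (\<forall>p. Factorial_Ring.prime p \<longrightarrow> is_h_function (residue_ring (int p)) p (\<lambda>a. F a mod int p) (H p)) \<and>
       (\<forall>t. ((\<lambda>p. H p t) \<longlongrightarrow> h t) (inf sequentially (principal {p. Factorial_Ring.prime p}))))"


subsection \<open>Differentiability class on an open set\<close>

definition C_k_on :: "nat \<Rightarrow> (real \<Rightarrow> real) \<Rightarrow> real set \<Rightarrow> bool"
  where "C_k_on k h U \<longleftrightarrow>
    (\<forall>i<k. \<forall>x\<in>U. ((deriv ^^ i) h) field_differentiable (at x)) \<and> continuous_on U ((deriv ^^ k) h)"

end

theory Submission
  imports
    Defs
    "HOL-Computational_Algebra.Formal_Power_Series"
    "HOL-Analysis.Equivalence_Lebesgue_Henstock_Integration"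
begin

text \<open>
  For an odd prime \<open>p\<close> and the prime field \<open>F\<close> put \<open>J(i, k)\<close> for the sizes of the Jordan blocks of \<open>T\<close> on
  \<open>F[x, T] / (x\<^sup>p, (x\<^sup>2 + T)\<^sup>k)\<close>, where \<open>i < p\<close> and \<open>k \<le> p\<close>. An adapted \<open>F[T]\<close>-basis is given by
  the Pade approximants of \<open>(1 + x)\<^sup>k\<close>, whose leading coefficients are binomial coefficients prime
  to \<open>p\<close>. Specializing \<open>T\<close> to \<open>g = z(y\<^sup>2 + z\<^sup>M)\<close>, \<open>M = n - 2\<close>, and then using the same statement for
  \<open>y\<^sup>2 + z\<^sup>M\<close> gives the exact length
  \<open>L(k) = \<Sum>\<^sub>i \<Sum>\<^sub>l min(p, J(i, k) + M J(l, J(i, k)))\<close> of \<open>S/(f\<^sup>k, x\<^sup>p, y\<^sup>p, z\<^sup>p)\<close>. Since the Frobenius is flat,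
  the sequence defining \<open>h\<^sub>f(t)\<close> is decreasing and
  \<open>L(\<lfloor>tp\<rfloor>) \<le> p\<^sup>3 h\<^sub>f(t) \<le> L(\<lceil>tp\<rceil>)\<close>. As \<open>p\<close> grows, \<open>L(k) / p\<^sup>3\<close> is a Riemann sum of a piecewise
  polynomial double integral.
\<close>

text \<open>Since the prime varies, reduction mod p is postponed: the computation runs in Z[[x,y,z]]
  with ideals containing p. Lengths over F_p become exponents of p in indices of additive subgroups,
  direct sums become products of indices, and units of F_p become integers prime to p. The structure
  theorem is stated over any commutative ring modulo an ideal \<open>K\<close> containing p, with an
  extra factor \<open>c\<close>. It can thus be applied twice, to x over Z[[z]][[y]] and to y over
  Z[[z]], where \<open>c\<close> is the power of z split off from g. The obstacle is that the exact
  length is available only for the box of side p, where the leading binomials have upper index below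
  p. So no closed form of the h-function at a given p is obtained. It is squeezed between two length
  sums that differ only in rounding, and these have a common limit. Length sums need odd p, while
  the limit h-function asks for an h-function at every prime. Existence is therefore derived from
  the Frobenius alone, which covers p = 2.\<close>

section \<open>Cosets and indices of additive subgroups\<close>

definition add_subgroup :: "'a::ab_group_add set \<Rightarrow> bool"
  where "add_subgroup I \<longleftrightarrow> 0 \<in> I \<and> (\<forall>u\<in>I. \<forall>v\<in>I. u - v \<in> I)"

lemma add_subgroupD:
  assumes "add_subgroup I"
  shows "0 \<in> I" "u \<in> I \<Longrightarrow> v \<in> I \<Longrightarrow> u - v \<in> I" "u \<in> I \<Longrightarrow> - u \<in> I"
    "u \<in> I \<Longrightarrow> v \<in> I \<Longrightarrow> u + v \<in> I"
proof -
  have d: "u - v \<in> I" if "u \<in> I" "v \<in> I" for u v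
    using assms that by (auto simp: add_subgroup_def)
  show z: "0 \<in> I" using assms by (auto simp: add_subgroup_def)
  show "u - v \<in> I" if "u \<in> I" "v \<in> I" using d that .
  show m: "- u \<in> I" if "u \<in> I" for u using d[OF z that] by simp
  show "u + v \<in> I" if "u \<in> I" "v \<in> I" using d[OF that(1) m[OF that(2)]] by simp
qed

lemma add_subgroup_sum:
  assumes "add_subgroup I" "\<And>i. i \<in> A \<Longrightarrow> f i \<in> I"
  shows "sum f A \<in> I"
  using assms(2)
  by (induction A rule: infinite_finite_induct) (auto intro: add_subgroupD[OF assms(1)])

text \<open>The value is \<open>0\<close> if there are infinitely many cosets.\<close>

definition quotient_index :: "'a::ab_group_add set \<Rightarrow> nat"
  where "quotient_index I = card (range (\<lambda>u. {v. v - u \<in> I}))"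

text \<open>Both ranges are in bijection with the classes of one equivalence relation, so cosets may
  be counted through any complete invariant.\<close>

lemma card_range_cong_kernel:
  assumes "\<And>x y. f x = f y \<longleftrightarrow> g x = g y"
  shows "card (range f) = card (range g)"
proof -
  have "bij_betw (\<lambda>s. g (inv_into UNIV f s)) (range f) (range g)"
  proof (rule bij_betw_imageI)
    show "inj_on (\<lambda>s. g (inv_into UNIV f s)) (range f)"
      by (rule inj_onI) (metis assms f_inv_into_f)
    show "(\<lambda>s. g (inv_into UNIV f s)) ` range f = range g"
    proof (auto simp: image_iff)
      fix y show "\<exists>x. g y = g (inv_into UNIV f (f x))"
        by (rule exI[of _ y]) (metis assms f_inv_into_f rangeI)
    qed
  qed
  thus ?thesis by (rule bij_betw_same_card)
qed

lemma coset_eq_iff: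
  assumes "add_subgroup I"
  shows "{w. w - u \<in> I} = {w. w - v \<in> I} \<longleftrightarrow> u - v \<in> I"
proof
  assume "{w. w - u \<in> I} = {w. w - v \<in> I}"
  moreover have "u \<in> {w. w - u \<in> I}" using add_subgroupD(1)[OF assms] by simp
  ultimately show "u - v \<in> I" by auto
next
  assume h: "u - v \<in> I"
  have "w - u \<in> I \<longleftrightarrow> w - v \<in> I" for w
    using add_subgroupD(4)[OF assms _ h, of "w - u"] add_subgroupD(2)[OF assms _ h, of "w - v"]
    by auto
  thus "{w. w - u \<in> I} = {w. w - v \<in> I}" by auto
qed

lemma quotient_index_eq_card_range:
  assumes "add_subgroup I" "\<And>u v. \<Phi> u = \<Phi> v \<longleftrightarrow> u - v \<in> I"
  shows "quotient_index I = card (range \<Phi>)"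
  unfolding quotient_index_def
  by (rule card_range_cong_kernel) (simp add: coset_eq_iff assms)

text \<open>\<open>\<Psi>\<close> induces a bijection from the product of the quotients by the
  \<open>L i\<close> onto the quotient by \<open>I\<close>: \<open>surj\<close> gives surjectivity
  and \<open>mem\<close> the kernel. It serves for coefficients, for coordinates in an adapted basis
  and for Frobenius components.\<close>

lemma quotient_index_prod:
  fixes \<Psi> :: "('i \<Rightarrow> 'h::ab_group_add) \<Rightarrow> 'g::ab_group_add"
  assumes C: "finite C" and I: "add_subgroup I" and L: "\<And>i. i \<in> C \<Longrightarrow> add_subgroup (L i)"
    and diff: "\<And>w w'. \<Psi> (\<lambda>i. w i - w' i) = \<Psi> w - \<Psi> w'"
    and surj: "\<And>u. \<exists>w. u - \<Psi> w \<in> I"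
    and mem: "\<And>w. \<Psi> w \<in> I \<longleftrightarrow> (\<forall>i\<in>C. w i \<in> L i)"
  shows "quotient_index I = (\<Prod>i\<in>C. quotient_index (L i))"
proof -
  let ?c = "\<lambda>u. {v. v - u \<in> I}"
  let ?d = "\<lambda>i u. {v. v - u \<in> L i}"
  let ?D = "\<lambda>w. restrict (\<lambda>i. ?d i (w i)) C"
  have "range ?c = range (\<lambda>w. ?c (\<Psi> w))"
  proof (safe, goal_cases)
    case (1 _ u)
    obtain w where "u - \<Psi> w \<in> I" using surj by blast
    hence "?c u = ?c (\<Psi> w)" using coset_eq_iff[OF I] by blast
    thus ?case by blast
  qed auto
  hence "quotient_index I = card (range (\<lambda>w. ?c (\<Psi> w)))" by (simp add: quotient_index_def)
  also have "\<dots> = card (range ?D)"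
  proof (rule card_range_cong_kernel)
    fix w w'
    have "?D w = ?D w' \<longleftrightarrow> (\<forall>i\<in>C. ?d i (w i) = ?d i (w' i))"
      by (auto simp: fun_eq_iff restrict_def)
    also have "\<dots> \<longleftrightarrow> (\<forall>i\<in>C. w i - w' i \<in> L i)"
      by (intro ball_cong refl coset_eq_iff L)
    also have "\<dots> \<longleftrightarrow> \<Psi> w - \<Psi> w' \<in> I" using mem[of "\<lambda>i. w i - w' i"] by (simp add: diff)
    also have "\<dots> \<longleftrightarrow> ?c (\<Psi> w) = ?c (\<Psi> w')" by (rule coset_eq_iff[OF I, symmetric])
    finally show "(?c (\<Psi> w) = ?c (\<Psi> w')) = (?D w = ?D w')" by blast
  qed
  also have "range ?D = PiE C (\<lambda>i. range (?d i))"
  proof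
    show "range ?D \<subseteq> PiE C (\<lambda>i. range (?d i))" by auto
    show "PiE C (\<lambda>i. range (?d i)) \<subseteq> range ?D"
    proof
      fix s assume s: "s \<in> PiE C (\<lambda>i. range (?d i))"
      hence "\<forall>i\<in>C. \<exists>x. s i = ?d i x" by auto
      then obtain w where "\<forall>i\<in>C. s i = ?d i (w i)" by metis
      hence "s = ?D w" using s by (auto simp: fun_eq_iff PiE_def extensional_def)
      thus "s \<in> range ?D" by blast
    qed
  qed
  also have "card (PiE C (\<lambda>i. range (?d i))) = (\<Prod>i\<in>C. quotient_index (L i))"
    by (simp add: card_PiE[OF C] quotient_index_def)
  finally show ?thesis .
qed

text \<open>A nonzero index expresses that \<open>I\<close> has finitely many cosets; these project
  onto the cosets of \<open>I'\<close>.\<close>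

lemma quotient_index_antimono:
  assumes "add_subgroup I" "add_subgroup I'" "I \<subseteq> I'" "quotient_index I \<noteq> 0"
  shows "quotient_index I' \<le> quotient_index I"
proof -
  let ?c = "\<lambda>u. {v. v - u \<in> I}" and ?c' = "\<lambda>u. {v. v - u \<in> I'}"
  have fin: "finite (range ?c)" using assms(4) by (metis card.infinite quotient_index_def)
  have "?c' u = ?c' (inv_into UNIV ?c (?c u))" for u
  proof -
    have "?c (inv_into UNIV ?c (?c u)) = ?c u" by (rule f_inv_into_f[of "?c u" ?c UNIV]) simp
    hence "inv_into UNIV ?c (?c u) - u \<in> I" using coset_eq_iff[OF assms(1)] by blast
    hence "inv_into UNIV ?c (?c u) - u \<in> I'" using assms(3) by blast
    thus ?thesis using coset_eq_iff[OF assms(2)] by blast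
  qed
  hence "range ?c' \<subseteq> (\<lambda>s. ?c' (inv_into UNIV ?c s)) ` range ?c" by blast
  hence "card (range ?c') \<le> card (range ?c)" using fin surj_card_le by blast
  thus ?thesis by (simp add: quotient_index_def)
qed

subsection \<open>Pade approximants of a binomial power\<close>

text \<open>Three applications of Vandermonde's identity: split \<open>m + n - j\<close> as
  \<open>(s - j) + (m + n - s)\<close>, sum over \<open>j\<close>, and then sum over \<open>r\<close>.\<close>

lemma pade_binomial_rat:
  fixes m n k s :: nat
  assumes s: "s \<le> m + n"
  shows "(\<Sum>j\<le>s. of_nat (k choose (s - j)) * ((of_nat m - of_nat k) gchoose j) * of_nat ((m + n - j) choose m))
     = (of_nat (((m + n - s) choose n) * ((k + n) choose s)) :: rat)"
proof -
  let ?g = "\<lambda>j. ((of_nat m - of_nat k :: rat) gchoose j)"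
  \<comment> \<open>Trinomial revision moves the dependence on \<open>r\<close> into
    \<open>n choose (s - r)\<close>, which leaves a constant factor in the last Vandermonde
    sum.\<close>
  have trin: "((m + n - s) choose (m - r)) * ((m - r) choose (s - r))
      = ((m + n - s) choose n) * (n choose (s - r))" if r: "r \<le> m" "r \<le> s" for r
  proof (cases "s \<le> m")
    case True
    have "((m + n - s) choose (m - r)) * ((m - r) choose (s - r))
       = ((m + n - s) choose (m - r)) * ((m - r) choose (m - s))"
      using r True by (subst (2) binomial_symmetric) auto
    also have "\<dots> = ((m + n - s) choose (m - s)) * (((m + n - s) - (m - s)) choose ((m - r) - (m - s)))"
    proof (cases "m - r \<le> m + n - s")
      case True' : True
      show ?thesis by (rule choose_mult) (use r True' in auto)
    next
      case False
      thus ?thesis using True r by (simp add: binomial_eq_0)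
    qed
    also have "\<dots> = ((m + n - s) choose n) * (n choose (s - r))"
    proof -
      have "(m + n - s) choose (m - s) = (m + n - s) choose n"
        using True by (subst binomial_symmetric) auto
      thus ?thesis using True r by simp
    qed
    finally show ?thesis .
  next
    case False
    thus ?thesis using r s by (simp add: binomial_eq_0)
  qed
  have cm: "(k choose (s - j)) * ((s - j) choose r) = (k choose r) * ((k - r) choose (s - r - j))"
    if "r \<le> s" "j \<le> s - r" for j r
  proof (cases "s - j \<le> k")
    case True
    thus ?thesis using choose_mult[of r "s - j" k] that by (simp add: algebra_simps)
  next
    case False
    thus ?thesis using that by (auto simp: binomial_eq_0)
  qed
  \<comment> \<open>The upper indices \<open>m - k\<close> (possibly negative) and
    \<open>k - r\<close> add up to the natural number \<open>m - r\<close>.\<close>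
  have inner: "(\<Sum>j\<le>s. of_nat (k choose (s - j)) * ?g j * of_nat ((s - j) choose r))
      = of_nat (k choose r) * (of_nat ((m - r) choose (s - r)) :: rat)" if r: "r \<le> m" "r \<le> s" for r
  proof (cases "r \<le> k")
    case True
    have "(\<Sum>j\<le>s. of_nat (k choose (s - j)) * ?g j * of_nat ((s - j) choose r))
        = (\<Sum>j\<in>{0..s - r}. of_nat (k choose (s - j)) * ?g j * of_nat ((s - j) choose r))"
      by (rule sum.mono_neutral_right) (auto simp: binomial_eq_0)
    also have "\<dots> = (\<Sum>j\<in>{0..s - r}. of_nat (k choose r) * (?g j * (of_nat (k - r) gchoose (s - r - j))))"
    proof (rule sum.cong[OF refl])
      fix j assume "j \<in> {0..s - r}"
      hence "of_nat ((k choose (s - j)) * ((s - j) choose r))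
          = (of_nat ((k choose r) * ((k - r) choose (s - r - j))) :: rat)" using cm[of r j] r by simp
      thus "of_nat (k choose (s - j)) * ?g j * of_nat ((s - j) choose r)
          = of_nat (k choose r) * (?g j * (of_nat (k - r) gchoose (s - r - j)))"
        by (simp add: binomial_gbinomial algebra_simps)
    qed
    also have "\<dots> = of_nat (k choose r) * ((of_nat m - of_nat k + of_nat (k - r)) gchoose (s - r))"
      by (subst gbinomial_Vandermonde[symmetric]) (simp add: sum_distrib_left)
    also have "of_nat m - of_nat k + of_nat (k - r) = (of_nat (m - r) :: rat)"
      using True r by (simp add: of_nat_diff)
    finally show ?thesis by (simp add: binomial_gbinomial)
  next
    case False
    have "of_nat (k choose (s - j)) * ?g j * of_nat ((s - j) choose r) = 0" for j
      using False by (cases "s - j \<le> k") (auto simp: binomial_eq_0)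
    hence "(\<Sum>j\<le>s. of_nat (k choose (s - j)) * ?g j * of_nat ((s - j) choose r)) = 0"
      by (intro sum.neutral ballI)
    thus ?thesis using False by (simp add: binomial_eq_0)
  qed
  have split: "(m + n - j) choose m = (\<Sum>r\<le>m. ((s - j) choose r) * ((m + n - s) choose (m - r)))"
    if "j \<le> s" for j
    using vandermonde[of "s - j" "m + n - s" m] that s by simp
  have "(\<Sum>j\<le>s. of_nat (k choose (s - j)) * ?g j * of_nat ((m + n - j) choose m))
      = (\<Sum>j\<le>s. \<Sum>r\<le>m. of_nat ((m + n - s) choose (m - r)) *
           (of_nat (k choose (s - j)) * ?g j * of_nat ((s - j) choose r)))"
    by (intro sum.cong refl) (simp add: split sum_distrib_left algebra_simps)
  also have "\<dots> = (\<Sum>r\<le>m. of_nat ((m + n - s) choose (m - r)) *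
           (\<Sum>j\<le>s. of_nat (k choose (s - j)) * ?g j * of_nat ((s - j) choose r)))"
    by (subst sum.swap) (simp add: sum_distrib_left)
  also have "\<dots> = (\<Sum>r\<le>m. of_nat ((m + n - s) choose n) * of_nat ((k choose r) * (if r \<le> s then n choose (s - r) else 0)))"
  proof (rule sum.cong[OF refl])
    fix r assume r: "r \<in> {..m}"
    show "of_nat ((m + n - s) choose (m - r)) * (\<Sum>j\<le>s. of_nat (k choose (s - j)) * ?g j * of_nat ((s - j) choose r))
       = of_nat ((m + n - s) choose n) * of_nat ((k choose r) * (if r \<le> s then n choose (s - r) else 0))"
    proof (cases "r \<le> s")
      case True
      have "of_nat ((m + n - s) choose (m - r)) * (of_nat ((m - r) choose (s - r)) :: rat)
          = of_nat ((m + n - s) choose n) * of_nat (n choose (s - r))"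
        unfolding of_nat_mult[symmetric] using trin[of r] r True by simp
      thus ?thesis using inner[of r] r True by (simp add: algebra_simps)
    next
      case False
      have "of_nat (k choose (s - j)) * ?g j * of_nat ((s - j) choose r) = 0" for j
        using False by (auto simp: binomial_eq_0)
      hence "(\<Sum>j\<le>s. of_nat (k choose (s - j)) * ?g j * of_nat ((s - j) choose r)) = 0"
        by (intro sum.neutral ballI)
      thus ?thesis using False by simp
    qed
  qed
  also have "\<dots> = of_nat ((m + n - s) choose n) *
      of_nat (\<Sum>r\<le>m. (k choose r) * (if r \<le> s then n choose (s - r) else 0))"
    by (simp add: sum_distrib_left)
  also have "of_nat ((m + n - s) choose n) *
        of_nat (\<Sum>r\<le>m. (k choose r) * (if r \<le> s then n choose (s - r) else 0))
      = (of_nat (((m + n - s) choose n) * ((k + n) choose s)) :: rat)"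
  proof (cases "s \<le> m")
    case True
    have "(\<Sum>r\<le>m. (k choose r) * (if r \<le> s then n choose (s - r) else 0)) = (\<Sum>r\<le>s. (k choose r) * (n choose (s - r)))"
      using True by (intro sum.mono_neutral_cong_right) auto
    thus ?thesis by (simp only: vandermonde of_nat_mult)
  next
    case False
    hence "(m + n - s) choose n = 0" using s by (intro binomial_eq_0) auto
    thus ?thesis by simp
  qed
  finally show ?thesis .
qed

text \<open>Upper negation. It makes the coefficients integers, so that the identity can be read in
  any commutative ring.\<close>

lemma gbinomial_neg_int:
  assumes "m < k"
  shows "((of_nat m - of_nat k :: rat) gchoose j) = of_int ((-1) ^ j * int ((k - m + j - 1) choose j))"
proof -
  have "((of_nat m - of_nat k :: rat) gchoose j) = (- of_nat (k - m)) gchoose j"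
    using assms by (simp add: of_nat_diff)
  also have "\<dots> = (-1) ^ j * ((of_nat (k - m) + of_nat j - 1) gchoose j)"
    by (rule gbinomial_minus)
  also have "(of_nat (k - m) + of_nat j - 1 :: rat) = of_nat (k - m + j - 1)"
    using assms by (simp add: of_nat_diff)
  finally show ?thesis by (simp add: binomial_gbinomial)
qed

text \<open>The Pade property: for m < s <= m + n the right side vanishes because m + n - s < n.
  Hence (1 + x)^k times a polynomial of degree n agrees through order m + n with a polynomial of
  degree m.\<close>

lemma pade_binomial:
  fixes m n k s :: nat
  assumes "s \<le> m + n" "m < k"
  shows "(\<Sum>j\<le>s. int (k choose (s - j)) * ((-1) ^ j * int ((k - m + j - 1) choose j) * int ((m + n - j) choose m)))
     = int (((m + n - s) choose n) * ((k + n) choose s))"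
proof -
  have "(of_int (\<Sum>j\<le>s. int (k choose (s - j)) * ((-1) ^ j * int ((k - m + j - 1) choose j) * int ((m + n - j) choose m))) :: rat)
     = of_int (int (((m + n - s) choose n) * ((k + n) choose s)))"
    using pade_binomial_rat[OF assms(1), of k] by (simp add: gbinomial_neg_int[OF assms(2)] algebra_simps)
  thus ?thesis by (simp only: of_int_eq_iff)
qed

subsection \<open>Triangular families of power series\<close>

definition is_ideal :: "'a::comm_ring_1 set \<Rightarrow> bool"
  where "is_ideal K \<longleftrightarrow> add_subgroup K \<and> (\<forall>r. \<forall>x\<in>K. r * x \<in> K)"

lemma is_idealD:
  assumes "is_ideal K"
  shows "add_subgroup K" "x \<in> K \<Longrightarrow> r * x \<in> K" "x \<in> K \<Longrightarrow> x * r \<in> K"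
  using assms by (auto simp: is_ideal_def mult.commute)

text \<open>By Bezout, \<open>e\<close> inverts \<open>c\<close> modulo p, hence modulo every ideal
  containing p. This replaces division in F_p.\<close>

lemma ideal_coprime_cancel:
  fixes K :: "'a::comm_ring_1 set"
  assumes K: "is_ideal K" and p: "of_nat p \<in> K" and c: "coprime c (int p)"
  shows "\<exists>e. \<forall>x. x - x * of_int c * of_int e \<in> K"
proof -
  obtain e f where "e * c + f * int p = 1" using bezout_int[of c "int p"] c by (metis coprime_imp_gcd_eq_1)
  hence "of_int e * of_int c + of_int f * of_nat p = (1::'a)"
    by (metis of_int_1 of_int_add of_int_mult of_int_of_nat_eq)
  hence "x - x * of_int c * of_int e = (x * of_int f) * of_nat p" for x :: 'a
    by (metis (no_types, opaque_lifting) add_diff_cancel_left' mult.assoc mult.commute mult.right_neutral ring_class.ring_distribs(1))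
  thus ?thesis using is_idealD(2)[OF K p] by metis
qed

text \<open>Back substitution from the top degree: in degree i the members of smaller index
  contribute elements of \<open>K\<close> by triangularity, those of larger index by induction, and
  the leading coefficient is invertible modulo \<open>K\<close>.\<close>

lemma triangular_unique:
  fixes K :: "'a::comm_ring_1 set" and Q :: "nat \<Rightarrow> 'a fps"
  assumes K: "is_ideal K" and p: "of_nat p \<in> K"
    and lead: "\<And>i. i < m \<Longrightarrow> \<exists>c. fps_nth (Q i) i = of_int c \<and> coprime c (int p)"
    and tri: "\<And>i l. i < m \<Longrightarrow> i < l \<Longrightarrow> l < m \<Longrightarrow> fps_nth (Q i) l \<in> K"
    and mem: "\<And>l. l < m \<Longrightarrow> (\<Sum>i<m. w i * fps_nth (Q i) l) \<in> K"
    and i: "i < m"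
  shows "w i \<in> K"
  using i
proof (induction "m - i" arbitrary: i rule: less_induct)
  case less
  obtain c where c: "fps_nth (Q i) i = of_int c" "coprime c (int p)" using lead less.prems by blast
  obtain e where e: "\<And>x. x - x * of_int c * of_int e \<in> K" using ideal_coprime_cancel[OF K p c(2)] by blast
  have "(\<Sum>l\<in>{..<m} - {i}. w l * fps_nth (Q l) i) \<in> K"
  proof (rule add_subgroup_sum[OF is_idealD(1)[OF K]])
    fix l assume l: "l \<in> {..<m} - {i}"
    show "w l * fps_nth (Q l) i \<in> K"
    proof (cases "l < i")
      case True
      thus ?thesis using tri[of l i] l less.prems is_idealD(2)[OF K] by auto
    next
      case False
      hence "w l \<in> K" using less.hyps[of l] l less.prems by auto
      thus ?thesis by (rule is_idealD(3)[OF K])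
    qed
  qed
  moreover have "(\<Sum>l<m. w l * fps_nth (Q l) i) = w i * of_int c + (\<Sum>l\<in>{..<m} - {i}. w l * fps_nth (Q l) i)"
    using less.prems c by (subst sum.remove[of _ i]) auto
  ultimately have "w i * of_int c \<in> K"
    using mem[OF less.prems] add_subgroupD(2)[OF is_idealD(1)[OF K]] by (metis add_diff_cancel_right')
  hence "w i * of_int c * of_int e \<in> K" by (rule is_idealD(3)[OF K])
  from add_subgroupD(4)[OF is_idealD(1)[OF K] this e[of "w i"]] show ?case by simp
qed

text \<open>Elimination of the top coefficient, degree by degree. The leading degrees may occur in
  any order, since the cofactors of the structure theorem are ordered by \<open>basis_degree\<close>
  and not by their index.\<close>

lemma triangular_span:
  fixes K :: "'a::comm_ring_1 set" and B :: "nat \<Rightarrow> 'a fps"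
  assumes K: "is_ideal K" and p: "of_nat p \<in> K"
    and lead: "\<And>e. e < m \<Longrightarrow> \<exists>i<m. (\<exists>c. fps_nth (B i) e = of_int c \<and> coprime c (int p)) \<and>
        (\<forall>l. e < l \<longrightarrow> l < m \<longrightarrow> fps_nth (B i) l \<in> K)"
  shows "\<exists>w. \<forall>l<m. fps_nth (u - (\<Sum>i<m. fps_const (w i) * B i)) l \<in> K"
proof -
  note G = add_subgroupD[OF is_idealD(1)[OF K]]
  have "\<forall>u. (\<forall>l. e \<le> l \<longrightarrow> l < m \<longrightarrow> fps_nth u l \<in> K) \<longrightarrow>
     (\<exists>w. \<forall>l<m. fps_nth (u - (\<Sum>i<m. fps_const (w i) * B i)) l \<in> K)" if "e \<le> m" for e
    using that
  proof (induction e)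
    case 0
    show ?case by (intro allI impI exI[of _ "\<lambda>_. 0"]) auto
  next
    case (Suc e)
    show ?case
    proof (intro allI impI)
      fix u :: "'a fps" assume u: "\<forall>l. Suc e \<le> l \<longrightarrow> l < m \<longrightarrow> fps_nth u l \<in> K"
      obtain i c where i: "i < m" "fps_nth (B i) e = of_int c" "coprime c (int p)"
        "\<forall>l. e < l \<longrightarrow> l < m \<longrightarrow> fps_nth (B i) l \<in> K" using lead[of e] Suc.prems by auto
      obtain f where f: "\<And>x. x - x * of_int c * of_int f \<in> K" using ideal_coprime_cancel[OF K p i(3)] by blast
      define t where "t = fps_nth u e * of_int f"
      define u' where "u' = u - fps_const t * B i"
      have "fps_nth u' l \<in> K" if "e \<le> l" "l < m" for l
      proof (cases "l = e")
        case True
        thus ?thesis using f[of "fps_nth u e"] by (simp add: u'_def t_def i(2) algebra_simps)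
      next
        case False
        thus ?thesis using that u i(4) is_idealD(2)[OF K] G(2) by (auto simp: u'_def)
      qed
      then obtain w where w: "\<forall>l<m. fps_nth (u' - (\<Sum>i<m. fps_const (w i) * B i)) l \<in> K"
        using Suc by fastforce
      have "(\<Sum>j<m. fps_const ((w(i := w i + t)) j) * B j) = fps_const t * B i + (\<Sum>j<m. fps_const (w j) * B j)"
      proof -
        have "(\<Sum>j<m. fps_const ((w(i := w i + t)) j) * B j)
          = (\<Sum>j<m. (if j = i then fps_const t * B i else 0) + fps_const (w j) * B j)"
          by (intro sum.cong refl) (auto simp: algebra_simps fps_const_add[symmetric] simp del: fps_const_add)
        also have "\<dots> = fps_const t * B i + (\<Sum>j<m. fps_const (w j) * B j)"
          using i(1) by (simp add: sum.distrib)
        finally show ?thesis .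
      qed
      hence "u - (\<Sum>j<m. fps_const ((w(i := w i + t)) j) * B j) = u' - (\<Sum>i<m. fps_const (w i) * B i)"
        by (simp add: u'_def)
      thus "\<exists>w. \<forall>l<m. fps_nth (u - (\<Sum>i<m. fps_const (w i) * B i)) l \<in> K" using w by metis
    qed
  qed
  from this[of m] show ?thesis by simp
qed

subsection \<open>Even power series\<close>

text \<open>The series with coefficients \<open>f\<close> in X = x^2. All identities live in X; an
  odd factor x^r is multiplied on afterwards.\<close>

definition even_fps :: "(nat \<Rightarrow> 'a::comm_ring_1) \<Rightarrow> 'a fps"
  where "even_fps f = Abs_fps (\<lambda>l. if even l then f (l div 2) else 0)"

lemma even_fps_mult:
  "even_fps f * even_fps h = even_fps (\<lambda>s. \<Sum>j\<le>s. f j * h (s - j))"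
proof (rule fps_ext)
  fix l
  show "fps_nth (even_fps f * even_fps h) l = fps_nth (even_fps (\<lambda>s. \<Sum>j\<le>s. f j * h (s - j))) l"
  proof (cases "even l")
    case True
    then obtain s where s: "l = 2 * s" by (elim evenE)
    have "fps_nth (even_fps f * even_fps h) l = (\<Sum>i\<in>(*) 2 ` {..s}. f (i div 2) * h ((2 * s - i) div 2))"
      unfolding fps_mult_nth s
    proof (rule sum.mono_neutral_cong_right)
      show "\<forall>i\<in>{0..2 * s} - (*) 2 ` {..s}. fps_nth (even_fps f) i * fps_nth (even_fps h) (2 * s - i) = 0"
      proof
        fix i assume i: "i \<in> {0..2 * s} - (*) 2 ` {..s}"
        have "odd i"
        proof
          assume "even i"
          then obtain j where "i = 2 * j" by (elim evenE)
          thus False using i by auto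
        qed
        thus "fps_nth (even_fps f) i * fps_nth (even_fps h) (2 * s - i) = 0" by (simp add: even_fps_def)
      qed
    qed (auto simp: even_fps_def)
    also have "\<dots> = (\<Sum>j\<le>s. f j * h (s - j))"
      by (subst sum.reindex) (auto simp: inj_on_def diff_mult_distrib2[symmetric])
    finally show ?thesis using s by (simp add: even_fps_def)
  next
    case False
    have "fps_nth (even_fps f) i * fps_nth (even_fps h) (l - i) = 0" if "i \<le> l" for i
      using False that by (cases "even i") (auto simp: even_fps_def)
    thus ?thesis using False by (simp add: fps_mult_nth even_fps_def)
  qed
qed

lemma even_fps_power:
  "(fps_X ^ 2 + fps_const g) ^ k = even_fps (\<lambda>s. of_nat (k choose s) * g ^ (k - s))"
proof (rule fps_ext)
  fix l
  have "fps_nth ((fps_X ^ 2 + fps_const g) ^ k) l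
     = (\<Sum>i\<le>k. fps_nth (fps_const (of_nat (k choose i) * g ^ (k - i)) * fps_X ^ (2 * i)) l)"
    by (subst binomial_ring) (simp add: fps_sum_nth fps_const_power[symmetric] fps_of_nat[symmetric]
        power_mult[symmetric] algebra_simps fps_const_mult[symmetric] del: fps_const_mult fps_const_power fps_of_nat)
  also have "\<dots> = (\<Sum>i\<le>k. if l = 2 * i then of_nat (k choose i) * g ^ (k - i) else 0)"
    by (intro sum.cong refl) (auto simp: fps_X_power_iff)
  also have "\<dots> = fps_nth (even_fps (\<lambda>s. of_nat (k choose s) * g ^ (k - s))) l"
  proof (cases "even l")
    case True
    then obtain s where "l = 2 * s" by (elim evenE)
    thus ?thesis by (auto simp: even_fps_def binomial_eq_0)
  next
    case False
    thus ?thesis by (auto simp: even_fps_def intro!: sum.neutral)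
  qed
  finally show "fps_nth ((fps_X ^ 2 + fps_const g) ^ k) l = \<dots>" .
qed

text \<open>The Pade identity made homogeneous of degree k + n in X = x^2 and g. The numerator has
  degree m only, so g^(k + n - m) splits off; this exponent becomes the size of a Jordan
  block.\<close>

lemma pade_even_fps:
  fixes g :: "'a::comm_ring_1"
  assumes "m < k" "s \<le> m + n"
  shows "fps_nth ((fps_X ^ 2 + fps_const g) ^ k *
      even_fps (\<lambda>j. if j \<le> n then of_int ((-1) ^ j * int ((k - m + j - 1) choose j) * int ((m + n - j) choose m)) * g ^ (n - j) else 0)) (2 * s)
    = g ^ (k + n - m) * (if s \<le> m then of_int (int (((m + n - s) choose n) * ((k + n) choose s))) * g ^ (m - s) else 0)"
proof -
  let ?b = "\<lambda>j. (-1) ^ j * int ((k - m + j - 1) choose j) * int ((m + n - j) choose m)"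
  have "fps_nth ((fps_X ^ 2 + fps_const g) ^ k * even_fps (\<lambda>j. if j \<le> n then of_int (?b j) * g ^ (n - j) else 0)) (2 * s)
     = (\<Sum>j\<le>s. (if j \<le> n then of_int (?b j) * g ^ (n - j) else 0) * (of_nat (k choose (s - j)) * g ^ (k - (s - j))))"
    unfolding even_fps_power by (subst mult.commute) (simp only: even_fps_mult, simp add: even_fps_def)
  also have "\<dots> = (\<Sum>j\<le>s. g ^ (k + n - s) * of_int (int (k choose (s - j)) * ?b j))"
  proof (rule sum.cong[OF refl])
    fix j assume j: "j \<in> {..s}"
    show "(if j \<le> n then of_int (?b j) * g ^ (n - j) else 0) * (of_nat (k choose (s - j)) * g ^ (k - (s - j)))
      = g ^ (k + n - s) * of_int (int (k choose (s - j)) * ?b j)"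
    proof (cases "j \<le> n \<and> s - j \<le> k")
      case True
      hence "k + n - s = (n - j) + (k - (s - j))" using j by auto
      hence "g ^ (k + n - s) = g ^ (n - j) * g ^ (k - (s - j))" by (simp only: power_add)
      thus ?thesis using True by (simp add: algebra_simps)
    next
      case False
      \<comment> \<open>Truncated exponents do no harm here: if s - j > k or j > n, one of the
        binomials is zero.\<close>
      show ?thesis
      proof (cases "j \<le> n")
        case True
        thus ?thesis using False by (simp add: binomial_eq_0)
      next
        case F: False
        hence "m + n - j < m" using j assms by auto
        thus ?thesis using F by (simp add: binomial_eq_0)
      qed
    qed
  qed
  also have "\<dots> = g ^ (k + n - s) * of_int (\<Sum>j\<le>s. int (k choose (s - j)) * ?b j)"
    by (simp only: sum_distrib_left of_int_sum)
  also have "(\<Sum>j\<le>s. int (k choose (s - j)) * ?b j) = int (((m + n - s) choose n) * ((k + n) choose s))"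
    by (rule pade_binomial[OF assms(2,1)])
  also have "g ^ (k + n - s) * of_int \<dots> = g ^ (k + n - m) * (if s \<le> m then of_int (int (((m + n - s) choose n) * ((k + n) choose s))) * g ^ (m - s) else 0)"
  proof (cases "s \<le> m")
    case True
    hence "g ^ (k + n - s) = g ^ (k + n - m) * g ^ (m - s)" using assms by (simp add: power_add[symmetric])
    thus ?thesis using True by (simp add: algebra_simps)
  next
    case False
    hence "m + n - s < n" using assms by auto
    thus ?thesis using False by (simp add: binomial_eq_0)
  qed
  finally show ?thesis .
qed

subsection \<open>The structure theorem\<close>

text \<open>
  For \<open>i = 2d + r\<close> with \<open>r < 2\<close>, and \<open>a = \<lceil>(p - r) / 2\<rceil>\<close>, the numbers below belong to the summand
  \<open>x\<^sup>r F[X, T] / (X\<^sup>a, (X + T)\<^sup>k)\<close> with \<open>X = x\<^sup>2\<close>: the size of its \<open>d\<close>-th Jordan block for \<open>T\<close>, and the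
  \<open>x\<close>-degree of the cofactor \<open>B\<close> in \<open>(X + T)\<^sup>k B = T\<^bsup>size\<^esup> Q\<close>, where \<open>Q\<close> generates that block.
\<close>

definition jordan_size :: "nat \<Rightarrow> nat \<Rightarrow> nat \<Rightarrow> nat"
  where "jordan_size p k i = (let d = i div 2; a = (p + 1 - i mod 2) div 2 in
    if d + p < a + k then p else if d < k then a + k - 1 - 2 * d else 0)"

definition basis_degree :: "nat \<Rightarrow> nat \<Rightarrow> nat \<Rightarrow> nat"
  where "basis_degree p k i = (let d = i div 2; a = (p + 1 - i mod 2) div 2 in
    i mod 2 + 2 * (if d + p < a + k then d + p - k else if d < k then a - 1 - d else d - k))"

text \<open>For each parity r the three cases (a shift by p - k, a reflection, a shift by -k) tile
  the range below \<open>a\<close>; the witness \<open>d\<close> inverts them. Hence the cofactors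
  have every leading degree below p and span modulo x^p.\<close>

lemma basis_degree_surj:
  assumes "odd p" "k \<le> p" "e < p"
  shows "\<exists>i<p. basis_degree p k i = e"
proof -
  define d' where "d' = e div 2"
  define r where "r = e mod 2"
  define a where "a = (p + 1 - r) div 2"
  have e: "e = 2 * d' + r" and r: "r < 2" by (auto simp: d'_def r_def)
  obtain h where h: "p = 2 * h + 1" using assms(1) by (elim oddE)
  have a: "r = 0 \<and> a = h + 1 \<or> r = 1 \<and> a = h" using r by (auto simp: a_def h less_2_cases_iff)
  have d': "d' < a" using a e assms(3) h by auto
  define d where "d = (if d' + k < a then d' + k else if p \<le> d' + k then d' + k - p else a - 1 - d')"
  have d: "d < a" using d' assms(2) a h by (auto simp: d_def)
  have i: "2 * d + r < p" using d a h by auto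
  have "(2 * d + r) div 2 = d" "(2 * d + r) mod 2 = r" using r by auto
  hence "basis_degree p k (2 * d + r) = r + 2 * (if d + p < a + k then d + p - k else if d < k then a - 1 - d else d - k)"
    by (simp add: basis_degree_def a_def Let_def)
  also have "(if d + p < a + k then d + p - k else if d < k then a - 1 - d else d - k) = d'"
    using d' assms(2) a h by (auto simp: d_def)
  finally show ?thesis using i e by (intro exI[of _ "2 * d + r"]) auto
qed

lemma jordan_size_le: "jordan_size p k i \<le> p"
proof -
  define d where "d = i div 2"
  define a where "a = (p + 1 - i mod 2) div 2"
  have "jordan_size p k i = (if d + p < a + k then p else if d < k then a + k - 1 - 2 * d else 0)"
    unfolding jordan_size_def Let_def d_def a_def ..
  thus ?thesis by auto
qed

lemma binomial_coprime_prime: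
  assumes "Factorial_Ring.prime p" "N < p" "r \<le> N"
  shows "coprime (int (N choose r)) (int p)"
proof -
  have "\<not> p dvd fact N" using assms by (simp add: prime_dvd_fact_iff)
  hence "\<not> p dvd (N choose r)" using binomial_fact_lemma[OF assms(3)] by (metis dvd_mult)
  hence "coprime p (N choose r)" using assms(1) by (simp add: prime_imp_coprime)
  thus ?thesis by (simp add: coprime_commute)
qed

text \<open>The error term stays explicit because the ring need not have characteristic p; it
  disappears modulo an ideal containing p.\<close>

lemma freshman:
  fixes x y :: "'a::comm_ring_1"
  assumes "Factorial_Ring.prime p"
  shows "\<exists>r. (x + y) ^ p = x ^ p + y ^ p + of_nat p * r"
proof -
  have p: "p > 1" using assms prime_gt_1_nat by blast
  have "(x + y) ^ p = (\<Sum>i\<le>p. of_nat (p choose i) * x ^ i * y ^ (p - i))" by (rule binomial_ring)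
  also have "\<dots> = (\<Sum>i\<in>{0,p}. of_nat (p choose i) * x ^ i * y ^ (p - i)) +
      (\<Sum>i\<in>{..p} - {0,p}. of_nat (p choose i) * x ^ i * y ^ (p - i))"
    by (subst sum.subset_diff[of "{0,p}"]) (auto simp: add.commute)
  also have "(\<Sum>i\<in>{..p} - {0,p}. of_nat (p choose i) * x ^ i * y ^ (p - i))
     = (\<Sum>i\<in>{..p} - {0,p}. of_nat p * (of_nat ((p choose i) div p) * x ^ i * y ^ (p - i)))"
  proof (rule sum.cong[OF refl])
    fix i assume "i \<in> {..p} - {0,p}"
    hence "p dvd (p choose i)" using assms by (intro dvd_choose_prime) auto
    hence "(of_nat (p choose i) :: 'a) = of_nat p * of_nat ((p choose i) div p)"
      by (metis dvd_mult_div_cancel of_nat_mult)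
    thus "of_nat (p choose i) * x ^ i * y ^ (p - i) = of_nat p * (of_nat ((p choose i) div p) * x ^ i * y ^ (p - i))"
      by (simp add: mult.assoc)
  qed
  also have "(\<Sum>i\<in>{0,p}. of_nat (p choose i) * x ^ i * y ^ (p - i)) = x ^ p + y ^ p"
    using p by simp
  finally show ?thesis by (auto simp: sum_distrib_left[symmetric])
qed

lemma even_fps_nth [simp]: "fps_nth (even_fps f) (2 * s) = f s" "odd l \<Longrightarrow> fps_nth (even_fps f) l = 0"
  by (auto simp: even_fps_def)

text \<open>
  The large blocks come from \<open>(X + T)\<^sup>p = X\<^sup>p + T\<^sup>p\<close>, the trivial ones from multiples of \<open>(X + T)\<^sup>k\<close>,
  and the others from the Pade approximants.
\<close>

lemma structure_basis:
  fixes K :: "'a::comm_ring_1 set"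
  assumes p: "Factorial_Ring.prime p" "odd p" and k: "k \<le> p" and K: "is_ideal K" "of_nat p \<in> K" and i: "i < p"
  shows "\<exists>Q B c c'. (\<forall>l<p. fps_nth ((fps_X ^ 2 + fps_const g) ^ k * B - fps_const (g ^ jordan_size p k i) * Q) l \<in> K)
    \<and> (\<forall>l>i. fps_nth Q l = 0) \<and> fps_nth Q i = of_int c \<and> coprime c (int p)
    \<and> (\<forall>l>basis_degree p k i. fps_nth B l = 0) \<and> fps_nth B (basis_degree p k i) = of_int c' \<and> coprime c' (int p)"
proof -
  define d where "d = i div 2"
  define r where "r = i mod 2"
  define a where "a = (p + 1 - r) div 2"
  have ir: "i = 2 * d + r" and r: "r < 2" by (auto simp: d_def r_def)
  obtain h where h: "p = 2 * h + 1" using p(2) by (elim oddE)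
  have a: "r = 0 \<and> a = h + 1 \<or> r = 1 \<and> a = h" using r by (auto simp: a_def h less_2_cases_iff)
  have da: "d < a" using a ir i h by auto
  have j: "jordan_size p k i = (if d + p < a + k then p else if d < k then a + k - 1 - 2 * d else 0)"
    unfolding jordan_size_def Let_def d_def r_def a_def ..
  have b: "basis_degree p k i = r + 2 * (if d + p < a + k then d + p - k else if d < k then a - 1 - d else d - k)"
    unfolding basis_degree_def Let_def d_def r_def a_def ..
  let ?U = "fps_X ^ 2 + fps_const g :: 'a fps"
  note G = add_subgroupD[OF is_idealD(1)[OF K(1)]]
  have U_nth: "fps_nth (?U ^ N) (2 * N) = 1" "l > 2 * N \<Longrightarrow> fps_nth (?U ^ N) l = 0" for N l
  proof -
    show "fps_nth (?U ^ N) (2 * N) = 1" by (simp add: even_fps_power)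
    assume l: "l > 2 * N"
    show "fps_nth (?U ^ N) l = 0"
    proof (cases "even l")
      case True
      then obtain s where "l = 2 * s" by (elim evenE)
      thus ?thesis using l by (simp add: even_fps_power binomial_eq_0)
    qed (simp add: even_fps_power)
  qed
  consider (A) "d + p < a + k" | (B) "\<not> d + p < a + k" "d < k" | (C) "\<not> d + p < a + k" "\<not> d < k" by blast
  thus ?thesis
  proof cases
    case A
    \<comment> \<open>Then \<open>?U ^ k * B\<close> is \<open>fps_X ^ i * ?U ^ p\<close>, whose
      part \<open>fps_X ^ (2 * p + i)\<close> lies beyond the degrees below p.\<close>
    define B where "B = fps_X ^ i * ?U ^ (p - k)"
    obtain R where R: "?U ^ p = (fps_X ^ 2) ^ p + fps_const g ^ p + of_nat p * R" using freshman[OF p(1)] by blast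
    have "?U ^ k * B - fps_const (g ^ p) * fps_X ^ i = fps_X ^ i * (?U ^ (k + (p - k)) - fps_const (g ^ p))"
      by (simp add: B_def power_add algebra_simps)
    also have "\<dots> = fps_X ^ i * ((fps_X ^ 2) ^ p + fps_const g ^ p + of_nat p * R - fps_const (g ^ p))"
      using k by (simp only: R le_add_diff_inverse)
    also have "\<dots> = fps_X ^ (2 * p + i) + fps_const (of_nat p) * (fps_X ^ i * R)"
      by (simp add: fps_const_power power_mult[symmetric] power_add algebra_simps fps_of_nat)
    finally have "fps_nth (?U ^ k * B - fps_const (g ^ p) * fps_X ^ i) l \<in> K" if "l < p" for l
      using that is_idealD(3)[OF K(1,2)] by (simp add: fps_X_power_iff)
    moreover have "basis_degree p k i = i + 2 * (p - k)" unfolding b using A k ir by simp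
    moreover have "fps_nth B l = 0" if "l > i + 2 * (p - k)" for l
      using that U_nth(2)[of "p - k" "l - i"] by (auto simp: B_def fps_X_power_mult_nth)
    moreover have "fps_nth B (i + 2 * (p - k)) = of_int 1"
      by (simp add: B_def fps_X_power_mult_nth U_nth)
    ultimately show ?thesis using A
      by (intro exI[of _ "fps_X ^ i"] exI[of _ B] exI[of _ 1]) (auto simp: j fps_X_power_iff)
  next
    case C
    define Q where "Q = fps_X ^ (r + 2 * (d - k)) * ?U ^ k"
    have "?U ^ k * fps_X ^ (r + 2 * (d - k)) - Q = 0" by (simp add: Q_def)
    hence "fps_nth (?U ^ k * fps_X ^ (r + 2 * (d - k)) - fps_const (g ^ jordan_size p k i) * Q) l \<in> K" for l
      using C G(1) by (simp add: j)
    moreover have "i = r + 2 * (d - k) + 2 * k" using C ir by simp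
    hence "\<forall>l>i. fps_nth Q l = 0" "fps_nth Q i = of_int 1"
      by (auto simp: Q_def fps_X_power_mult_nth U_nth)
    moreover have "basis_degree p k i = r + 2 * (d - k)" using C by (simp add: b)
    ultimately show ?thesis
      by (intro exI[of _ Q] exI[of _ "fps_X ^ (r + 2 * (d - k))"] exI[of _ 1]) (auto simp: fps_X_power_iff)
  next
    case B
    \<comment> \<open>With numerator degree \<open>d\<close> and d + n = a - 1, the Pade identity
      covers all X-degrees below \<open>a\<close>, hence after the shift by x^r all x-degrees below
      p.\<close>
    define n where "n = a - 1 - d"
    have an: "a = d + n + 1" using da by (simp add: n_def)
    define P where "P = even_fps (\<lambda>s. if s \<le> d then of_int (int (((d + n - s) choose n) * ((k + n) choose s))) * g ^ (d - s) else 0)"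
    define D where "D = even_fps (\<lambda>j. if j \<le> n then of_int ((-1) ^ j * int ((k - d + j - 1) choose j) * int ((d + n - j) choose d)) * g ^ (n - j) else 0)"
    have eq: "fps_nth (?U ^ k * D) l = g ^ (k + n - d) * fps_nth P l" if "l < 2 * a" for l
    proof (cases "even l")
      case True
      then obtain s where s: "l = 2 * s" by (elim evenE)
      show ?thesis unfolding s D_def P_def using B an that s
        by (subst pade_even_fps) auto
    next
      case False
      have "?U ^ k * D = even_fps (\<lambda>s. \<Sum>j\<le>s. (of_nat (k choose j) * g ^ (k - j)) * (if s - j \<le> n then of_int ((-1) ^ (s - j) * int ((k - d + (s - j) - 1) choose (s - j)) * int ((d + n - (s - j)) choose d)) * g ^ (n - (s - j)) else 0))"
        unfolding D_def even_fps_power even_fps_mult ..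
      thus ?thesis using False by (simp add: P_def)
    qed
    have jj: "jordan_size p k i = k + n - d" using B an by (simp add: j)
    have bb: "basis_degree p k i = r + 2 * n" using B by (simp add: b n_def)
    have P0: "fps_nth P l = 0" if "l > 2 * d" for l
      using that by (cases "even l") (auto simp: P_def elim!: evenE)
    have D0: "fps_nth D l = 0" if "l > 2 * n" for l
      using that by (cases "even l") (auto simp: D_def elim!: evenE)
    have PL: "fps_nth P (2 * d) = of_int (int ((k + n) choose d))" by (simp add: P_def)
    have DL: "fps_nth D (2 * n) = of_int ((-1) ^ n * int ((k - d + n - 1) choose n))" by (simp add: D_def)
    \<comment> \<open>Because a = d + n + 1, the bound k + n < p is exactly the failure of the
      condition of the first case.\<close>
    have c1: "coprime (int ((k + n) choose d)) (int p)"
      using B an by (intro binomial_coprime_prime[OF p(1)]) auto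
    have "coprime (int ((k - d + n - 1) choose n)) (int p)"
      using B an by (intro binomial_coprime_prime[OF p(1)]) auto
    hence c2: "coprime ((-1) ^ n * int ((k - d + n - 1) choose n)) (int p)"
      by (cases "even n") auto
    have "fps_nth (?U ^ k * (fps_X ^ r * D) - fps_const (g ^ jordan_size p k i) * (fps_X ^ r * P)) l \<in> K" if "l < p" for l
    proof -
      have "?U ^ k * (fps_X ^ r * D) - fps_const (g ^ jordan_size p k i) * (fps_X ^ r * P)
         = fps_X ^ r * (?U ^ k * D - fps_const (g ^ jordan_size p k i) * P)" by (simp add: algebra_simps)
      also have "fps_nth \<dots> l = 0"
      proof (cases "l < r")
        case False
        hence "l - r < 2 * a" using that a h by auto
        thus ?thesis using eq[of "l - r"] by (auto simp: fps_X_power_mult_nth jj)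
      qed (simp add: fps_X_power_mult_nth)
      finally show ?thesis using G(1) by simp
    qed
    moreover have "\<forall>l>i. fps_nth (fps_X ^ r * P) l = 0" using P0 ir by (auto simp: fps_X_power_mult_nth)
    moreover have "fps_nth (fps_X ^ r * P) i = of_int (int ((k + n) choose d))"
      using PL ir by (simp add: fps_X_power_mult_nth)
    moreover have "\<forall>l>basis_degree p k i. fps_nth (fps_X ^ r * D) l = 0" using D0 bb by (auto simp: fps_X_power_mult_nth)
    moreover have "fps_nth (fps_X ^ r * D) (basis_degree p k i) = of_int ((-1) ^ n * int ((k - d + n - 1) choose n))"
      using DL bb by (simp add: fps_X_power_mult_nth)
    ultimately show ?thesis using c1 c2 by blast
  qed
qed

text \<open>In the bases \<open>B\<close> (source) and \<open>Q\<close> (target), multiplication by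
  (x^2 + g)^k is diagonal modulo \<open>K\<close> and x^p, with entries
  g^\<open>jordan_size\<close>. The quotient therefore splits into cyclic pieces, and the factor
  \<open>c\<close> is carried along unchanged.\<close>

lemma structure_theorem:
  fixes K :: "'a::comm_ring_1 set" and c g :: 'a
  assumes p: "Factorial_Ring.prime p" "odd p" and k: "k \<le> p" and K: "is_ideal K" "of_nat p \<in> K"
  shows "quotient_index {u. \<exists>v. \<forall>l<p. fps_nth (u - fps_const c * (fps_X ^ 2 + fps_const g) ^ k * v) l \<in> K}
    = (\<Prod>i<p. quotient_index {w. \<exists>v. w - c * g ^ jordan_size p k i * v \<in> K})"
proof -
  let ?U = "fps_X ^ 2 + fps_const g :: 'a fps"
  note G = add_subgroupD[OF is_idealD(1)[OF K(1)]]
  define L where "L = (\<lambda>i. {w. \<exists>v. w - c * g ^ jordan_size p k i * v \<in> K})"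
  define I where "I = {u. \<exists>v. \<forall>l<p. fps_nth (u - fps_const c * ?U ^ k * v) l \<in> K}"
  define good where "good i Q B \<longleftrightarrow> (\<forall>l<p. fps_nth (?U ^ k * B - fps_const (g ^ jordan_size p k i) * Q) l \<in> K)
    \<and> (\<forall>l>i. fps_nth Q l = 0) \<and> (\<exists>c. fps_nth Q i = of_int c \<and> coprime c (int p))
    \<and> (\<forall>l>basis_degree p k i. fps_nth B l = 0) \<and> (\<exists>c. fps_nth B (basis_degree p k i) = of_int c \<and> coprime c (int p))" for i Q B
  have "\<exists>Q B. good i Q B" if "i < p" for i
    using structure_basis[OF p k K that, of g] unfolding good_def by (elim exE conjE) blast
  then obtain Q B where "\<And>i. i < p \<Longrightarrow> good i (Q i) (B i)" by metis
  hence QB: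
    "\<And>i l. i < p \<Longrightarrow> l < p \<Longrightarrow> fps_nth (?U ^ k * B i - fps_const (g ^ jordan_size p k i) * Q i) l \<in> K"
    "\<And>i l. i < p \<Longrightarrow> i < l \<Longrightarrow> fps_nth (Q i) l = 0"
    "\<And>i. i < p \<Longrightarrow> \<exists>c. fps_nth (Q i) i = of_int c \<and> coprime c (int p)"
    "\<And>i l. i < p \<Longrightarrow> basis_degree p k i < l \<Longrightarrow> fps_nth (B i) l = 0"
    "\<And>i. i < p \<Longrightarrow> \<exists>c. fps_nth (B i) (basis_degree p k i) = of_int c \<and> coprime c (int p)"
    unfolding good_def by blast+
  have spanQ: "\<exists>w. \<forall>l<p. fps_nth (u - (\<Sum>i<p. fps_const (w i) * Q i)) l \<in> K" for u
    by (rule triangular_span[OF K]) (use QB G(1) in auto)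
  have spanB: "\<exists>w. \<forall>l<p. fps_nth (u - (\<Sum>i<p. fps_const (w i) * B i)) l \<in> K" for u
  proof (rule triangular_span[OF K])
    fix e assume "e < p"
    then obtain i where "i < p" "basis_degree p k i = e" using basis_degree_surj[OF p(2) k] by blast
    thus "\<exists>i<p. (\<exists>c. fps_nth (B i) e = of_int c \<and> coprime c (int p)) \<and> (\<forall>l. e < l \<longrightarrow> l < p \<longrightarrow> fps_nth (B i) l \<in> K)"
      using QB(4,5) G(1) by metis
  qed
  have low: "fps_nth (f * x) l \<in> K" if "\<forall>l<p. fps_nth x l \<in> K" "l < p" for f x l
    unfolding fps_mult_nth using that
    by (intro add_subgroup_sum[OF is_idealD(1)[OF K(1)]] is_idealD(2)[OF K(1)]) auto
  \<comment> \<open>The diagonal form of multiplication by \<open>fps_const c * ?U ^ k\<close>, up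
    to an error with coefficients in \<open>K\<close>.\<close>
  have cvt: "fps_nth (fps_const c * ?U ^ k * (\<Sum>i<p. fps_const (w i) * B i)
      - (\<Sum>i<p. fps_const (c * g ^ jordan_size p k i * w i) * Q i)) l \<in> K" if "l < p" for w l
  proof -
    have "fps_const c * ?U ^ k * (\<Sum>i<p. fps_const (w i) * B i) - (\<Sum>i<p. fps_const (c * g ^ jordan_size p k i * w i) * Q i)
       = (\<Sum>i<p. fps_const (c * w i) * (?U ^ k * B i - fps_const (g ^ jordan_size p k i) * Q i))"
      unfolding sum_distrib_left sum_subtractf[symmetric]
      by (intro sum.cong refl) (simp add: algebra_simps fps_const_mult[symmetric] del: fps_const_mult)
    thus ?thesis using QB(1) that
      by (simp only: fps_sum_nth)
         (intro add_subgroup_sum[OF is_idealD(1)[OF K(1)]] low; simp)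
  qed
  have I: "add_subgroup I"
    unfolding add_subgroup_def
  proof (intro conjI ballI)
    show "0 \<in> I" by (auto simp: I_def intro!: exI[of _ 0] G)
    fix u u' assume "u \<in> I" "u' \<in> I"
    then obtain v v' where v: "\<forall>l<p. fps_nth (u - fps_const c * ?U ^ k * v) l \<in> K"
      "\<forall>l<p. fps_nth (u' - fps_const c * ?U ^ k * v') l \<in> K" by (auto simp: I_def)
    have "fps_nth ((u - u') - fps_const c * ?U ^ k * (v - v')) l \<in> K" if "l < p" for l
      using G(2)[OF v(1)[rule_format, OF that] v(2)[rule_format, OF that]] by (simp add: algebra_simps)
    thus "u - u' \<in> I" unfolding I_def by blast
  qed
  have L: "add_subgroup (L i)" for i
    unfolding add_subgroup_def
  proof (intro conjI ballI)
    show "0 \<in> L i" by (auto simp: L_def intro!: exI[of _ 0] G)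
    fix u u' assume "u \<in> L i" "u' \<in> L i"
    then obtain v v' where v: "u - c * g ^ jordan_size p k i * v \<in> K" "u' - c * g ^ jordan_size p k i * v' \<in> K"
      by (auto simp: L_def)
    have "(u - u') - c * g ^ jordan_size p k i * (v - v') \<in> K"
      using G(2)[OF v] by (simp add: algebra_simps)
    thus "u - u' \<in> L i" unfolding L_def by blast
  qed
  define \<Psi> where "\<Psi> = (\<lambda>w. \<Sum>i<p. fps_const (w i) * Q i)"
  have \<Psi>_diff: "\<Psi> (\<lambda>i. w i - w' i) = \<Psi> w - \<Psi> w'" for w w'
    by (simp add: \<Psi>_def sum_subtractf[symmetric] algebra_simps fps_const_sub[symmetric] del: fps_const_sub)
  have K_in_I: "u \<in> I" if "\<forall>l<p. fps_nth u l \<in> K" for u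
    using that unfolding I_def by (intro CollectI exI[of _ 0]) simp
  have "quotient_index I = (\<Prod>i<p. quotient_index (L i))"
  proof (rule quotient_index_prod[where \<Psi> = \<Psi>])
    show "\<exists>w. u - \<Psi> w \<in> I" for u
      using spanQ[of u] K_in_I unfolding \<Psi>_def by blast
    show "\<Psi> w \<in> I \<longleftrightarrow> (\<forall>i\<in>{..<p}. w i \<in> L i)" for w
    proof
      assume "\<Psi> w \<in> I"
      then obtain v where v: "\<And>l. l < p \<Longrightarrow> fps_nth (\<Psi> w - fps_const c * ?U ^ k * v) l \<in> K"
        by (auto simp: I_def)
      obtain b where b: "\<forall>l<p. fps_nth (v - (\<Sum>i<p. fps_const (b i) * B i)) l \<in> K" using spanB by blast
      define t where "t = (\<lambda>i. c * g ^ jordan_size p k i * b i)"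
      \<comment> \<open>Expanding the multiplier in the basis \<open>B\<close> yields a second
        \<open>Q\<close>-expansion of \<open>\<Psi> w\<close>; uniqueness modulo \<open>K\<close>
        then compares the coordinates.\<close>
      have "(\<Sum>i<p. (w i - t i) * fps_nth (Q i) l) \<in> K" if "l < p" for l
      proof -
        have "fps_nth (fps_const c * ?U ^ k * (v - (\<Sum>i<p. fps_const (b i) * B i))) l \<in> K"
          by (rule low[OF b that])
        from G(4)[OF v[OF that] G(4)[OF this cvt[OF that, of b]]]
        have "fps_nth (\<Psi> w - \<Psi> t) l \<in> K" by (simp add: algebra_simps \<Psi>_def t_def)
        thus ?thesis by (simp add: \<Psi>_diff[symmetric]) (simp add: \<Psi>_def fps_sum_nth)
      qed
      hence "w i - t i \<in> K" if "i < p" for i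
        by (intro triangular_unique[OF K, of p Q "\<lambda>i. w i - t i"]) (use QB(2,3) G(1) that in auto)
      thus "\<forall>i\<in>{..<p}. w i \<in> L i" by (auto simp: L_def t_def)
    next
      assume "\<forall>i\<in>{..<p}. w i \<in> L i"
      hence "\<forall>i. \<exists>b. i < p \<longrightarrow> w i - c * g ^ jordan_size p k i * b \<in> K" by (auto simp: L_def)
      then obtain b where b: "\<And>i. i < p \<Longrightarrow> w i - c * g ^ jordan_size p k i * b i \<in> K" by metis
      define t where "t = (\<lambda>i. c * g ^ jordan_size p k i * b i)"
      have "fps_nth (\<Psi> w - fps_const c * ?U ^ k * (\<Sum>i<p. fps_const (b i) * B i)) l \<in> K" if "l < p" for l
      proof -
        have "fps_nth (\<Psi> w - \<Psi> t) l \<in> K"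
          unfolding \<Psi>_diff[symmetric] unfolding \<Psi>_def fps_sum_nth using b
          by (intro add_subgroup_sum[OF is_idealD(1)[OF K(1)]]) (auto simp: t_def intro: is_idealD(3)[OF K(1)])
        from G(2)[OF this cvt[OF that, of b]] show ?thesis
          by (simp add: \<Psi>_def t_def algebra_simps)
      qed
      thus "\<Psi> w \<in> I" unfolding I_def by blast
    qed
  qed (use I L \<Psi>_diff in auto)
  thus ?thesis by (simp add: I_def L_def)
qed

subsection \<open>Three variables\<close>

text \<open>In \<open>int fps fps fps\<close> the outermost indeterminate is \<open>x\<close> and the innermost one is \<open>z\<close>.\<close>

definition coeff3 :: "'a::zero fps fps fps \<Rightarrow> nat \<Rightarrow> nat \<Rightarrow> nat \<Rightarrow> 'a"
  where "coeff3 u i j l = fps_nth (fps_nth (fps_nth u i) j) l"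

text \<open>The ideal (p, x^q, y^q, z^q) of Z[[x,y,z]].\<close>

definition p_box :: "nat \<Rightarrow> nat \<Rightarrow> int fps fps fps set"
  where "p_box p q = {u. \<forall>i<q. \<forall>j<q. \<forall>l<q. int p dvd coeff3 u i j l}"

text \<open>The preimage in Z[[x,y,z]] of the ideal (f^k, x^q, y^q, z^q) of F_p[[x,y,z]].\<close>

definition h_lift :: "nat \<Rightarrow> int fps fps fps \<Rightarrow> nat \<Rightarrow> nat \<Rightarrow> int fps fps fps set"
  where "h_lift p f k q = {u. \<exists>v. u - f ^ k * v \<in> p_box p q}"

definition D_poly :: "nat \<Rightarrow> int fps fps fps"
  where "D_poly n = fps_X ^ 2 + fps_const (fps_X ^ 2) * fps_const (fps_const fps_X) + fps_const (fps_const fps_X) ^ (n - 1)"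

text \<open>The inner \<open>jordan_size p k i\<close> diagonalizes in x, the nested one in y; the
  minimum with p is the length of F_p[[z]]/(z^p, z^J).\<close>

definition length_sum :: "nat \<Rightarrow> nat \<Rightarrow> nat \<Rightarrow> nat"
  where "length_sum M p k = (\<Sum>i<p. \<Sum>l<p. min p (jordan_size p k i + M * jordan_size p (jordan_size p k i) l))"

lemma coeff3_simps [simp]:
  "coeff3 (u + v) i j l = coeff3 u i j l + coeff3 v i j l" "coeff3 (u' - v') i j l = coeff3 u' i j l - coeff3 v' i j l"
  "coeff3 0 i j l = 0"
  for u v :: "'a::monoid_add fps fps fps" and u' v' :: "'b::group_add fps fps fps"
  by (auto simp: coeff3_def)

lemma is_idealI:
  assumes "0 \<in> K" "\<And>u v. u \<in> K \<Longrightarrow> v \<in> K \<Longrightarrow> u - v \<in> K" "\<And>r u. u \<in> K \<Longrightarrow> r * u \<in> K"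
  shows "is_ideal K"
  using assms by (auto simp: is_ideal_def add_subgroup_def)

lemma is_ideal_low_coeffs:
  assumes "is_ideal K"
  shows "is_ideal {u. \<forall>l<m::nat. fps_nth u l \<in> K}"
proof (rule is_idealI)
  note G = add_subgroupD[OF is_idealD(1)[OF assms]]
  show "0 \<in> {u. \<forall>l<m. fps_nth u l \<in> K}" using G by auto
  show "u - v \<in> {u. \<forall>l<m. fps_nth u l \<in> K}"
    if "u \<in> {u. \<forall>l<m. fps_nth u l \<in> K}" "v \<in> {u. \<forall>l<m. fps_nth u l \<in> K}" for u v
    using that G by auto
  show "r * u \<in> {u. \<forall>l<m. fps_nth u l \<in> K}" if "u \<in> {u. \<forall>l<m. fps_nth u l \<in> K}" for r u
    using that unfolding fps_mult_nth mem_Collect_eq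
    by (intro allI impI add_subgroup_sum[OF is_idealD(1)[OF assms]] is_idealD(2)[OF assms]) auto
qed

lemma is_ideal_dvd: "is_ideal {x::int. int p dvd x}"
  by (rule is_idealI) auto

text \<open>One condition per variable, the outermost first: the shape in which the structure
  theorem takes its ideal \<open>K\<close>.\<close>

lemma p_box_eq: "p_box p q = {u. \<forall>i<q. fps_nth u i \<in> {u. \<forall>j<q. fps_nth u j \<in> {u. \<forall>l<q. fps_nth u l \<in> {x. int p dvd x}}}}"
  by (auto simp: p_box_def coeff3_def)

lemma is_ideal_p_box: "is_ideal (p_box p q)"
  unfolding p_box_eq by (intro is_ideal_low_coeffs is_ideal_dvd)

lemma add_subgroup_h_lift: "add_subgroup (h_lift p f k q)"
  unfolding add_subgroup_def
proof (intro conjI ballI)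
  note G = add_subgroupD[OF is_idealD(1)[OF is_ideal_p_box[of p q]]]
  show "0 \<in> h_lift p f k q" using G(1) by (auto simp: h_lift_def intro!: exI[of _ 0])
  fix u u' assume "u \<in> h_lift p f k q" "u' \<in> h_lift p f k q"
  then obtain v v' where v: "u - f ^ k * v \<in> p_box p q" "u' - f ^ k * v' \<in> p_box p q"
    by (auto simp: h_lift_def)
  have "(u - u') - f ^ k * (v - v') \<in> p_box p q"
    using G(2)[OF v] by (simp add: algebra_simps)
  thus "u - u' \<in> h_lift p f k q" unfolding h_lift_def by blast
qed

lemma h_lift_antimono:
  assumes "k \<le> k'"
  shows "h_lift p f k' q \<subseteq> h_lift p f k q"
proof
  fix u assume "u \<in> h_lift p f k' q"
  then obtain v where "u - f ^ k' * v \<in> p_box p q" by (auto simp: h_lift_def)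
  moreover have "f ^ k' * v = f ^ k * (f ^ (k' - k) * v)"
    using assms by (simp add: mult.assoc[symmetric] power_add[symmetric])
  ultimately show "u \<in> h_lift p f k q" unfolding h_lift_def by auto
qed

lemma quotient_index_dvd:
  assumes "p > 0"
  shows "quotient_index {x::int. int p dvd x} = p"
proof -
  have "quotient_index {x::int. int p dvd x} = card (range (\<lambda>x::int. x mod int p))"
    by (rule quotient_index_eq_card_range)
      (auto simp: is_idealD(1)[OF is_ideal_dvd] mod_eq_dvd_iff)
  also have "range (\<lambda>x::int. x mod int p) = {0..<int p}"
  proof
    show "{0..<int p} \<subseteq> range (\<lambda>x::int. x mod int p)"
    proof
      fix x assume "x \<in> {0..<int p}"
      hence "x = x mod int p" by simp
      thus "x \<in> range (\<lambda>x::int. x mod int p)" by blast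
    qed
  qed (use assms in auto)
  finally show ?thesis by simp
qed

lemma quotient_index_dvd_coeffs:
  assumes "p > 0"
  shows "quotient_index {r::int fps. \<forall>l<m. int p dvd fps_nth r l} = p ^ m"
proof -
  have "quotient_index {r::int fps. \<forall>l<m. int p dvd fps_nth r l} = (\<Prod>l<m. quotient_index {x::int. int p dvd x})"
  proof (rule quotient_index_prod[where \<Psi> = "\<lambda>w. Abs_fps (\<lambda>l. if l < m then w l else 0)"])
    show "add_subgroup {r::int fps. \<forall>l<m. int p dvd fps_nth r l}"
      using is_idealD(1)[OF is_ideal_low_coeffs[OF is_ideal_dvd[of p], of m]] by simp
    show "\<exists>w. u - Abs_fps (\<lambda>l. if l < m then w l else 0) \<in> {r::int fps. \<forall>l<m. int p dvd fps_nth r l}" for u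
      by (rule exI[of _ "fps_nth u"]) auto
  qed (auto simp: is_idealD(1)[OF is_ideal_dvd] fps_eq_iff)
  thus ?thesis by (simp add: quotient_index_dvd[OF assms])
qed

text \<open>A block of size j for x leaves (g^j) modulo (p, y^p, z^p), where g^j = z^j (y^2 +
  z^M)^j. The second application takes c = z^j and z^M for g, and leaves powers of z alone.\<close>

lemma quotient_index_D_poly:
  assumes p: "Factorial_Ring.prime p" "odd p" and k: "k \<le> p" and n: "n \<ge> 2"
  shows "quotient_index (h_lift p (D_poly n) k p) = p ^ length_sum (n - 2) p k"
proof -
  have p0: "p > 0" using p(1) prime_gt_0_nat by blast
  define M where "M = n - 2"
  have M: "n - 1 = Suc M" using n by (simp add: M_def)
  define K1 where "K1 = {r::int fps. \<forall>l<p. fps_nth r l \<in> {x. int p dvd x}}"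
  define K2 where "K2 = {w::int fps fps. \<forall>j<p. fps_nth w j \<in> K1}"
  have K1: "is_ideal K1" "of_nat p \<in> K1"
    unfolding K1_def by (intro is_ideal_low_coeffs is_ideal_dvd) (auto simp: fps_of_nat[symmetric])
  have K2: "is_ideal K2" "of_nat p \<in> K2"
  proof -
    show "is_ideal K2" unfolding K2_def by (intro is_ideal_low_coeffs K1)
    show "of_nat p \<in> K2"
      unfolding K2_def using K1 add_subgroupD(1)[OF is_idealD(1)[OF K1(1)]] by (auto simp: fps_of_nat[symmetric] simp del: fps_of_nat)
  qed
  define g :: "int fps fps" where "g = fps_const fps_X * (fps_X ^ 2 + fps_const (fps_X ^ M))"
  have Dg: "D_poly n = fps_X ^ 2 + fps_const g"
    unfolding D_poly_def M g_def by (simp add: algebra_simps fps_const_mult[symmetric] fps_const_add[symmetric] fps_const_power[symmetric]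
      del: fps_const_mult fps_const_add fps_const_power)
  have "h_lift p (D_poly n) k p = {u. \<exists>v. \<forall>l<p. fps_nth (u - fps_const 1 * (fps_X ^ 2 + fps_const g) ^ k * v) l \<in> K2}"
    by (simp add: h_lift_def p_box_eq K2_def K1_def Dg)
  hence "quotient_index (h_lift p (D_poly n) k p) = (\<Prod>i<p. quotient_index {w. \<exists>v. w - 1 * g ^ jordan_size p k i * v \<in> K2})"
    by (simp only: structure_theorem[OF p k K2])
  also have "\<dots> = (\<Prod>i<p. \<Prod>l<p. p ^ min p (jordan_size p k i + M * jordan_size p (jordan_size p k i) l))"
  proof (rule prod.cong[OF refl])
    fix i assume "i \<in> {..<p}"
    define j where "j = jordan_size p k i"
    have j: "j \<le> p" by (simp add: j_def jordan_size_le)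
    have "1 * g ^ j = fps_const (fps_X ^ j) * (fps_X ^ 2 + fps_const (fps_X ^ M)) ^ j"
      by (simp add: g_def power_mult_distrib fps_const_power[symmetric] del: fps_const_power)
    hence "{w. \<exists>v. w - 1 * g ^ j * v \<in> K2}
      = {w. \<exists>v. \<forall>b<p. fps_nth (w - fps_const (fps_X ^ j) * (fps_X ^ 2 + fps_const (fps_X ^ M)) ^ j * v) b \<in> K1}"
      by (simp add: K2_def)
    hence "quotient_index {w. \<exists>v. w - 1 * g ^ j * v \<in> K2}
      = (\<Prod>l<p. quotient_index {r. \<exists>v. r - fps_X ^ j * (fps_X ^ M) ^ jordan_size p j l * v \<in> K1})"
      by (simp only: structure_theorem[OF p j K1])
    also have "\<dots> = (\<Prod>l<p. p ^ min p (j + M * jordan_size p j l))"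
    proof (rule prod.cong[OF refl])
      fix l assume "l \<in> {..<p}"
      define J where "J = j + M * jordan_size p j l"
      have "{r. \<exists>v. r - fps_X ^ j * (fps_X ^ M) ^ jordan_size p j l * v \<in> K1} = {r. \<exists>v. r - fps_X ^ J * v \<in> K1}"
        by (simp add: J_def power_add power_mult)
      also have "\<dots> = {r. \<forall>l<min p J. int p dvd fps_nth r l}"
      proof (safe, goal_cases)
        case (1 r v l)
        hence "int p dvd fps_nth (r - fps_X ^ J * v) l" by (auto simp: K1_def)
        thus ?case using 1 by (simp add: fps_X_power_mult_nth)
      next
        \<comment> \<open>Subtracting z^J times the shifted tail keeps only the coefficients below
          J, which are divisible by p where it matters.\<close>
        case (2 r)
        show ?case
          by (rule exI[of _ "fps_shift J r"]) (use 2 in \<open>auto simp: K1_def fps_X_power_mult_nth\<close>)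
      qed
      finally show "quotient_index {r. \<exists>v. r - fps_X ^ j * (fps_X ^ M) ^ jordan_size p j l * v \<in> K1} = p ^ min p (j + M * jordan_size p j l)"
        by (simp only: quotient_index_dvd_coeffs[OF p0] J_def)
    qed
    finally show "quotient_index {w. \<exists>v. w - 1 * g ^ jordan_size p k i * v \<in> K2} = (\<Prod>l<p. p ^ min p (jordan_size p k i + M * jordan_size p (jordan_size p k i) l))"
      by (simp add: j_def)
  qed
  also have "\<dots> = p ^ length_sum M p k"
    by (simp add: length_sum_def power_sum)
  finally show ?thesis by (simp add: M_def)
qed

subsection \<open>The Frobenius endomorphism\<close>

text \<open>The coordinate of \<open>u\<close> at x^a y^b z^e when Z[[x,y,z]] is viewed as a free
  module over Z[[x^p,y^p,z^p]], with p-th powers of the variables renamed back to the variables;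
  \<open>assemble\<close> is the inverse.\<close>

definition frob_component :: "nat \<Rightarrow> int fps fps fps \<Rightarrow> nat \<times> nat \<times> nat \<Rightarrow> int fps fps fps"
  where "frob_component p u = (\<lambda>(a, b, e). Abs_fps (\<lambda>i. Abs_fps (\<lambda>j. Abs_fps (\<lambda>l. coeff3 u (p * i + a) (p * j + b) (p * l + e)))))"

definition assemble :: "nat \<Rightarrow> (nat \<times> nat \<times> nat \<Rightarrow> int fps fps fps) \<Rightarrow> int fps fps fps"
  where "assemble p w = Abs_fps (\<lambda>i. Abs_fps (\<lambda>j. Abs_fps (\<lambda>l.
    coeff3 (w (i mod p, j mod p, l mod p)) (i div p) (j div p) (l div p))))"

lemma coeff3_frob_component: "coeff3 (frob_component p u (a, b, e)) i j l = coeff3 u (p * i + a) (p * j + b) (p * l + e)"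
  by (simp add: frob_component_def coeff3_def)

lemma coeff3_assemble: "coeff3 (assemble p w) i j l = coeff3 (w (i mod p, j mod p, l mod p)) (i div p) (j div p) (l div p)"
  by (simp add: assemble_def coeff3_def)

lemma coeff3_eq_iff: "u = v \<longleftrightarrow> (\<forall>i j l. coeff3 u i j l = coeff3 v i j l)"
  by (auto simp: coeff3_def fps_eq_iff)

definition p_multiples :: "nat \<Rightarrow> int fps fps fps set"
  where "p_multiples p = {u. \<forall>i j l. int p dvd coeff3 u i j l}"

lemma p_multiples_alt: "p_multiples p = (\<Inter>q. p_box p q)"
proof
  show "(\<Inter>q. p_box p q) \<subseteq> p_multiples p"
  proof (clarsimp simp: p_multiples_def p_box_def)
    fix u i j l assume "\<forall>q. \<forall>i<q. \<forall>j<q. \<forall>l<q. int p dvd coeff3 u i j l"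
    from this[rule_format, of i "Suc (i + j + l)" j l] show "int p dvd coeff3 u i j l" by simp
  qed
qed (auto simp: p_multiples_def p_box_def)

lemma is_ideal_p_multiples: "is_ideal (p_multiples p)"
proof (rule is_idealI)
  note G = add_subgroupD[OF is_idealD(1)[OF is_ideal_p_box[of p]]] and H = is_idealD(2)[OF is_ideal_p_box[of p]]
  show "0 \<in> p_multiples p" using G unfolding p_multiples_alt by auto
  show "u - v \<in> p_multiples p" if "u \<in> p_multiples p" "v \<in> p_multiples p" for u v using G that unfolding p_multiples_alt by auto
  show "r * u \<in> p_multiples p" if "u \<in> p_multiples p" for r u using H that unfolding p_multiples_alt by auto
qed

lemma coeff3_of_nat_mult: "coeff3 (of_nat p * r) i j l = int p * coeff3 r i j l"
  by (simp add: coeff3_def fps_of_nat[symmetric] del: fps_of_nat)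

lemma frob_component_diff: "frob_component p (u - v) c = frob_component p u c - frob_component p v c"
  by (cases c) (simp add: coeff3_eq_iff coeff3_frob_component)

lemma frob_component_add: "frob_component p (u + v) c = frob_component p u c + frob_component p v c"
  by (cases c) (simp add: coeff3_eq_iff coeff3_frob_component)

lemma frob_component_p_multiples: "u \<in> p_multiples p \<Longrightarrow> frob_component p u c \<in> p_multiples p"
  by (cases c) (auto simp: p_multiples_def coeff3_frob_component)

text \<open>Modulo \<open>p\<close>, \<open>w\<^sup>p = w(x\<^sup>p, y\<^sup>p, z\<^sup>p)\<close>, so multiplication by \<open>w\<^sup>p\<close> acts as \<open>w\<close> on each component.\<close>

definition frob_linear :: "nat \<Rightarrow> int fps fps fps \<Rightarrow> bool"
  where "frob_linear p w \<longleftrightarrow> (\<forall>v. \<forall>a<p. \<forall>b<p. \<forall>e<p.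
     frob_component p (w ^ p * v) (a, b, e) - w * frob_component p v (a, b, e) \<in> p_multiples p)"

text \<open>The p-th power is additive up to a multiple of p. Together with products and the
  variables themselves, this reaches every polynomial built from the variables by sums, products and
  powers.\<close>

lemma frob_linear_add:
  assumes p: "Factorial_Ring.prime p" and "frob_linear p w" "frob_linear p w'"
  shows "frob_linear p (w + w')"
  unfolding frob_linear_def
proof (intro allI impI)
  note G = add_subgroupD[OF is_idealD(1)[OF is_ideal_p_multiples[of p]]]
  fix v a b e assume c: "a < p" "b < p" "e < p"
  let ?c = "(a, b, e)"
  obtain r where r: "(w + w') ^ p = w ^ p + w' ^ p + of_nat p * r" using freshman[OF p] by blast
  have "frob_component p (of_nat p * (r * v)) ?c \<in> p_multiples p"
    by (rule frob_component_p_multiples) (simp add: p_multiples_def coeff3_of_nat_mult)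
  moreover have "frob_component p (w ^ p * v) ?c - w * frob_component p v ?c \<in> p_multiples p" "frob_component p (w' ^ p * v) ?c - w' * frob_component p v ?c \<in> p_multiples p"
    using assms c by (auto simp: frob_linear_def)
  ultimately have "frob_component p (of_nat p * (r * v)) ?c + ((frob_component p (w ^ p * v) ?c - w * frob_component p v ?c) + (frob_component p (w' ^ p * v) ?c - w' * frob_component p v ?c)) \<in> p_multiples p"
    using G(4) by blast
  moreover have "frob_component p ((w + w') ^ p * v) ?c = frob_component p (w ^ p * v) ?c + frob_component p (w' ^ p * v) ?c + frob_component p (of_nat p * (r * v)) ?c"
    unfolding r frob_component_add[symmetric] by (simp add: algebra_simps)
  ultimately show "frob_component p ((w + w') ^ p * v) ?c - (w + w') * frob_component p v ?c \<in> p_multiples p"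
    by (simp add: algebra_simps)
qed

lemma frob_linear_mult:
  assumes "frob_linear p w" "frob_linear p w'"
  shows "frob_linear p (w * w')"
  unfolding frob_linear_def
proof (intro allI impI)
  note G = add_subgroupD[OF is_idealD(1)[OF is_ideal_p_multiples[of p]]]
  fix v a b e assume c: "a < p" "b < p" "e < p"
  let ?c = "(a, b, e)"
  have "frob_component p (w ^ p * (w' ^ p * v)) ?c - w * frob_component p (w' ^ p * v) ?c \<in> p_multiples p"
    "frob_component p (w' ^ p * v) ?c - w' * frob_component p v ?c \<in> p_multiples p"
    using assms c by (auto simp: frob_linear_def)
  from G(4)[OF this(1) is_idealD(2)[OF is_ideal_p_multiples this(2), of w]]
  show "frob_component p ((w * w') ^ p * v) ?c - (w * w') * frob_component p v ?c \<in> p_multiples p"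
    by (simp add: algebra_simps power_mult_distrib)
qed

lemma frob_linear_power:
  assumes "frob_linear p w"
  shows "frob_linear p (w ^ k)"
proof (induction k)
  case 0
  show ?case using add_subgroupD(1)[OF is_idealD(1)[OF is_ideal_p_multiples]] by (simp add: frob_linear_def)
next
  case (Suc k)
  thus ?case using frob_linear_mult[OF assms] by simp
qed

lemma coeff3_var_power_mult:
  "coeff3 (fps_X ^ q * v) i j l = (if i < q then 0 else coeff3 v (i - q) j l)"
  "coeff3 (fps_const fps_X ^ q * v) i j l = (if j < q then 0 else coeff3 v i (j - q) l)"
  "coeff3 (fps_const (fps_const fps_X) ^ q * v) i j l = (if l < q then 0 else coeff3 v i j (l - q))"
  for v :: "'a::comm_ring_1 fps fps fps"
  by (simp_all add: coeff3_def fps_X_power_mult_nth fps_const_power)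

text \<open>For a variable the relation holds exactly: raising one exponent by p raises its quotient
  by 1 and keeps its remainder.\<close>

lemma frob_linear_vars:
  assumes "p > 0"
  shows "frob_linear p fps_X" "frob_linear p (fps_const fps_X)" "frob_linear p (fps_const (fps_const fps_X))"
proof -
  have z: "0 \<in> p_multiples p" using add_subgroupD(1)[OF is_idealD(1)[OF is_ideal_p_multiples]] .
  have s: "p * i + a < p \<longleftrightarrow> i = 0" "i \<noteq> 0 \<Longrightarrow> p * i + a - p = p * (i - 1) + a" if "a < p" for i a
    using that by (cases i; simp)+
  have main: "frob_component p (w ^ p * v) (a, b, e) - w * frob_component p v (a, b, e) = 0"
    if "a < p" "b < p" "e < p" "w \<in> {fps_X, fps_const fps_X, fps_const (fps_const fps_X)}" for w v a b e
  proof -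
    have "coeff3 (frob_component p (w ^ p * v) (a, b, e)) i j l = coeff3 (w ^ 1 * frob_component p v (a, b, e)) i j l" for i j l
      using that(4) that(1-3) unfolding insert_iff empty_iff
      by (elim disjE) (simp_all only: coeff3_frob_component coeff3_var_power_mult, auto simp: s)
    thus ?thesis by (simp add: coeff3_eq_iff[of _ 0])
  qed
  thus "frob_linear p fps_X" "frob_linear p (fps_const fps_X)" "frob_linear p (fps_const (fps_const fps_X))"
    unfolding frob_linear_def using z by (intro allI impI, subst main; simp)+
qed

lemma frob_linear_D_poly:
  assumes "Factorial_Ring.prime p"
  shows "frob_linear p (D_poly n)"
  using frob_linear_vars[of p] assms prime_gt_0_nat[OF assms]
  unfolding D_poly_def fps_const_power[symmetric]
  by (intro frob_linear_add frob_linear_mult frob_linear_power) auto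

text \<open>Flatness of the Frobenius made explicit: the p^3 coordinates turn the ideal for (p k, p
  q) into p^3 copies of the ideal for (k, q). Conversely, the cofactors of the coordinates are
  assembled into one cofactor.\<close>

lemma h_lift_frobenius_iff:
  assumes "frob_linear p f" "p > 0"
  shows "u \<in> h_lift p f (p * k) (p * q) \<longleftrightarrow> (\<forall>a<p. \<forall>b<p. \<forall>e<p. frob_component p u (a, b, e) \<in> h_lift p f k q)"
proof -
  note G = add_subgroupD[OF is_idealD(1)[OF is_ideal_p_box[of p q]]]
  have fk: "frob_component p (f ^ (p * k) * v) (a, b, e) - f ^ k * frob_component p v (a, b, e) \<in> p_box p q"
    if "a < p" "b < p" "e < p" for v a b e
    using frob_linear_power[OF assms(1), of k] that
    by (auto simp: frob_linear_def p_multiples_alt power_mult[symmetric] mult.commute)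
  have lt: "p * i + a < p * q" if "i < q" "a < p" for i a
  proof -
    have "p * i + a < p * Suc i" using that by simp
    also have "\<dots> \<le> p * q" using that by (intro mult_le_mono) auto
    finally show ?thesis .
  qed
  show ?thesis
  proof
    assume "u \<in> h_lift p f (p * k) (p * q)"
    then obtain v where v: "u - f ^ (p * k) * v \<in> p_box p (p * q)" by (auto simp: h_lift_def)
    show "\<forall>a<p. \<forall>b<p. \<forall>e<p. frob_component p u (a, b, e) \<in> h_lift p f k q"
    proof (intro allI impI)
      fix a b e assume c: "a < p" "b < p" "e < p"
      have "frob_component p (u - f ^ (p * k) * v) (a, b, e) \<in> p_box p q"
        using v c lt by (auto simp: p_box_def coeff3_frob_component simp del: coeff3_simps)
      from G(4)[OF this fk[OF c, of v]]
      have "frob_component p u (a, b, e) - f ^ k * frob_component p v (a, b, e) \<in> p_box p q" by (simp add: frob_component_diff)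
      thus "frob_component p u (a, b, e) \<in> h_lift p f k q" unfolding h_lift_def by blast
    qed
  next
    assume "\<forall>a<p. \<forall>b<p. \<forall>e<p. frob_component p u (a, b, e) \<in> h_lift p f k q"
    hence "\<forall>a b e. \<exists>v. a < p \<longrightarrow> b < p \<longrightarrow> e < p \<longrightarrow> frob_component p u (a, b, e) - f ^ k * v \<in> p_box p q"
      by (auto simp: h_lift_def)
    then obtain v where v: "\<And>a b e. a < p \<Longrightarrow> b < p \<Longrightarrow> e < p \<Longrightarrow> frob_component p u (a, b, e) - f ^ k * v a b e \<in> p_box p q"
      by metis
    define V where "V = assemble p (\<lambda>(a, b, e). v a b e)"
    have V: "frob_component p V (a, b, e) = v a b e" if "a < p" "b < p" "e < p" for a b e
      using that assms(2) by (simp add: coeff3_eq_iff coeff3_frob_component V_def coeff3_assemble)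
    have main: "frob_component p (u - f ^ (p * k) * V) (a, b, e) \<in> p_box p q" if "a < p" "b < p" "e < p" for a b e
      using G(2)[OF v[OF that] fk[OF that, of V]] V[OF that] by (simp add: frob_component_diff algebra_simps)
    have "int p dvd coeff3 (u - f ^ (p * k) * V) i j l" if "i < p * q" "j < p * q" "l < p * q" for i j l
    proof -
      have "int p dvd coeff3 (frob_component p (u - f ^ (p * k) * V) (i mod p, j mod p, l mod p)) (i div p) (j div p) (l div p)"
        using main[of "i mod p" "j mod p" "l mod p"] that assms(2)
        by (auto simp: p_box_def less_mult_imp_div_less mult.commute simp del: coeff3_simps)
      thus ?thesis by (simp add: coeff3_frob_component)
    qed
    thus "u \<in> h_lift p f (p * k) (p * q)" unfolding h_lift_def p_box_def by blast
  qed
qed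

lemma quotient_index_frobenius:
  assumes "frob_linear p f" "p > 0"
  shows "quotient_index (h_lift p f (p * k) (p * q)) = quotient_index (h_lift p f k q) ^ (p ^ 3)"
proof -
  let ?C = "{..<p} \<times> {..<p} \<times> {..<p}"
  have ca: "frob_component p (assemble p w) (a, b, e) = w (a, b, e)" if "a < p" "b < p" "e < p" for w a b e
    using that assms(2) by (simp add: coeff3_eq_iff coeff3_frob_component coeff3_assemble)
  have ac: "assemble p (frob_component p u) = u" for u
    by (simp add: coeff3_eq_iff coeff3_frob_component coeff3_assemble)
  have "quotient_index (h_lift p f (p * k) (p * q)) = (\<Prod>c\<in>?C. quotient_index (h_lift p f k q))"
  proof (rule quotient_index_prod[where \<Psi> = "assemble p"])
    show "assemble p (\<lambda>i. w i - w' i) = assemble p w - assemble p w'" for w w'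
      by (simp add: coeff3_eq_iff coeff3_assemble)
    show "\<exists>w. u - assemble p w \<in> h_lift p f (p * k) (p * q)" for u
      by (rule exI[of _ "frob_component p u"]) (simp add: ac add_subgroupD(1)[OF add_subgroup_h_lift])
    show "assemble p w \<in> h_lift p f (p * k) (p * q) \<longleftrightarrow> (\<forall>c\<in>?C. w c \<in> h_lift p f k q)" for w
      by (auto simp: h_lift_frobenius_iff[OF assms] ca)
  qed (auto simp: add_subgroup_h_lift)
  thus ?thesis by (simp add: card_cartesian_product power3_eq_cube mult.assoc)
qed

subsection \<open>Chains of ideals\<close>

lemma quotient_index_UNIV: "quotient_index UNIV = 1"
  by (simp add: quotient_index_def)

text \<open>If the indices agreed, the projection between the finite sets of cosets would be
  injective, which identifies the coset of an element of \<open>I'\<close> outside \<open>I\<close>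
  with that of 0.\<close>

lemma quotient_index_psubset:
  assumes I: "add_subgroup I" and I': "add_subgroup I'" and sub: "I \<subset> I'" and nz: "quotient_index I \<noteq> 0"
  shows "quotient_index I' < quotient_index I"
proof (rule le_neq_trans)
  show "quotient_index I' \<le> quotient_index I"
    using quotient_index_antimono[OF I I'] sub nz by blast
  let ?c = "\<lambda>u. {v. v - u \<in> I}" and ?c' = "\<lambda>u. {v. v - u \<in> I'}"
  have fin: "finite (range ?c)" using nz by (metis card.infinite quotient_index_def)
  show "quotient_index I' \<noteq> quotient_index I"
  proof
    assume eq: "quotient_index I' = quotient_index I"
    define s where "s C = ?c' (SOME u. ?c u = C)" for C
    have s: "s (?c u) = ?c' u" for u
    proof -
      have "?c (SOME v. ?c v = ?c u) = ?c u" by (rule someI[of _ u]) simp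
      hence "(SOME v. ?c v = ?c u) - u \<in> I'" using coset_eq_iff[OF I] sub by blast
      thus ?thesis unfolding s_def using coset_eq_iff[OF I'] by blast
    qed
    have "s ` range ?c = range ?c'" using s by (auto simp: image_image)
    hence inj: "inj_on s (range ?c)"
      using eq fin by (intro eq_card_imp_inj_on) (auto simp: quotient_index_def)
    obtain x where x: "x \<in> I'" "x \<notin> I" using sub by blast
    have "s (?c x) = s (?c 0)" unfolding s using coset_eq_iff[OF I', of x 0] x by simp
    hence "?c x = ?c 0" by (rule inj_onD[OF inj _ rangeI rangeI])
    thus False using coset_eq_iff[OF I, of x 0] x by simp
  qed
qed

text \<open>V/V' is generated by the class of \<open>b\<close>, which is nonzero and killed by p, so
  it is cyclic of order p. A coset of V' is determined by its coset modulo V and a multiple of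
  \<open>b\<close> modulo p.\<close>

lemma quotient_index_step:
  fixes V V' :: "'a::comm_ring_1 set"
  assumes p: "Factorial_Ring.prime p" and V: "add_subgroup V" and V': "add_subgroup V'" and sub: "V' \<subseteq> V"
    and gen: "\<And>u. u \<in> V \<Longrightarrow> \<exists>c. u - of_int c * b \<in> V'" and pb: "of_nat p * b \<in> V'"
    and ideal: "\<And>c v. v \<in> V' \<Longrightarrow> of_int c * v \<in> V'" and b: "b \<in> V" "b \<notin> V'"
    and closed: "\<And>c v. v \<in> V \<Longrightarrow> of_int c * v \<in> V"
  shows "quotient_index V' = p * quotient_index V"
proof -
  note G = add_subgroupD[OF V] and G' = add_subgroupD[OF V']
  let ?c = "\<lambda>u. {v. v - u \<in> V}"
  define \<rho> where "\<rho> u = (SOME v. ?c v = ?c u)" for u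
  have \<rho>: "u - \<rho> u \<in> V" for u
  proof -
    have "?c (\<rho> u) = ?c u" unfolding \<rho>_def by (rule someI[of _ u]) simp
    thus ?thesis using coset_eq_iff[OF V, of u "\<rho> u"] by simp
  qed
  have \<rho>_cong: "\<rho> u = \<rho> v" if "u - v \<in> V" for u v
    using coset_eq_iff[OF V, of u v] that by (simp add: \<rho>_def)
  \<comment> \<open>\<open>\<rho>\<close> picks a representative of each V-coset, and
    \<open>e u\<close> is the coefficient of \<open>b\<close> in the difference from it; only its
    residue mod p is an invariant.\<close>
  define e where "e u = (SOME c. u - \<rho> u - of_int c * b \<in> V')" for u
  have e: "u - \<rho> u - of_int (e u) * b \<in> V'" for u
    unfolding e_def using gen[OF \<rho>] by (rule someI_ex)
  have mult_b: "of_int c * b \<in> V' \<longleftrightarrow> int p dvd c" for c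
  proof
    assume "int p dvd c"
    then obtain d where "c = int p * d" by blast
    thus "of_int c * b \<in> V'" using ideal[OF pb, of d] by (simp add: algebra_simps)
  next
    assume c: "of_int c * b \<in> V'"
    show "int p dvd c"
    proof (rule ccontr)
      assume "\<not> int p dvd c"
      hence "coprime (int p) c" using p by (simp add: prime_imp_coprime)
      then obtain x y where xy: "x * int p + y * c = 1" using bezout_int[of "int p" c] by (metis coprime_imp_gcd_eq_1)
      have "of_int (x * int p + y * c) * b \<in> V'"
        using G'(4)[OF ideal[OF pb, of x] ideal[OF c, of y]] by (simp add: algebra_simps)
      thus False using b(2) by (simp only: xy) simp
    qed
  qed
  have eq: "quotient_index V' = card (range (\<lambda>u. (?c u, e u mod int p)))"
  proof (rule quotient_index_eq_card_range[OF V'])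
    fix u v
    have "u - v \<in> V' \<longleftrightarrow> u - v \<in> V \<and> int p dvd e u - e v"
    proof (cases "u - v \<in> V")
      case True
      have d: "(u - \<rho> u - of_int (e u) * b) - (v - \<rho> v - of_int (e v) * b) \<in> V'" by (rule G'(2)[OF e e])
      hence d: "(u - v) - of_int (e u - e v) * b \<in> V'" using \<rho>_cong[OF True] by (simp add: algebra_simps)
      have "u - v \<in> V' \<longleftrightarrow> of_int (e u - e v) * b \<in> V'"
        using G'(2)[OF _ d, of "u - v"] G'(4)[OF _ d, of "of_int (e u - e v) * b"] by auto
      thus ?thesis using True by (simp only: mult_b simp_thms)
    qed (use sub in auto)
    thus "((?c u, e u mod int p) = (?c v, e v mod int p)) = (u - v \<in> V')"
      by (simp add: coset_eq_iff[OF V] mod_eq_dvd_iff)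
  qed
  have "range (\<lambda>u. (?c u, e u mod int p)) = range ?c \<times> {0..<int p}"
  proof
    show "range (\<lambda>u. (?c u, e u mod int p)) \<subseteq> range ?c \<times> {0..<int p}"
      using prime_gt_0_nat[OF p] by auto
    show "range ?c \<times> {0..<int p} \<subseteq> range (\<lambda>u. (?c u, e u mod int p))"
    proof clarify
      fix u x assume x: "x \<in> {0..<int p}"
      define w where "w = u + of_int (x - e u) * b"
      have wu: "w - u \<in> V" using closed[OF b(1), of "x - e u"] by (simp add: w_def del: of_int_diff)
      have "(w - \<rho> w - of_int (e w) * b) - (u - \<rho> u - of_int (e u) * b) \<in> V'" by (rule G'(2)[OF e e])
      hence "of_int (x - e w) * b \<in> V'" using \<rho>_cong[OF wu] by (simp add: w_def algebra_simps)
      hence "x mod int p = e w mod int p" by (simp only: mult_b mod_eq_dvd_iff)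
      hence "(?c u, x) = (?c w, e w mod int p)" using x wu coset_eq_iff[OF V, of w u] by simp
      thus "(?c u, x) \<in> range (\<lambda>u. (?c u, e u mod int p))" by (rule range_eqI)
    qed
  qed
  hence "quotient_index V' = card (range ?c \<times> {0..<int p})" by (simp only: eq)
  thus ?thesis by (simp add: card_cartesian_product quotient_index_def[of V])
qed

section \<open>Filtration by the monomials of the box\<close>

lemma coeff3_mult:
  "coeff3 (u * v) i j l = (\<Sum>i'\<le>i. \<Sum>j'\<le>j. \<Sum>l'\<le>l. coeff3 u i' j' l' * coeff3 v (i - i') (j - j') (l - l'))"
  by (simp add: coeff3_def fps_mult_nth fps_sum_nth atMost_atLeast0)

text \<open>The q^3 monomials of the box in lexicographic order, read as digits in base q. The value
  m = 0 gives the whole ring and m = q^3 gives \<open>p_box p q\<close>.\<close>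

definition initial_box :: "nat \<Rightarrow> nat \<Rightarrow> nat \<Rightarrow> int fps fps fps set"
  where "initial_box p q m = {u. \<forall>i<q. \<forall>j<q. \<forall>l<q. (i * q + j) * q + l < m \<longrightarrow> int p dvd coeff3 u i j l}"

text \<open>The code is monotone in each exponent, so all divisors of a monomial come no later than
  the monomial itself.\<close>

lemma is_ideal_initial_box: "is_ideal (initial_box p q m)"
proof (rule is_idealI)
  fix r u assume u: "u \<in> initial_box p q m"
  have "int p dvd coeff3 (u * r) i j l" if "i < q" "j < q" "l < q" "(i * q + j) * q + l < m" for i j l
    unfolding coeff3_mult
  proof (intro dvd_sum dvd_mult2)
    fix i' j' l' assume "i' \<in> {..i}" "j' \<in> {..j}" "l' \<in> {..l}"
    moreover from this have "(i' * q + j') * q + l' \<le> (i * q + j) * q + l"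
      by (intro add_mono mult_mono) auto
    ultimately show "int p dvd coeff3 u i' j' l'" using u that by (auto simp: initial_box_def)
  qed
  thus "r * u \<in> initial_box p q m" by (auto simp: initial_box_def mult.commute)
qed (auto simp: initial_box_def)

lemma code_less:
  fixes i j l q :: nat
  assumes "i < q" "j < q" "l < q"
  shows "(i * q + j) * q + l < q ^ 3"
proof -
  have "i * q + j < q * q"
  proof -
    have "i * q + j < Suc i * q" using assms by simp
    also have "\<dots> \<le> q * q" using assms by (intro mult_le_mono) auto
    finally show ?thesis .
  qed
  hence "Suc (i * q + j) * q \<le> q * q * q" by (intro mult_le_mono) auto
  thus ?thesis using assms by (simp add: power3_eq_cube)
qed

text \<open>V m = J + \<open>initial_box p q m\<close> descends from the whole ring to J. Each step
  removes at most the class of one monomial \<open>b\<close>, which p kills, so the index is kept or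
  multiplied by p.\<close>

lemma ideal_filtration:
  assumes p: "Factorial_Ring.prime p" and J: "is_ideal J" "p_box p q \<subseteq> J"
  shows "\<exists>V e. V 0 = UNIV \<and> V (q ^ 3) = J \<and> (\<forall>m. is_ideal (V m)) \<and> (\<forall>m. J \<subseteq> V m) \<and> (\<forall>m. V (Suc m) \<subseteq> V m)
    \<and> e 0 = 0 \<and> (\<forall>m\<le>q^3. quotient_index (V m) = p ^ e m) \<and> (\<forall>m. e (Suc m) = e m \<or> e (Suc m) = Suc (e m))"
proof -
  define V where "V m = {u. \<exists>w\<in>J. u - w \<in> initial_box p q m}" for m
  note GJ = add_subgroupD[OF is_idealD(1)[OF J(1)]]
  note GW = add_subgroupD[OF is_idealD(1)[OF is_ideal_initial_box[of p q]]]
  have V: "is_ideal (V m)" for m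
  proof (rule is_idealI)
    show "0 \<in> V m" unfolding V_def using GJ(1) GW(1)[of m] by (intro CollectI bexI[of _ 0]) simp
  next
    fix u v assume "u \<in> V m" "v \<in> V m"
    then obtain w w' where w: "w \<in> J" "w' \<in> J" "u - w \<in> initial_box p q m" "v - w' \<in> initial_box p q m" unfolding V_def by auto
    have "(u - v) - (w - w') \<in> initial_box p q m" using GW(2)[OF w(3,4)] by (simp add: algebra_simps)
    thus "u - v \<in> V m" unfolding V_def using GJ(2)[OF w(1,2)] by blast
  next
    fix r u assume "u \<in> V m"
    then obtain w where w: "w \<in> J" "u - w \<in> initial_box p q m" unfolding V_def by auto
    have "r * u - r * w \<in> initial_box p q m" using is_idealD(2)[OF is_ideal_initial_box w(2), of r] by (simp add: algebra_simps)
    thus "r * u \<in> V m" unfolding V_def using is_idealD(2)[OF J(1) w(1)] by blast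
  qed
  have W_V: "initial_box p q m \<subseteq> V m" for m unfolding V_def using GJ(1) by (intro subsetI CollectI bexI[of _ 0]) simp_all
  have J_V: "J \<subseteq> V m" for m
  proof
    fix u assume "u \<in> J"
    thus "u \<in> V m" unfolding V_def using GW(1)[of m] by (intro CollectI bexI[of _ u]) simp_all
  qed
  have V0: "V 0 = UNIV" using W_V[of 0] by (auto simp: initial_box_def)
  have VQ: "V (q ^ 3) = J"
  proof
    have W: "initial_box p q (q ^ 3) \<subseteq> J" using J(2) code_less by (auto simp: initial_box_def p_box_def)
    show "V (q ^ 3) \<subseteq> J"
    proof
      fix u assume "u \<in> V (q ^ 3)"
      then obtain w where "w \<in> J" "u - w \<in> J" unfolding V_def using W by auto
      thus "u \<in> J" using GJ(4)[of "u - w" w] by simp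
    qed
  qed (rule J_V)
  have "initial_box p q (Suc m) \<subseteq> initial_box p q m" for m by (auto simp: initial_box_def)
  hence V_dec: "V (Suc m) \<subseteq> V m" for m unfolding V_def by blast
  have step: "quotient_index (V (Suc m)) = quotient_index (V m) \<or> quotient_index (V (Suc m)) = p * quotient_index (V m)"
    if m: "m < q ^ 3" for m
  proof -
    \<comment> \<open>The base q digits of m recover the monomial that separates step m from step m
      + 1.\<close>
    define l j i where "l = m mod q" and "j = (m div q) mod q" and "i = m div q div q"
    have q: "q > 0" using m by (cases q) auto
    have i: "i < q" using m by (simp add: i_def less_mult_imp_div_less power3_eq_cube)
    have jl: "j < q" "l < q" using q by (auto simp: j_def l_def)
    have code: "(i * q + j) * q + l = m" by (simp add: i_def j_def l_def)
    define b where "b = Abs_fps (\<lambda>i'. Abs_fps (\<lambda>j'. Abs_fps (\<lambda>l'. if i' = i \<and> j' = j \<and> l' = l then 1 else (0::int))))"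
    have cb: "coeff3 (of_int c * b) i' j' l' = (if i' = i \<and> j' = j \<and> l' = l then c else 0)" for c i' j' l'
    proof -
      have "of_int c * b = fps_const (fps_const (fps_const c)) * b"
        by (simp add: fps_of_int[symmetric] del: fps_of_int)
      thus ?thesis by (simp add: coeff3_def b_def)
    qed
    have uniq: "i' = i \<and> j' = j \<and> l' = l" if "i' < q" "j' < q" "l' < q" "(i' * q + j') * q + l' = m" for i' j' l'
    proof -
      have l: "m mod q = l'" unfolding that(4)[symmetric] using that(3) by simp
      have d: "m div q = i' * q + j'" unfolding that(4)[symmetric] using that(3) by simp
      have "m div q mod q = j'" "m div q div q = i'" unfolding d using that(2) by simp_all
      thus ?thesis using l by (simp add: i_def j_def l_def)
    qed
    have gen: "\<exists>c. u - of_int c * b \<in> V (Suc m)" if uV: "u \<in> V m" for u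
    proof -
      obtain w where w: "w \<in> J" "u - w \<in> initial_box p q m" using uV unfolding V_def by auto
      define c where "c = coeff3 (u - w) i j l"
      have "(u - of_int c * b) - w \<in> initial_box p q (Suc m)"
        unfolding initial_box_def mem_Collect_eq
      proof (intro allI impI)
        fix i' j' l' assume h: "i' < q" "j' < q" "l' < q" "(i' * q + j') * q + l' < Suc m"
        have d: "coeff3 (u - of_int c * b - w) i' j' l' = coeff3 (u - w) i' j' l' - coeff3 (of_int c * b) i' j' l'" by simp
        show "int p dvd coeff3 (u - of_int c * b - w) i' j' l'"
        proof (cases "i' = i \<and> j' = j \<and> l' = l")
          case True
          hence e: "i' = i" "j' = j" "l' = l" by blast+
          have "coeff3 (of_int c * b) i j l = coeff3 (u - w) i j l"
            unfolding cb by (simp only: c_def simp_thms if_True)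
          thus ?thesis using d unfolding e by (simp only: diff_self dvd_0_right)
        next
          case False
          hence "(i' * q + j') * q + l' < m" using uniq[OF h(1-3)] h(4) by linarith
          hence "int p dvd coeff3 (u - w) i' j' l'" using w(2) h(1-3) unfolding initial_box_def by blast
          thus ?thesis unfolding d cb using False by (simp only: if_False diff_0_right)
        qed
      qed
      thus ?thesis using w(1) unfolding V_def by blast
    qed
    have pb: "of_nat p * b \<in> V (Suc m)"
    proof -
      have "of_nat p * b \<in> initial_box p q (Suc m)"
        unfolding initial_box_def mem_Collect_eq cb[of "int p", unfolded of_int_of_nat_eq] by simp
      thus ?thesis using W_V by blast
    qed
    have bV: "b \<in> V m"
    proof -
      have "coeff3 b i' j' l' = (if i' = i \<and> j' = j \<and> l' = l then 1 else 0)" for i' j' l'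
        using cb[of 1] by (simp only: of_int_1 mult_1)
      hence "b \<in> initial_box p q m"
        unfolding initial_box_def mem_Collect_eq using code by (auto simp: less_irrefl)
      thus ?thesis using W_V by blast
    qed
    show ?thesis
    proof (cases "b \<in> V (Suc m)")
      case True
      have "V m \<subseteq> V (Suc m)"
      proof
        fix u assume "u \<in> V m"
        then obtain c where "u - of_int c * b \<in> V (Suc m)" using gen by blast
        from add_subgroupD(4)[OF is_idealD(1)[OF V] this is_idealD(2)[OF V True, of "of_int c"]]
        show "u \<in> V (Suc m)" by simp
      qed
      thus ?thesis using V_dec[of m] by auto
    next
      case False
      show ?thesis
        by (rule disjI2, rule quotient_index_step[OF p is_idealD(1)[OF V] is_idealD(1)[OF V] V_dec gen pb _ bV False])
          (assumption | erule is_idealD(2)[OF V])+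
    qed
  qed
  \<comment> \<open>Counts the proper inclusions among the first q^3 steps, detected by a change of
    index.\<close>
  define e where "e = rec_nat 0 (\<lambda>m x. if m < q ^ 3 \<and> quotient_index (V (Suc m)) \<noteq> quotient_index (V m) then Suc x else x)"
  have e: "e 0 = 0" "e (Suc m) = (if m < q ^ 3 \<and> quotient_index (V (Suc m)) \<noteq> quotient_index (V m) then Suc (e m) else e m)" for m
    by (auto simp: e_def)
  have "quotient_index (V m) = p ^ e m" if "m \<le> q ^ 3" for m
    using that
  proof (induction m)
    case 0
    thus ?case by (simp add: V0 quotient_index_UNIV e)
  next
    case (Suc m)
    thus ?case using step[of m] by (auto simp: e)
  qed
  moreover have "e (Suc m) = e m \<or> e (Suc m) = Suc (e m)" for m by (simp add: e(2))
  ultimately show ?thesis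
    by (intro exI[of _ V] exI[of _ e] conjI allI impI V0 VQ V J_V V_dec e(1))
qed

lemma discrete_ivt:
  fixes e :: "nat \<Rightarrow> nat"
  assumes "e 0 = 0" "\<And>m. e (Suc m) = e m \<or> e (Suc m) = Suc (e m)" "d \<le> e Q"
  shows "\<exists>m\<le>Q. e m = d"
  using assms(3)
proof (induction Q)
  case (Suc Q)
  show ?case
  proof (cases "d \<le> e Q")
    case True
    thus ?thesis using Suc.IH le_Suc_eq by blast
  next
    case False
    hence "e (Suc Q) = d" using assms(2)[of Q] Suc.prems by auto
    thus ?thesis by blast
  qed
qed (use assms(1) in auto)

text \<open>Upper bound: along a strictly ascending chain the indices are strictly decreasing powers
  of p, starting at most at p^D. Lower bound: the filtration with its repetitions left out is a
  chain of length D.\<close>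

lemma ideal_chain_length:
  assumes p: "Factorial_Ring.prime p" and I: "is_ideal I" "p_box p q \<subseteq> I"
  shows "\<exists>D. quotient_index I = p ^ D \<and> D \<le> q ^ 3 \<and>
    (\<forall>n. (\<exists>J :: nat \<Rightarrow> int fps fps fps set. (\<forall>i\<le>n. is_ideal (J i) \<and> I \<subseteq> J i) \<and> (\<forall>i<n. J i \<subset> J (Suc i))) \<longleftrightarrow> n \<le> D)"
proof -
  have p1: "p > 1" using p prime_gt_1_nat by blast
  obtain V e where V: "V 0 = UNIV" "V (q ^ 3) = I" "\<And>m. is_ideal (V m)" "\<And>m. I \<subseteq> V m" "\<And>m. V (Suc m) \<subseteq> V m"
    and e: "e 0 = 0" "\<And>m. m \<le> q ^ 3 \<Longrightarrow> quotient_index (V m) = p ^ e m" "\<And>m. e (Suc m) = e m \<or> e (Suc m) = Suc (e m)"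
    using ideal_filtration[OF p I] by metis
  define D where "D = e (q ^ 3)"
  have idx: "quotient_index I = p ^ D" using e(2)[of "q ^ 3"] V(2) by (simp add: D_def)
  have e_mono: "e m \<le> e m'" if "m \<le> m'" for m m'
    using that by (rule lift_Suc_mono_le[rotated]) (metis e(3) le_SucI order_refl)
  have "e m \<le> m" for m
  proof (induction m)
    case (Suc m)
    thus ?case using e(3)[of m] by auto
  qed (simp add: e(1))
  hence Dq: "D \<le> q ^ 3" by (simp add: D_def)
  have V_anti: "V m' \<subseteq> V m" if "m \<le> m'" for m m'
    using that by (induction m' rule: dec_induct) (use V(5) in blast)+
  have "n \<le> D" if J: "\<And>i. i \<le> n \<Longrightarrow> is_ideal (J i) \<and> I \<subseteq> J i" "\<And>i. i < n \<Longrightarrow> J i \<subset> J (Suc i)"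
    for n and J :: "nat \<Rightarrow> int fps fps fps set"
  proof -
    have "\<exists>d. quotient_index (J i) = p ^ d" if "i \<le> n" for i
    proof -
      have "p_box p q \<subseteq> J i" using J(1)[OF that] I(2) by blast
      from ideal_filtration[OF p conjunct1[OF J(1)[OF that]] this] show ?thesis by (metis order_refl)
    qed
    then obtain d where d: "\<And>i. i \<le> n \<Longrightarrow> quotient_index (J i) = p ^ d i" by metis
    have "d (Suc i) < d i" if "i < n" for i
    proof -
      have "quotient_index (J (Suc i)) < quotient_index (J i)"
        using J(1)[of i] J(1)[of "Suc i"] J(2)[OF that] d[of i] that p1
        by (intro quotient_index_psubset is_idealD(1)) auto
      thus ?thesis using d[of i] d[of "Suc i"] that p1 by simp
    qed
    hence dec: "d (Suc i) < d i" if "i < n" for i using that by blast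
    have "d i + i \<le> d 0" if "i \<le> n" for i
      using that
    proof (induction i)
      case (Suc i)
      thus ?case using dec[of i] by simp
    qed simp
    hence "n \<le> d 0" using add_leD2 by blast
    moreover have "quotient_index (J 0) \<le> quotient_index I"
      using J(1)[of 0] I idx p1 by (intro quotient_index_antimono is_idealD(1)) auto
    hence "d 0 \<le> D" using d[of 0] idx p1 by simp
    ultimately show ?thesis by simp
  qed
  moreover have "\<exists>J :: nat \<Rightarrow> int fps fps fps set. (\<forall>i\<le>n. is_ideal (J i) \<and> I \<subseteq> J i) \<and> (\<forall>i<n. J i \<subset> J (Suc i))"
    if n: "n \<le> D" for n
  proof -
    have "\<exists>m\<le>q ^ 3. e m = d" if "d \<le> D" for d
      using discrete_ivt[OF e(1,3), of d "q ^ 3"] that by (simp add: D_def)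
    then obtain m where m: "\<And>d. d \<le> D \<Longrightarrow> m d \<le> q ^ 3 \<and> e (m d) = d" by metis
    \<comment> \<open>\<open>m d\<close> is a position with exponent \<open>d\<close>; counting down
      from \<open>D\<close> makes the descending filtration an ascending chain.\<close>
    define J where "J i = V (m (D - i))" for i
    have "J i \<subset> J (Suc i)" if "i < n" for i
    proof -
      have lt: "D - Suc i < D - i" using that n by auto
      have "m (D - Suc i) \<le> m (D - i)"
      proof (rule ccontr)
        assume "\<not> ?thesis"
        hence "e (m (D - i)) \<le> e (m (D - Suc i))" by (intro e_mono) auto
        thus False using m[of "D - i"] m[of "D - Suc i"] lt by auto
      qed
      moreover have "quotient_index (J i) \<noteq> quotient_index (J (Suc i))"
        using m[of "D - i"] m[of "D - Suc i"] e(2) lt p1 by (simp add: J_def)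
      moreover from calculation(1) have "J i \<subseteq> J (Suc i)" unfolding J_def by (rule V_anti)
      ultimately show ?thesis by (metis psubsetI)
    qed
    moreover have "is_ideal (J i) \<and> I \<subseteq> J i" for i using V(3,4) unfolding J_def by blast
    ultimately show ?thesis by blast
  qed
  ultimately show ?thesis using idx Dq by (intro exI[of _ D]) blast
qed

subsection \<open>From \<open>int fps fps fps\<close> to the rings of the definitions\<close>

text \<open>Passes from nested series to functions on exponent vectors while mapping coefficients.
  Two cases occur: \<open>\<iota>\<close> is reduction mod p for the h-functions, and
  \<open>of_int\<close> for the complex series.\<close>

definition coeff_map :: "(int \<Rightarrow> 'a) \<Rightarrow> int fps fps fps \<Rightarrow> (3 \<Rightarrow> nat) \<Rightarrow> 'a"
  where "coeff_map \<iota> u = (\<lambda>a. \<iota> (coeff3 u (a 0) (a 1) (a 2)))"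

lemma all_3: "(\<forall>v::3. P v) \<longleftrightarrow> P 0 \<and> P 1 \<and> P 2"
proof -
  \<comment> \<open>In the type \<open>3\<close> the numeral 3 equals 0.\<close>
  have "v = 0 \<or> v = 1 \<or> v = 2" for v :: 3 using exhaust_3[of v] by auto
  thus ?thesis by metis
qed

lemma UNIV_3': "(UNIV :: 3 set) = {0, 1, 2}"
  using all_3[of "\<lambda>v. v \<in> {0, 1, 2}"] by auto

definition vec3 :: "nat \<Rightarrow> nat \<Rightarrow> nat \<Rightarrow> 3 \<Rightarrow> nat"
  where "vec3 i j l = (\<lambda>v. if v = 0 then i else if v = 1 then j else l)"

lemma vec3_simps [simp]: "vec3 i j l 0 = i" "vec3 i j l 1 = j" "vec3 i j l 2 = l"
  by (auto simp: vec3_def)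

lemma vec3_eq: "a = vec3 (a 0) (a 1) (a 2)"
  unfolding fun_eq_iff all_3 by simp

lemma atMost_vec3: "{b. b \<le> a} = (\<lambda>(i, j, l). vec3 i j l) ` ({..a 0} \<times> {..a 1} \<times> {..a 2})"
proof -
  have "b \<le> a \<longleftrightarrow> b 0 \<le> a 0 \<and> b 1 \<le> a 1 \<and> b 2 \<le> a 2" for b
    unfolding le_fun_def all_3 ..
  moreover have "b = (\<lambda>(i, j, l). vec3 i j l) (b 0, b 1, b 2)" for b using vec3_eq[of b] by simp
  ultimately show ?thesis by (auto intro!: image_eqI)
qed

lemma inj_vec3: "inj_on (\<lambda>(i, j, l). vec3 i j l) A"
proof (rule inj_onI)
  fix s t :: "nat \<times> nat \<times> nat"
  assume h: "(\<lambda>(i, j, l). vec3 i j l) s = (\<lambda>(i, j, l). vec3 i j l) t"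
  obtain i j l i' j' l' where st: "s = (i, j, l)" "t = (i', j', l')" by (cases s, cases t)
  have "vec3 i j l v = vec3 i' j' l' v" for v using h st by simp
  from this[of 0] this[of 1] this[of 2] show "s = t" by (simp add: st)
qed

lemma coeff_map_mult:
  assumes R: "ring R" and \<iota>: "\<And>x. \<iota> x \<in> carrier R" "\<iota> 0 = \<zero>\<^bsub>R\<^esub>" "\<And>x y. \<iota> (x + y) = \<iota> x \<oplus>\<^bsub>R\<^esub> \<iota> y"
    "\<And>x y. \<iota> (x * y) = \<iota> x \<otimes>\<^bsub>R\<^esub> \<iota> y"
  shows "coeff_map \<iota> (u * v) = coeff_map \<iota> u \<otimes>\<^bsub>mpowser_ring R\<^esub> coeff_map \<iota> v"
proof
  interpret ring R by fact
  fix a :: "3 \<Rightarrow> nat"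
  have hom_sum: "finsum R (\<lambda>b. \<iota> (f b)) A = \<iota> (sum f A)" if "finite A" for f :: "(3 \<Rightarrow> nat) \<Rightarrow> int" and A
    using that by (induction A rule: finite_induct) (auto simp: \<iota>)
  have fin: "finite {b. b \<le> a}" unfolding atMost_vec3 by (intro finite_imageI finite_cartesian_product) auto
  have "(coeff_map \<iota> u \<otimes>\<^bsub>mpowser_ring R\<^esub> coeff_map \<iota> v) a
     = finsum R (\<lambda>b. \<iota> (coeff3 u (b 0) (b 1) (b 2) * coeff3 v (a 0 - b 0) (a 1 - b 1) (a 2 - b 2))) {b. b \<le> a}"
    by (simp add: mpowser_ring_def coeff_map_def \<iota>)
  also have "\<dots> = \<iota> (\<Sum>b\<in>{b. b \<le> a}. coeff3 u (b 0) (b 1) (b 2) * coeff3 v (a 0 - b 0) (a 1 - b 1) (a 2 - b 2))"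
    by (rule hom_sum[OF fin])
  also have "(\<Sum>b\<in>{b. b \<le> a}. coeff3 u (b 0) (b 1) (b 2) * coeff3 v (a 0 - b 0) (a 1 - b 1) (a 2 - b 2))
     = (\<Sum>(i, j, l)\<in>{..a 0} \<times> {..a 1} \<times> {..a 2}. coeff3 u i j l * coeff3 v (a 0 - i) (a 1 - j) (a 2 - l))"
    unfolding atMost_vec3 by (subst sum.reindex[OF inj_vec3]) (simp add: case_prod_beta)
  also have "\<dots> = coeff3 (u * v) (a 0) (a 1) (a 2)"
    by (simp add: coeff3_mult sum.cartesian_product)
  finally show "coeff_map \<iota> (u * v) a = (coeff_map \<iota> u \<otimes>\<^bsub>mpowser_ring R\<^esub> coeff_map \<iota> v) a"
    by (simp add: coeff_map_def)
qed

lemma coeff_map_add: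
  assumes "\<And>x y. \<iota> (x + y) = \<iota> x \<oplus>\<^bsub>R\<^esub> \<iota> y"
  shows "coeff_map \<iota> (u + v) = coeff_map \<iota> u \<oplus>\<^bsub>mpowser_ring R\<^esub> coeff_map \<iota> v"
  by (auto simp: coeff_map_def mpowser_ring_def assms)

lemma coeff3_one: "coeff3 1 i j l = (if i = 0 \<and> j = 0 \<and> l = 0 then 1 else (0::'a::comm_ring_1))"
  by (auto simp: coeff3_def)

lemma coeff_map_one:
  assumes "\<iota> 0 = \<zero>\<^bsub>R\<^esub>" "\<iota> 1 = \<one>\<^bsub>R\<^esub>"
  shows "coeff_map \<iota> 1 = \<one>\<^bsub>mpowser_ring R\<^esub>"
  unfolding fun_eq_iff mpowser_ring_def coeff_map_def using all_3[of "\<lambda>v. _ v = (0::nat)"]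
  by (auto simp: coeff3_one assms fun_eq_iff)

lemma coeff_map_zero:
  assumes "\<iota> 0 = \<zero>\<^bsub>R\<^esub>"
  shows "coeff_map \<iota> 0 = \<zero>\<^bsub>mpowser_ring R\<^esub>"
  by (auto simp: coeff_map_def mpowser_ring_def assms)

lemma coeff_map_power:
  assumes R: "ring R" and \<iota>: "\<And>x. \<iota> x \<in> carrier R" "\<iota> 0 = \<zero>\<^bsub>R\<^esub>" "\<iota> 1 = \<one>\<^bsub>R\<^esub>" "\<And>x y. \<iota> (x + y) = \<iota> x \<oplus>\<^bsub>R\<^esub> \<iota> y"
    "\<And>x y. \<iota> (x * y) = \<iota> x \<otimes>\<^bsub>R\<^esub> \<iota> y"
  shows "coeff_map \<iota> (u ^ k) = coeff_map \<iota> u [^]\<^bsub>mpowser_ring R\<^esub> k"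
proof (induction k)
  case 0
  show ?case by (simp add: nat_pow_def coeff_map_one \<iota>)
next
  case (Suc k)
  have "coeff_map \<iota> (u ^ Suc k) = coeff_map \<iota> (u ^ k * u)" by (simp add: mult.commute)
  also have "\<dots> = coeff_map \<iota> (u ^ k) \<otimes>\<^bsub>mpowser_ring R\<^esub> coeff_map \<iota> u"
    by (rule coeff_map_mult[OF R \<iota>(1,2,4,5)])
  finally show ?case using Suc.IH by (simp add: nat_pow_def)
qed

lemma coeff_map_vars:
  assumes "\<iota> 0 = \<zero>\<^bsub>R\<^esub>" "\<iota> 1 = \<one>\<^bsub>R\<^esub>"
  shows "coeff_map \<iota> fps_X = mvar R 0" "coeff_map \<iota> (fps_const fps_X) = mvar R 1"
    "coeff_map \<iota> (fps_const (fps_const fps_X)) = mvar R 2"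
  by (auto simp: fun_eq_iff all_3 mvar_def coeff_map_def coeff3_def assms fps_X_def)

lemma coeff_map_D_poly:
  assumes R: "ring R" and \<iota>: "\<And>x. \<iota> x \<in> carrier R" "\<iota> 0 = \<zero>\<^bsub>R\<^esub>" "\<iota> 1 = \<one>\<^bsub>R\<^esub>" "\<And>x y. \<iota> (x + y) = \<iota> x \<oplus>\<^bsub>R\<^esub> \<iota> y"
    "\<And>x y. \<iota> (x * y) = \<iota> x \<otimes>\<^bsub>R\<^esub> \<iota> y" and S: "S = mpowser_ring R"
  shows "coeff_map \<iota> (D_poly n) = mvar R 0 [^]\<^bsub>S\<^esub> (2::nat) \<oplus>\<^bsub>S\<^esub> mvar R 1 [^]\<^bsub>S\<^esub> (2::nat) \<otimes>\<^bsub>S\<^esub> mvar R 2 \<oplus>\<^bsub>S\<^esub> mvar R 2 [^]\<^bsub>S\<^esub> (n - 1)"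
  unfolding D_poly_def S fps_const_power[symmetric] coeff_map_add[of \<iota> R, OF \<iota>(4)] coeff_map_mult[OF R \<iota>(1,2,4,5)]
    coeff_map_power[OF R \<iota>] coeff_map_vars[OF \<iota>(2,3)] ..

section \<open>Length over the reduction mod p as an exponent of p\<close>

text \<open>Transports the ring axioms along reduction mod p, so that associativity of the
  convolution in \<open>mpowser_ring\<close> comes from the nested series.\<close>

lemma cring_of_surj_hom:
  fixes \<phi> :: "'b::comm_ring_1 \<Rightarrow> 'a" and S :: "'a ring"
  assumes "carrier S = range \<phi>" "\<And>x y. \<phi> (x + y) = \<phi> x \<oplus>\<^bsub>S\<^esub> \<phi> y" "\<And>x y. \<phi> (x * y) = \<phi> x \<otimes>\<^bsub>S\<^esub> \<phi> y"
    "\<phi> 0 = \<zero>\<^bsub>S\<^esub>" "\<phi> 1 = \<one>\<^bsub>S\<^esub>"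
  shows "cring S"
proof (rule cringI)
  show "abelian_group S"
  proof (rule abelian_groupI)
    fix x assume "x \<in> carrier S"
    then obtain u where "x = \<phi> u" using assms by auto
    thus "\<exists>y\<in>carrier S. y \<oplus>\<^bsub>S\<^esub> x = \<zero>\<^bsub>S\<^esub>"
      using assms by (intro bexI[of _ "\<phi> (- u)"]) (auto simp flip: assms(2,4))
  qed (auto simp: assms(1) simp flip: assms(2,4) intro: arg_cong[of _ _ \<phi>] simp: algebra_simps)
  show "Group.comm_monoid S"
    by (rule comm_monoidI) (auto simp: assms(1) simp flip: assms(3,5) simp: algebra_simps)
qed (auto simp: assms(1) simp flip: assms(2,3) simp: algebra_simps)

lemma is_ideal_h_lift: "is_ideal (h_lift p f k q)"
proof -
  have "r * u \<in> h_lift p f k q" if "u \<in> h_lift p f k q" for r u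
  proof -
    from that obtain v where "u - f ^ k * v \<in> p_box p q" by (auto simp: h_lift_def)
    hence "r * (u - f ^ k * v) \<in> p_box p q" by (rule is_idealD(2)[OF is_ideal_p_box])
    hence "r * u - f ^ k * (r * v) \<in> p_box p q" by (simp add: algebra_simps)
    thus ?thesis unfolding h_lift_def by blast
  qed
  thus ?thesis using add_subgroup_h_lift by (auto simp: is_ideal_def)
qed

lemma p_box_subset_h_lift: "p_box p q \<subseteq> h_lift p f k q"
proof
  fix u assume "u \<in> p_box p q"
  thus "u \<in> h_lift p f k q" unfolding h_lift_def by (intro CollectI exI[of _ 0]) simp
qed

text \<open>Each monomial is assigned to the first variable whose exponent is at least q; the
  remaining coefficients are divisible by p.\<close>

lemma p_box_decompose:
  assumes "w \<in> p_box p q"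
  shows "\<exists>r0 r1 r2 r3. w = of_nat p * r0 + fps_X ^ q * r1 + fps_const fps_X ^ q * r2 + fps_const (fps_const fps_X) ^ q * r3"
proof -
  define mk :: "(nat \<Rightarrow> nat \<Rightarrow> nat \<Rightarrow> int) \<Rightarrow> int fps fps fps"
    where "mk c = Abs_fps (\<lambda>i. Abs_fps (\<lambda>j. Abs_fps (\<lambda>l. c i j l)))" for c
  have mk: "coeff3 (mk c) i j l = c i j l" for c i j l by (simp add: mk_def coeff3_def)
  have "w = of_nat p * mk (\<lambda>i j l. if i < q \<and> j < q \<and> l < q then coeff3 w i j l div int p else 0)
    + fps_X ^ q * mk (\<lambda>i j l. coeff3 w (i + q) j l)
    + fps_const fps_X ^ q * mk (\<lambda>i j l. if i < q then coeff3 w i (j + q) l else 0)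
    + fps_const (fps_const fps_X) ^ q * mk (\<lambda>i j l. if i < q \<and> j < q then coeff3 w i j (l + q) else 0)"
    unfolding coeff3_eq_iff coeff3_simps coeff3_of_nat_mult coeff3_var_power_mult mk
    using assms by (auto simp: p_box_def)
  thus ?thesis by blast
qed

text \<open>Reduction \<open>\<phi>\<close> is onto and its kernel lies in
  \<open>h_lift p f k q\<close>, the preimage of the ideal in question. Submodules of the quotient
  thus correspond to ideals of the lift containing \<open>h_lift p f k q\<close>, and the chain
  count applies.\<close>

lemma module_length_h_lift:
  fixes f :: "int fps fps fps" and R :: "int ring"
  assumes p: "Factorial_Ring.prime p"
  defines "R \<equiv> residue_ring (int p)"
  defines "S \<equiv> mpowser_ring R"
  defines "\<phi> \<equiv> coeff_map (\<lambda>x. x mod int p)"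
  shows "\<exists>D. quotient_index (h_lift p f k q) = p ^ D \<and> D \<le> q ^ 3 \<and>
    module_length S (quot_module S (Idl\<^bsub>S\<^esub> (insert (\<phi> f [^]\<^bsub>S\<^esub> k) (range (\<lambda>i. mvar R i [^]\<^bsub>S\<^esub> q))))) = enat D"
proof -
  have p1: "p > 1" using p prime_gt_1_nat by blast
  interpret R: residues "int p" R using p1 by unfold_locales (auto simp: R_def)
  have \<iota>: "x mod int p \<in> carrier R" "0 mod int p = \<zero>\<^bsub>R\<^esub>" "1 mod int p = \<one>\<^bsub>R\<^esub>"
    "(x + y) mod int p = (x mod int p) \<oplus>\<^bsub>R\<^esub> (y mod int p)" "(x * y) mod int p = (x mod int p) \<otimes>\<^bsub>R\<^esub> (y mod int p)" for x y
    using p1 R.add_cong[symmetric] R.mult_cong[symmetric] by (simp_all only: R.mod_in_carrier R.res_zero_eq R.res_one_eq mod_0) simp_all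
  have ringR: "ring R" by (rule R.ring_axioms)
  have \<phi>_add: "\<phi> (u + v) = \<phi> u \<oplus>\<^bsub>S\<^esub> \<phi> v" for u v
    unfolding \<phi>_def S_def by (rule coeff_map_add) (rule \<iota>)
  have \<phi>_mult: "\<phi> (u * v) = \<phi> u \<otimes>\<^bsub>S\<^esub> \<phi> v" for u v
    unfolding \<phi>_def S_def by (rule coeff_map_mult[OF ringR]) (rule \<iota>)+
  have \<phi>_zero: "\<phi> 0 = \<zero>\<^bsub>S\<^esub>" unfolding \<phi>_def S_def by (rule coeff_map_zero) (rule \<iota>)
  have \<phi>_one: "\<phi> 1 = \<one>\<^bsub>S\<^esub>" unfolding \<phi>_def S_def by (rule coeff_map_one) (rule \<iota>)+
  have \<phi>_power: "\<phi> (u ^ k) = \<phi> u [^]\<^bsub>S\<^esub> k" for u k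
    unfolding \<phi>_def S_def by (rule coeff_map_power[OF ringR]) (rule \<iota>)+
  have \<phi>_var: "\<phi> fps_X = mvar R 0" "\<phi> (fps_const fps_X) = mvar R 1" "\<phi> (fps_const (fps_const fps_X)) = mvar R 2"
    unfolding \<phi>_def by (rule coeff_map_vars; rule \<iota>)+
  have carr: "carrier S = range \<phi>"
  proof
    show "range \<phi> \<subseteq> carrier S" by (auto simp: S_def mpowser_ring_def \<phi>_def coeff_map_def)
    show "carrier S \<subseteq> range \<phi>"
    proof
      fix s assume "s \<in> carrier S"
      hence s: "s a \<in> {0..int p - 1}" for a
        by (auto simp: S_def mpowser_ring_def R.res_carrier_eq)
      define u where "u = Abs_fps (\<lambda>i. Abs_fps (\<lambda>j. Abs_fps (\<lambda>l. s (vec3 i j l))))"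
      have "\<phi> u = s"
      proof
        fix a
        have "\<phi> u a = s (vec3 (a 0) (a 1) (a 2)) mod int p" by (simp add: \<phi>_def coeff_map_def u_def coeff3_def)
        thus "\<phi> u a = s a" using s[of a] by (simp add: vec3_eq[symmetric])
      qed
      thus "s \<in> range \<phi>" by blast
    qed
  qed
  have ker: "\<phi> u = \<phi> v \<longleftrightarrow> u - v \<in> p_multiples p" for u v
  proof -
    have "\<phi> u = \<phi> v \<longleftrightarrow> (\<forall>i j l. coeff3 u i j l mod int p = coeff3 v i j l mod int p)"
    proof
      assume h: "\<phi> u = \<phi> v"
      show "\<forall>i j l. coeff3 u i j l mod int p = coeff3 v i j l mod int p"
      proof (intro allI)
        fix i j l
        show "coeff3 u i j l mod int p = coeff3 v i j l mod int p"
          using fun_cong[OF h, of "vec3 i j l"] by (simp add: \<phi>_def coeff_map_def)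
      qed
    qed (simp add: \<phi>_def coeff_map_def)
    thus ?thesis by (simp add: mod_eq_dvd_iff p_multiples_def)
  qed
  interpret S: cring S
    by (rule cring_of_surj_hom[OF carr \<phi>_add \<phi>_mult \<phi>_zero \<phi>_one])
  define H where "H = h_lift p f k q"
  note HI = is_ideal_h_lift[of p f k q, folded H_def]
  note GH = add_subgroupD[OF is_idealD(1)[OF HI]]
  define I where "I = \<phi> ` H"
  have p_multiples_H: "p_multiples p \<subseteq> H" using p_box_subset_h_lift[of p q f k] by (auto simp: p_multiples_alt H_def)
  have mem_I: "\<phi> u \<in> I \<longleftrightarrow> u \<in> H" for u
  proof
    assume "\<phi> u \<in> I"
    then obtain v where v: "v \<in> H" "\<phi> u = \<phi> v" by (auto simp: I_def)
    hence "u - v \<in> H" using p_multiples_H by (auto simp: ker)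
    from GH(4)[OF this v(1)] show "u \<in> H" by simp
  qed (auto simp: I_def)
  have \<phi>_uminus: "\<ominus>\<^bsub>S\<^esub> \<phi> u = \<phi> (- u)" for u
    by (rule S.minus_equality) (auto simp: carr \<phi>_add[symmetric] \<phi>_zero[symmetric])
  have ideal: "ideal I S"
  proof (rule idealI[OF S.ring_axioms])
    show "subgroup I (add_monoid S)"
    proof (rule S.add.subgroupI)
      show "I \<subseteq> carrier S" by (auto simp: I_def carr)
      show "I \<noteq> {}" using GH(1) by (auto simp: I_def)
    next
      fix a assume "a \<in> I"
      then obtain u where u: "u \<in> H" "a = \<phi> u" by (auto simp: I_def)
      have "\<ominus>\<^bsub>S\<^esub> a = \<phi> (- u)" by (simp add: u \<phi>_uminus)
      thus "\<ominus>\<^bsub>S\<^esub> a \<in> I" using GH(3)[OF u(1)] by (simp add: mem_I)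
    next
      fix a b assume "a \<in> I" "b \<in> I"
      then obtain u v where u: "u \<in> H" "a = \<phi> u" "v \<in> H" "b = \<phi> v" by (auto simp: I_def)
      thus "a \<oplus>\<^bsub>S\<^esub> b \<in> I" using GH(4)[of u v] by (simp add: mem_I flip: \<phi>_add)
    qed
  next
    fix a x assume "a \<in> I" "x \<in> carrier S"
    then obtain u r where u: "u \<in> H" "a = \<phi> u" "x = \<phi> r" by (auto simp: I_def carr)
    show "x \<otimes>\<^bsub>S\<^esub> a \<in> I" "a \<otimes>\<^bsub>S\<^esub> x \<in> I"
      using is_idealD(2,3)[OF HI u(1), of r] by (simp_all add: u mem_I flip: \<phi>_mult)
  qed
  interpret I: ideal I S by (rule ideal)
  define gens where "gens = insert (\<phi> f [^]\<^bsub>S\<^esub> k) (range (\<lambda>i. mvar R i [^]\<^bsub>S\<^esub> q))"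
  have gens: "gens = {\<phi> (f ^ k), \<phi> (fps_X ^ q), \<phi> (fps_const fps_X ^ q), \<phi> (fps_const (fps_const fps_X) ^ q)}"
    unfolding gens_def \<phi>_power \<phi>_var UNIV_3' image_insert image_empty ..
  have Idl: "Idl\<^bsub>S\<^esub> gens = I"
  proof
    have "f ^ k \<in> H" unfolding H_def h_lift_def
      using add_subgroupD(1)[OF is_idealD(1)[OF is_ideal_p_box]] by (intro CollectI exI[of _ 1]) simp
    moreover have "fps_X ^ q \<in> p_box p q" "fps_const fps_X ^ q \<in> p_box p q" "fps_const (fps_const fps_X) ^ q \<in> p_box p q"
      unfolding p_box_def
      using coeff3_var_power_mult[of q "1 :: int fps fps fps"] by auto
    hence "fps_X ^ q \<in> H" "fps_const fps_X ^ q \<in> H" "fps_const (fps_const fps_X) ^ q \<in> H"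
      using p_box_subset_h_lift[of p q f k] by (auto simp: H_def)
    ultimately show "Idl\<^bsub>S\<^esub> gens \<subseteq> I"
      by (intro S.genideal_minimal ideal) (auto simp: gens I_def)
    have gc: "gens \<subseteq> carrier S" by (auto simp: gens carr)
    interpret G: ideal "Idl\<^bsub>S\<^esub> gens" S by (rule S.genideal_ideal[OF gc])
    have g: "\<phi> (g * r) \<in> Idl\<^bsub>S\<^esub> gens" if "\<phi> g \<in> gens" for g r
      unfolding \<phi>_mult using S.genideal_self[OF gc] that by (intro G.I_r_closed) (auto simp: carr)
    show "I \<subseteq> Idl\<^bsub>S\<^esub> gens"
    proof
      fix a assume "a \<in> I"
      then obtain u where u: "u \<in> H" "a = \<phi> u" by (auto simp: I_def)
      then obtain v where "u - f ^ k * v \<in> p_box p q" by (auto simp: H_def h_lift_def)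
      then obtain r0 r1 r2 r3 where "u - f ^ k * v = of_nat p * r0 + fps_X ^ q * r1 + fps_const fps_X ^ q * r2 + fps_const (fps_const fps_X) ^ q * r3"
        using p_box_decompose by blast
      hence "u - (f ^ k * v + fps_X ^ q * r1 + fps_const fps_X ^ q * r2 + fps_const (fps_const fps_X) ^ q * r3) = of_nat p * r0"
        by (simp add: algebra_simps)
      hence "\<phi> u = \<phi> (f ^ k * v + fps_X ^ q * r1 + fps_const fps_X ^ q * r2 + fps_const (fps_const fps_X) ^ q * r3)"
        unfolding ker by (simp add: p_multiples_def coeff3_of_nat_mult)
      also have "\<dots> \<in> Idl\<^bsub>S\<^esub> gens"
        unfolding \<phi>_add by (intro G.a_closed g) (auto simp: gens)
      finally show "a \<in> Idl\<^bsub>S\<^esub> gens" by (simp add: u)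
    qed
  qed
  define M where "M = quot_module S I"
  define \<Phi> where "\<Phi> u = I +>\<^bsub>S\<^esub> \<phi> u" for u
  have cM: "carrier M = range \<Phi>"
    by (auto simp: M_def quot_module_def ring.extend_def module.fields_def FactRing_def A_RCOSETS_def' \<Phi>_def carr)
  have addM: "\<Phi> u \<oplus>\<^bsub>M\<^esub> \<Phi> v = \<Phi> (u + v)" for u v
    using I.a_rcos_sum[of "\<phi> u" "\<phi> v"]
    by (simp add: M_def quot_module_def ring.extend_def module.fields_def FactRing_def \<Phi>_def carr \<phi>_add)
  have \<Phi>_eq: "\<Phi> u = \<Phi> v \<longleftrightarrow> u - v \<in> H" for u v
  proof -
    have "\<phi> u \<ominus>\<^bsub>S\<^esub> \<phi> v = \<phi> (u - v)" by (simp add: a_minus_def \<phi>_uminus flip: \<phi>_add)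
    thus ?thesis using S.quotient_eq_iff_same_a_r_cos[OF ideal, of "\<phi> u" "\<phi> v"]
      by (simp add: \<Phi>_def mem_I carr)
  qed
  have zeroM: "\<zero>\<^bsub>M\<^esub> = \<Phi> 0"
    using S.a_coset_add_zero[of I] I.a_subset
    by (simp add: M_def quot_module_def ring.extend_def module.fields_def FactRing_def \<Phi>_def \<phi>_zero)
  have smultM: "\<phi> r \<odot>\<^bsub>M\<^esub> \<Phi> u = \<Phi> (r * u)" for r u
    using I.rcoset_mult_add[of "\<phi> r" "\<phi> u"]
    by (simp add: M_def quot_module_def ring.extend_def module.fields_def FactRing_def \<Phi>_def carr \<phi>_mult)
  have grp: "Group.group (add_monoid M)"
  proof (rule groupI)
    fix a assume "a \<in> carrier (add_monoid M)"
    then obtain u where "a = \<Phi> u" by (auto simp: cM)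
    thus "\<exists>b\<in>carrier (add_monoid M). b \<otimes>\<^bsub>add_monoid M\<^esub> a = \<one>\<^bsub>add_monoid M\<^esub>"
      by (intro bexI[of _ "\<Phi> (- u)"]) (auto simp: cM addM zeroM)
  qed (auto simp: cM addM zeroM add.assoc)
  have sub_to_ideal: "is_ideal {u. \<Phi> u \<in> N}" "H \<subseteq> {u. \<Phi> u \<in> N}" if N: "submodule N S M" for N
  proof -
    interpret N: submodule N S M by fact
    have z: "\<Phi> 0 \<in> N" using N.one_closed by (simp add: zeroM)
    have sm: "\<Phi> (r * u) \<in> N" if "\<Phi> u \<in> N" for r u
      using N.smult_closed[of "\<phi> r" "\<Phi> u"] that by (simp add: smultM carr)
    have ad: "\<Phi> (u + v) \<in> N" if "\<Phi> u \<in> N" "\<Phi> v \<in> N" for u v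
      using N.m_closed[OF that] by (simp add: addM)
    show "is_ideal {u. \<Phi> u \<in> N}"
    proof (rule is_idealI)
      fix u v assume "u \<in> {u. \<Phi> u \<in> N}" "v \<in> {u. \<Phi> u \<in> N}"
      thus "u - v \<in> {u. \<Phi> u \<in> N}" using ad[of u "(-1) * v"] sm[of v "-1"] by simp
    qed (use z sm in auto)
    show "H \<subseteq> {u. \<Phi> u \<in> N}"
    proof
      fix u assume "u \<in> H"
      hence "\<Phi> u = \<Phi> 0" by (simp add: \<Phi>_eq)
      thus "u \<in> {u. \<Phi> u \<in> N}" using z by simp
    qed
  qed
  have ideal_to_sub: "submodule (\<Phi> ` J) S M" if J: "is_ideal J" for J
  proof (intro submodule.intro submodule_axioms.intro)
    note GJ = add_subgroupD[OF is_idealD(1)[OF J]]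
    show "subgroup (\<Phi> ` J) (add_monoid M)"
    proof (rule group.subgroupI[OF grp])
      show "\<Phi> ` J \<subseteq> carrier (add_monoid M)" by (auto simp: cM)
      show "\<Phi> ` J \<noteq> {}" using GJ(1) by auto
    next
      fix a assume "a \<in> \<Phi> ` J"
      then obtain u where u: "u \<in> J" "a = \<Phi> u" by auto
      have "inv\<^bsub>add_monoid M\<^esub> a = \<Phi> (- u)"
        by (rule group.inv_equality[OF grp]) (auto simp: u addM zeroM cM)
      thus "inv\<^bsub>add_monoid M\<^esub> a \<in> \<Phi> ` J" using GJ(3)[OF u(1)] by simp
    next
      fix a b assume "a \<in> \<Phi> ` J" "b \<in> \<Phi> ` J"
      thus "a \<otimes>\<^bsub>add_monoid M\<^esub> b \<in> \<Phi> ` J" using GJ(4) by (auto simp: addM)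
    qed
  next
    fix a x assume "a \<in> carrier S" "x \<in> \<Phi> ` J"
    thus "a \<odot>\<^bsub>M\<^esub> x \<in> \<Phi> ` J" using is_idealD(2)[OF J] by (auto simp: carr smultM)
  qed
  obtain D where D: "quotient_index H = p ^ D" "D \<le> q ^ 3"
    "\<And>n. (\<exists>J :: nat \<Rightarrow> int fps fps fps set. (\<forall>i\<le>n. is_ideal (J i) \<and> H \<subseteq> J i) \<and> (\<forall>i<n. J i \<subset> J (Suc i))) \<longleftrightarrow> n \<le> D"
    using ideal_chain_length[OF p HI p_box_subset_h_lift[of p q f k, folded H_def]] by blast
  \<comment> \<open>Preimages and images under \<open>\<Phi>\<close> carry strict chains in both
    directions, since \<open>\<Phi> u = \<Phi> v\<close> means that u - v lies in \<open>H\<close>,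
    which every ideal concerned contains.\<close>
  have chain: "(\<exists>N :: nat \<Rightarrow> _ set. (\<forall>i\<le>n. submodule (N i) S M) \<and> (\<forall>i<n. N i \<subset> N (Suc i))) \<longleftrightarrow> n \<le> D" for n
  proof
    assume "\<exists>N :: nat \<Rightarrow> _ set. (\<forall>i\<le>n. submodule (N i) S M) \<and> (\<forall>i<n. N i \<subset> N (Suc i))"
    then obtain N where N: "\<And>i. i \<le> n \<Longrightarrow> submodule (N i) S M" "\<And>i. i < n \<Longrightarrow> N i \<subset> N (Suc i)" by blast
    have "{u. \<Phi> u \<in> N i} \<subset> {u. \<Phi> u \<in> N (Suc i)}" if "i < n" for i
    proof -
      have "N (Suc i) \<subseteq> range \<Phi>"
        using subgroup.subset[OF submodule.axioms(1)[OF N(1)[of "Suc i"]]] that by (simp add: cM)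
      thus ?thesis using N(2)[OF that] by blast
    qed
    thus "n \<le> D" using sub_to_ideal[OF N(1)] by (subst D(3)[symmetric], intro exI[of _ "\<lambda>i. {u. \<Phi> u \<in> N i}"]) auto
  next
    assume "n \<le> D"
    then obtain J :: "nat \<Rightarrow> int fps fps fps set" where
      J: "\<And>i. i \<le> n \<Longrightarrow> is_ideal (J i)" "\<And>i. i \<le> n \<Longrightarrow> H \<subseteq> J i" "\<And>i. i < n \<Longrightarrow> J i \<subset> J (Suc i)"
      using D(3)[of n] by blast
    have "\<Phi> ` J i \<subset> \<Phi> ` J (Suc i)" if i: "i < n" for i
    proof -
      obtain u where u: "u \<in> J (Suc i)" "u \<notin> J i" using J(3)[OF i] by blast
      have "\<Phi> u \<notin> \<Phi> ` J i"
      proof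
        assume "\<Phi> u \<in> \<Phi> ` J i"
        then obtain v where v: "v \<in> J i" "u - v \<in> H" by (auto simp: \<Phi>_eq)
        hence "u - v \<in> J i" using J(2)[of i] i by auto
        from add_subgroupD(4)[OF is_idealD(1)[OF J(1)[of i]] this v(1)] i u(2) show False by simp
      qed
      thus ?thesis using u(1) J(3)[OF i] by blast
    qed
    thus "\<exists>N :: nat \<Rightarrow> _ set. (\<forall>i\<le>n. submodule (N i) S M) \<and> (\<forall>i<n. N i \<subset> N (Suc i))"
      using ideal_to_sub[OF J(1)] by (intro exI[of _ "\<lambda>i. \<Phi> ` J i"]) blast
  qed
  have "module_length S M = Sup {enat n | n. n \<le> D}"
    unfolding module_length_def chain ..
  also have "\<dots> = enat D"
    by (rule Sup_eqI) auto
  finally show ?thesis using D(1,2) Idl unfolding M_def H_def gens_def by blast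
qed

subsection \<open>Existence of the \<open>h\<close>-functions\<close>

text \<open>At k = p all blocks have full size p, so the length reaches its maximum p^3. This
  justifies cutting k off at p later.\<close>

lemma length_sum_self:
  assumes "odd p"
  shows "length_sum M p p = p ^ 3"
proof -
  have j: "jordan_size p p i = p" if "i < p" for i
  proof -
    have "i div 2 < (p + 1 - i mod 2) div 2" using that assms by (cases "even i") (auto elim!: oddE evenE)
    thus ?thesis by (simp add: jordan_size_def Let_def)
  qed
  have "length_sum M p p = (\<Sum>i<p. \<Sum>l<p. p)"
    unfolding length_sum_def by (intro sum.cong refl) (simp add: j)
  thus ?thesis by (simp add: power3_eq_cube)
qed

text \<open>The rounding behind monotonicity: the exponent at level e + 1 is at most p times the
  exponent at level e.\<close>

lemma ceiling_power_Suc_le: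
  assumes "p > 0"
  shows "nat \<lceil>t * real p ^ Suc e\<rceil> \<le> p * nat \<lceil>t * real p ^ e\<rceil>"
proof (cases "t \<le> 0")
  case True
  hence "t * real p ^ Suc e \<le> 0" by (intro mult_nonpos_nonneg) auto
  hence "\<lceil>t * real p ^ Suc e\<rceil> \<le> 0" by (simp only: ceiling_le_zero)
  thus ?thesis by simp
next
  case False
  hence "0 \<le> t * real p ^ e" by simp
  from ceiling_mono[OF this] have nn: "\<lceil>t * real p ^ e\<rceil> \<ge> 0" by simp
  have "t * real p ^ Suc e = real p * (t * real p ^ e)" by simp
  also have "\<dots> \<le> real p * of_int \<lceil>t * real p ^ e\<rceil>" by (intro mult_left_mono) auto
  also have "\<dots> = of_int (int (p * nat \<lceil>t * real p ^ e\<rceil>))" using nn by simp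
  finally have "\<lceil>t * real p ^ Suc e\<rceil> \<le> int (p * nat \<lceil>t * real p ^ e\<rceil>)" by (simp only: ceiling_le_iff)
  thus ?thesis by (simp only: nat_le_iff)
qed

text \<open>The rounding behind the lower bound: from level 1 on, the exponent dominates the
  rescaled floor of t p.\<close>

lemma floor_power_le_ceiling:
  "p ^ e * nat \<lfloor>t * real p\<rfloor> \<le> nat \<lceil>t * real p ^ Suc e\<rceil>"
proof (cases "\<lfloor>t * real p\<rfloor> \<le> 0")
  case False
  have "real (p ^ e * nat \<lfloor>t * real p\<rfloor>) = real p ^ e * of_int \<lfloor>t * real p\<rfloor>" using False by simp
  also have "\<dots> \<le> real p ^ e * (t * real p)" by (intro mult_left_mono) auto
  also have "\<dots> = t * real p ^ Suc e" by simp
  also have "\<dots> \<le> of_int \<lceil>t * real p ^ Suc e\<rceil>" by (rule le_of_int_ceiling)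
  finally have "of_int (int (p ^ e * nat \<lfloor>t * real p\<rfloor>)) \<le> (of_int \<lceil>t * real p ^ Suc e\<rceil> :: real)"
    by (simp only: of_int_of_nat_eq)
  hence "int (p ^ e * nat \<lfloor>t * real p\<rfloor>) \<le> \<lceil>t * real p ^ Suc e\<rceil>" by (simp only: of_int_le_iff)
  thus ?thesis by linarith
qed simp

text \<open>The normalized lengths L(k, q)/q^3 do not change when k and q are both multiplied by p,
  and they grow with k. Hence the defining sequence decreases and is bounded below by 0; its value
  at level 1 bounds the limit from above, and the rescaled floor bounds it from below.\<close>

lemma h_function_bounds:
  fixes f :: "int fps fps fps"
  assumes p: "Factorial_Ring.prime p" and frob: "frob_linear p f"
  shows "\<exists>H len. is_h_function (residue_ring (int p)) p (coeff_map (\<lambda>x. x mod int p) f) H \<and>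
    (\<forall>k. quotient_index (h_lift p f k p) = p ^ len k \<and> len k \<le> p ^ 3) \<and>
    (\<forall>t. real (len (nat \<lfloor>t * real p\<rfloor>)) / real p ^ 3 \<le> H t \<and> H t \<le> real (len (nat \<lceil>t * real p\<rceil>)) / real p ^ 3)"
proof -
  have p1: "p > 1" using p prime_gt_1_nat by blast
  define S where "S = (mpowser_ring (residue_ring (int p)) :: ((3 \<Rightarrow> nat) \<Rightarrow> int) ring)"
  define modlen where "modlen k q = module_length S (quot_module S (Idl\<^bsub>S\<^esub> (insert (coeff_map (\<lambda>x. x mod int p) f [^]\<^bsub>S\<^esub> k)
    (range (\<lambda>i. mvar (residue_ring (int p)) i [^]\<^bsub>S\<^esub> q)))))" for k q :: nat
  have "\<exists>D. quotient_index (h_lift p f k q) = p ^ D \<and> D \<le> q ^ 3 \<and> modlen k q = enat D" for k q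
    unfolding modlen_def S_def by (rule module_length_h_lift[OF p])
  then obtain L where L: "\<And>k q. quotient_index (h_lift p f k q) = p ^ L k q" "\<And>k q. L k q \<le> q ^ 3" "\<And>k q. modlen k q = enat (L k q)"
    by metis
  have mono: "L k q \<le> L k' q" if "k \<le> k'" for k k' q
  proof -
    have "quotient_index (h_lift p f k q) \<le> quotient_index (h_lift p f k' q)"
      using p1 by (intro quotient_index_antimono add_subgroup_h_lift h_lift_antimono that) (simp add: L)
    thus ?thesis using p1 by (simp add: L)
  qed
  have frob_L: "L (p * k) (p * q) = p ^ 3 * L k q" for k q
  proof -
    have "p ^ L (p * k) (p * q) = p ^ (L k q * p ^ 3)"
      using quotient_index_frobenius[OF frob, of k q] p1 by (simp add: L power_mult)
    thus ?thesis using p1 by (simp only: power_inject_exp mult.commute)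
  qed
  have frob_L': "L (p ^ e * k) (p ^ e * q) = p ^ (3 * e) * L k q" for e k q
  proof (induction e)
    case (Suc e)
    have "L (p ^ Suc e * k) (p ^ Suc e * q) = L (p * (p ^ e * k)) (p * (p ^ e * q))" by (simp add: mult.assoc)
    also have "\<dots> = p ^ 3 * (p ^ (3 * e) * L k q)" unfolding frob_L Suc.IH ..
    also have "\<dots> = p ^ (3 * Suc e) * L k q" by (simp add: power_add mult.assoc[symmetric])
    finally show ?case .
  qed simp
  define g where "g t e = real (L (nat \<lceil>t * real p ^ e\<rceil>) (p ^ e)) / real p ^ (e * 3)" for t e
  have dec: "decseq (g t)" for t
  proof (rule decseq_SucI)
    fix e
    have "L (nat \<lceil>t * real p ^ Suc e\<rceil>) (p ^ Suc e) \<le> L (p * nat \<lceil>t * real p ^ e\<rceil>) (p ^ Suc e)"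
      using p1 by (intro mono ceiling_power_Suc_le) auto
    also have "\<dots> = p ^ 3 * L (nat \<lceil>t * real p ^ e\<rceil>) (p ^ e)" using frob_L by simp
    finally have "real (L (nat \<lceil>t * real p ^ Suc e\<rceil>) (p ^ Suc e)) \<le> real (p ^ 3 * L (nat \<lceil>t * real p ^ e\<rceil>) (p ^ e))"
      by (simp only: of_nat_le_iff)
    thus "g t (Suc e) \<le> g t e" using p1 by (simp add: g_def divide_simps power_add power3_eq_cube mult_ac del: power_Suc)
  qed
  have "\<exists>h. g t \<longlonglongrightarrow> h \<and> (\<forall>i. h \<le> g t i)" for t
    using decseq_convergent[OF dec, of 0 t] by (metis divide_nonneg_nonneg g_def of_nat_0_le_iff zero_le_power)
  then obtain H where H: "\<And>t. g t \<longlonglongrightarrow> H t" "\<And>t i. H t \<le> g t i" by metis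
  have "is_h_function (residue_ring (int p)) p (coeff_map (\<lambda>x. x mod int p) f) H"
    unfolding is_h_function_def
  proof
    fix t
    have "ereal_of_enat (module_length S (quot_module S (h_ideal (residue_ring (int p)) p (coeff_map (\<lambda>x. x mod int p) f) t e)))
        / ereal (real p ^ (e * CARD(3))) = ereal (g t e)" for e
    proof -
      have "module_length S (quot_module S (h_ideal (residue_ring (int p)) p (coeff_map (\<lambda>x. x mod int p) f) t e))
         = modlen (nat \<lceil>t * real p ^ e\<rceil>) (p ^ e)"
        unfolding h_ideal_def Let_def modlen_def S_def ..
      thus ?thesis using p1 by (simp add: L g_def)
    qed
    thus "((\<lambda>e. ereal_of_enat (module_length (mpowser_ring (residue_ring (int p))) (quot_module (mpowser_ring (residue_ring (int p)))
          (h_ideal (residue_ring (int p)) p (coeff_map (\<lambda>x. x mod int p) f) t e))) / ereal (real p ^ (e * CARD(3)))) \<longlongrightarrow> ereal (H t)) sequentially"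
      using H(1)[of t] unfolding S_def by (simp add: tendsto_ereal)
  qed
  moreover have "real (L (nat \<lfloor>t * real p\<rfloor>) p) / real p ^ 3 \<le> H t" for t
  proof (rule LIMSEQ_le_const[OF H(1)])
    have "real (L (nat \<lfloor>t * real p\<rfloor>) p) / real p ^ 3 \<le> g t e" if e: "1 \<le> e" for e
    proof -
      obtain e' where e': "e = Suc e'" using e by (cases e) auto
      have "p ^ (3 * e') * L (nat \<lfloor>t * real p\<rfloor>) p = L (p ^ e' * nat \<lfloor>t * real p\<rfloor>) (p ^ e)"
        using frob_L'[of e' "nat \<lfloor>t * real p\<rfloor>" p] by (simp add: e' mult.commute)
      also have "\<dots> \<le> L (nat \<lceil>t * real p ^ e\<rceil>) (p ^ e)"
        unfolding e' by (intro mono floor_power_le_ceiling)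
      finally have "real (p ^ (3 * e') * L (nat \<lfloor>t * real p\<rfloor>) p) \<le> real (L (nat \<lceil>t * real p ^ e\<rceil>) (p ^ e))"
        by (simp only: of_nat_le_iff)
      hence "real p ^ (3 * e') * real (L (nat \<lfloor>t * real p\<rfloor>) p) \<le> real (L (nat \<lceil>t * real p ^ e\<rceil>) (p ^ e))" by simp
      moreover have "real p ^ (e * 3) = real p ^ (3 * e') * real p ^ 3" by (simp add: e' power_add[symmetric] algebra_simps)
      ultimately show ?thesis using p1 by (simp add: g_def divide_simps mult_ac)
    qed
    thus "\<exists>N. \<forall>e\<ge>N. real (L (nat \<lfloor>t * real p\<rfloor>) p) / real p ^ 3 \<le> g t e" by blast
  qed
  moreover have "H t \<le> real (L (nat \<lceil>t * real p\<rceil>) p) / real p ^ 3" for t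
    using H(2)[of t 1] by (simp add: g_def)
  ultimately show ?thesis using L(1,2) by (intro exI[of _ H] exI[of _ "\<lambda>k. L k p"]) blast
qed

lemma h_function_D_poly:
  assumes n: "n \<ge> 2"
  shows "\<exists>H :: nat \<Rightarrow> real \<Rightarrow> real. \<forall>p. Factorial_Ring.prime p \<longrightarrow>
    is_h_function (residue_ring (int p)) p (coeff_map (\<lambda>x. x mod int p) (D_poly n)) (H p) \<and>
    (odd p \<longrightarrow> (\<forall>t. real (length_sum (n - 2) p (min p (nat \<lfloor>t * real p\<rfloor>))) / real p ^ 3 \<le> H p t \<and>
       H p t \<le> real (length_sum (n - 2) p (min p (nat \<lceil>t * real p\<rceil>))) / real p ^ 3))"
proof -
  have "\<exists>H :: real \<Rightarrow> real. Factorial_Ring.prime p \<longrightarrow>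
    is_h_function (residue_ring (int p)) p (coeff_map (\<lambda>x. x mod int p) (D_poly n)) H \<and>
    (odd p \<longrightarrow> (\<forall>t. real (length_sum (n - 2) p (min p (nat \<lfloor>t * real p\<rfloor>))) / real p ^ 3 \<le> H t \<and>
       H t \<le> real (length_sum (n - 2) p (min p (nat \<lceil>t * real p\<rceil>))) / real p ^ 3))" for p
  proof (cases "Factorial_Ring.prime p")
    case p: True
    have p1: "p > 1" using p prime_gt_1_nat by blast
    obtain H len where H: "is_h_function (residue_ring (int p)) p (coeff_map (\<lambda>x. x mod int p) (D_poly n)) H"
      "\<And>k. quotient_index (h_lift p (D_poly n) k p) = p ^ len k" "\<And>k. len k \<le> p ^ 3"
      "\<And>t. real (len (nat \<lfloor>t * real p\<rfloor>)) / real p ^ 3 \<le> H t" "\<And>t. H t \<le> real (len (nat \<lceil>t * real p\<rceil>)) / real p ^ 3"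
      using h_function_bounds[OF p frob_linear_D_poly[OF p]] by metis
    have "len k = length_sum (n - 2) p (min p k)" if odd: "odd p" for k
    proof -
      have le: "len k = length_sum (n - 2) p k" if "k \<le> p" for k
        using quotient_index_D_poly[OF p odd that n] H(2)[of k] p1 by simp
      show ?thesis
      proof (cases "k \<le> p")
        case False
        \<comment> \<open>For k > p the length lies between its value p^3 at k = p and the general
          bound p^3.\<close>
        have "quotient_index (h_lift p (D_poly n) p p) \<le> quotient_index (h_lift p (D_poly n) k p)"
          using p1 False by (intro quotient_index_antimono add_subgroup_h_lift h_lift_antimono) (auto simp: H(2))
        hence "len p \<le> len k" using p1 by (simp add: H(2))
        thus ?thesis using le[of p] H(3)[of k] False length_sum_self[OF odd] by (simp add: min_def)
      qed (simp add: le min_def)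
    qed
    thus ?thesis using H(1,4,5) by (intro exI[of _ H]) auto
  qed auto
  thus ?thesis by metis
qed

subsection \<open>Riemann sums\<close>

lemma indicator_floor:
  assumes "p > 0" "i < p"
  shows "indicator {real i / real p..<(real i + 1) / real p} u = (if 0 \<le> u \<and> nat \<lfloor>u * real p\<rfloor> = i then 1 else (0::real))"
proof -
  have "u \<in> {real i / real p..<(real i + 1) / real p} \<longleftrightarrow> real i \<le> u * real p \<and> u * real p < real i + 1"
    using assms by (auto simp: field_simps)
  also have "\<dots> \<longleftrightarrow> \<lfloor>u * real p\<rfloor> = int i" by (auto simp: floor_eq_iff)
  also have "\<dots> \<longleftrightarrow> 0 \<le> u \<and> nat \<lfloor>u * real p\<rfloor> = i"
  proof
    assume h: "\<lfloor>u * real p\<rfloor> = int i"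
    hence "0 \<le> u * real p" by (metis of_nat_0_le_iff zero_le_floor)
    thus "0 \<le> u \<and> nat \<lfloor>u * real p\<rfloor> = i" using h assms by (auto simp: zero_le_mult_iff)
  next
    assume "0 \<le> u \<and> nat \<lfloor>u * real p\<rfloor> = i"
    moreover from this have "0 \<le> \<lfloor>u * real p\<rfloor>" by simp
    ultimately show "\<lfloor>u * real p\<rfloor> = int i" by linarith
  qed
  finally show ?thesis by (auto simp: indicator_def)
qed

text \<open>The summands change with p, so the sums are written as integrals of step functions and
  dominated convergence is used. The finite set \<open>A\<close> absorbs the points where
  \<open>jordan_size\<close> switches case.\<close>

lemma riemann_sum_tendsto:
  fixes F :: "nat \<Rightarrow> nat \<Rightarrow> real" and G :: "real \<Rightarrow> real"
  assumes bound: "\<And>p i. \<bar>F p i\<bar> \<le> 1" and G: "(G has_integral I) {0..1}" "G \<in> borel_measurable borel"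
    and A: "finite A" and lim: "\<And>u. 0 \<le> u \<Longrightarrow> u < 1 \<Longrightarrow> u \<notin> A \<Longrightarrow> (\<lambda>p. F p (nat \<lfloor>u * real p\<rfloor>)) \<longlonglongrightarrow> G u"
  shows "(\<lambda>p. (\<Sum>i<p. F p i) / real p) \<longlonglongrightarrow> I"
proof -
  define s where "s p u = (\<Sum>i<p. F p i * indicator {real i / real p..<(real i + 1) / real p} u)" for p u
  have s_eq: "s p u = (if 0 \<le> u \<and> u < 1 then F p (nat \<lfloor>u * real p\<rfloor>) else 0)" if p: "p > 0" for p u
  proof -
    have "s p u = (\<Sum>i<p. if i = nat \<lfloor>u * real p\<rfloor> then (if 0 \<le> u then F p i else 0) else 0)"
      unfolding s_def by (intro sum.cong refl) (simp add: indicator_floor[OF p] split: if_splits)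
    also have "\<dots> = (if nat \<lfloor>u * real p\<rfloor> < p then (if 0 \<le> u then F p (nat \<lfloor>u * real p\<rfloor>) else 0) else 0)"
      by simp
    also have "\<dots> = (if 0 \<le> u \<and> u < 1 then F p (nat \<lfloor>u * real p\<rfloor>) else 0)"
    proof (cases "0 \<le> u")
      case True
      have "nat \<lfloor>u * real p\<rfloor> < p \<longleftrightarrow> \<lfloor>u * real p\<rfloor> < int p" using p True by (simp add: nat_less_iff)
      also have "\<dots> \<longleftrightarrow> u < 1" using p by (simp add: floor_less_iff)
      finally show ?thesis using True by simp
    qed simp
    finally show ?thesis .
  qed
  have s_int: "(LINT u|lborel. s p u) = (\<Sum>i<p. F p i) / real p" for p
  proof -
    have le: "real i / real p \<le> (real i + 1) / real p" for i by (simp add: divide_right_mono)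
    have int: "integrable lborel (indicator {real i / real p..<(real i + 1) / real p} :: real \<Rightarrow> real)" for i
      using le[of i] by (intro integrable_real_indicator) (auto simp: emeasure_lborel_Ico)
    have "(LINT u|lborel. s p u) = (\<Sum>i<p. LINT u|lborel. F p i * indicator {real i / real p..<(real i + 1) / real p} u)"
      unfolding s_def by (rule Bochner_Integration.integral_sum) (intro integrable_mult_right int)
    also have "\<dots> = (\<Sum>i<p. F p i * (1 / real p))"
    proof (rule sum.cong[OF refl])
      fix i
      have "(LINT u|lborel. F p i * indicator {real i / real p..<(real i + 1) / real p} u)
          = F p i * measure lborel {real i / real p..<(real i + 1) / real p}"
        by simp
      also have "measure lborel {real i / real p..<(real i + 1) / real p} = 1 / real p"
        using le[of i] by (simp add: diff_divide_distrib[symmetric])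
      finally show "(LINT u|lborel. F p i * indicator {real i / real p..<(real i + 1) / real p} u) = F p i * (1 / real p)" .
    qed
    finally show ?thesis by (simp add: sum_divide_distrib)
  qed
  define g where "g = (\<lambda>u. indicator {0..1} u * G u :: real)"
  define w where "w = (indicator {0..1} :: real \<Rightarrow> real)"
  have s_bound: "\<bar>s p u\<bar> \<le> w u" for p u
  proof (cases "p = 0")
    case False
    thus ?thesis using bound s_eq[of p u] by (auto simp: w_def indicator_def)
  qed (simp add: s_def w_def)
  have s_lim: "AE u in lborel. (\<lambda>p. s p u) \<longlonglongrightarrow> g u"
  proof -
    have "A \<union> {1} \<in> null_sets lborel" using A by (intro finite_imp_null_set_lborel) auto
    hence "AE u in lborel. u \<notin> A \<union> {1}" by (rule AE_not_in)
    thus ?thesis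
    proof eventually_elim
      case (elim u)
      show ?case
      proof (cases "0 \<le> u \<and> u < 1")
        case True
        hence "(\<lambda>p. F p (nat \<lfloor>u * real p\<rfloor>)) \<longlonglongrightarrow> G u" using lim elim by auto
        moreover have "eventually (\<lambda>p. F p (nat \<lfloor>u * real p\<rfloor>) = s p u) sequentially"
          using eventually_gt_at_top[of 0] by eventually_elim (use True in \<open>simp add: s_eq\<close>)
        ultimately have "(\<lambda>p. s p u) \<longlonglongrightarrow> G u" by (rule Lim_transform_eventually)
        thus ?thesis using True by (simp add: g_def)
      next
        case False
        have "s p u = 0" for p
          using False s_eq[of p u] by (cases "p = 0", simp add: s_def) auto
        thus ?thesis using False elim by (auto simp: g_def indicator_def)
      qed
    qed
  qed
  have meas: "s p \<in> borel_measurable lborel" for p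
    unfolding s_def by measurable
  have gm: "g \<in> borel_measurable lborel" unfolding g_def using G(2) by measurable
  have wi: "integrable lborel w" unfolding w_def by simp
  have lim': "(\<lambda>p. LINT u|lborel. s p u) \<longlonglongrightarrow> (LINT u|lborel. g u)"
    by (rule integral_dominated_convergence[OF gm meas wi s_lim]) (use s_bound in auto)
  have gi: "integrable lborel g"
    by (rule integrable_dominated_convergence[OF gm meas wi s_lim]) (use s_bound in auto)
  have "(g has_integral (LINT u|lborel. g u)) UNIV" by (rule has_integral_integral_lborel[OF gi])
  moreover have "g = (\<lambda>u. if u \<in> {0..1} then G u else 0)" by (auto simp: g_def indicator_def)
  ultimately have "(G has_integral (LINT u|lborel. g u)) {0..1}" by (simp only: has_integral_restrict_UNIV)
  hence "(LINT u|lborel. g u) = I" using G(1) has_integral_unique by blast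
  thus ?thesis using lim' by (simp add: s_int)
qed

subsection \<open>Limits of the exponents\<close>

text \<open>The scaling limit of \<open>jordan_size p k i / p\<close> for k/p -> t and i/p -> u:
  there d/p -> u/2 and a/p -> 1/2, which turns the case conditions into u < 2t - 1 and u <
  2t.\<close>

definition exp_limit :: "real \<Rightarrow> real \<Rightarrow> real"
  where "exp_limit t u = (if u < 2 * t - 1 then 1 else if u < 2 * t then t + 1 / 2 - u else 0)"

lemma tendsto_divide_linear:
  assumes "\<And>p. \<bar>x p - c * real p\<bar> \<le> C"
  shows "(\<lambda>p. x p / real p) \<longlonglongrightarrow> c"
proof (rule LIM_zero_cancel, rule Lim_null_comparison)
  show "eventually (\<lambda>p. norm (x p / real p - c) \<le> C / real p) sequentially"
    using eventually_gt_at_top[of 0]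
  proof eventually_elim
    case (elim p)
    hence "x p / real p - c = (x p - c * real p) / real p" by (simp add: field_simps)
    thus ?case using assms[of p] elim by (simp add: divide_right_mono)
  qed
  show "(\<lambda>p. C / real p) \<longlonglongrightarrow> 0" by (rule lim_const_over_n)
qed

lemma eventually_less_of_tendsto_divide:
  assumes "(\<lambda>p. real (a p) / real p) \<longlonglongrightarrow> x" "(\<lambda>p. real (b p) / real p) \<longlonglongrightarrow> y" "x < y"
  shows "eventually (\<lambda>p. a p < b p) sequentially"
proof -
  have "(\<lambda>p. real (b p) / real p - real (a p) / real p) \<longlonglongrightarrow> y - x" by (intro tendsto_diff assms)
  hence "eventually (\<lambda>p. 0 < real (b p) / real p - real (a p) / real p) sequentially"
    using assms(3) by (intro order_tendstoD) auto
  thus ?thesis using eventually_gt_at_top[of 0]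
    by eventually_elim (auto simp: diff_divide_distrib[symmetric] zero_less_divide_iff)
qed

text \<open>Away from u = 2t - 1 and u = 2t the limiting inequalities are strict, so one case of
  \<open>jordan_size\<close> holds for all large p.\<close>

lemma jordan_size_tendsto:
  assumes k: "(\<lambda>p. real (k p) / real p) \<longlonglongrightarrow> t" and u: "0 \<le> u" "u < 1" "u \<noteq> 2 * t - 1" "u \<noteq> 2 * t"
  shows "(\<lambda>p. real (jordan_size p (k p) (nat \<lfloor>u * real p\<rfloor>)) / real p) \<longlonglongrightarrow> exp_limit t u"
proof -
  define i where "i p = nat \<lfloor>u * real p\<rfloor>" for p
  define d where "d p = i p div 2" for p
  define a where "a p = (p + 1 - i p mod 2) div 2" for p
  have j: "jordan_size p (k p) (i p) = (if d p + p < a p + k p then p else if d p < k p then a p + k p - 1 - 2 * d p else 0)" for p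
    unfolding jordan_size_def Let_def d_def a_def ..
  have ib: "real (i p) \<le> u * real p" "u * real p < real (i p) + 1" for p
    using u(1) by (auto simp: i_def)
  have db: "2 * real (d p) \<le> real (i p)" "real (i p) \<le> 2 * real (d p) + 1" for p
  proof -
    have "2 * d p \<le> i p" "i p \<le> 2 * d p + 1" by (auto simp: d_def)
    thus "2 * real (d p) \<le> real (i p)" "real (i p) \<le> 2 * real (d p) + 1" by linarith+
  qed
  have ab: "real p \<le> 2 * real (a p) + 1" "2 * real (a p) \<le> real p + 1" for p
  proof -
    have "p \<le> 2 * a p + 1" "2 * a p \<le> p + 1" unfolding a_def by presburger+
    thus "real p \<le> 2 * real (a p) + 1" "2 * real (a p) \<le> real p + 1" by linarith+
  qed
  have dl: "(\<lambda>p. real (d p) / real p) \<longlonglongrightarrow> u / 2"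
  proof (rule tendsto_divide_linear[where C = 2])
    fix p
    have "u / 2 * real p = u * real p / 2" by simp
    thus "\<bar>real (d p) - u / 2 * real p\<bar> \<le> 2" using ib[of p] db[of p] by linarith
  qed
  have al: "(\<lambda>p. real (a p) / real p) \<longlonglongrightarrow> 1 / 2"
  proof (rule tendsto_divide_linear[where C = 1])
    fix p
    show "\<bar>real (a p) - 1 / 2 * real p\<bar> \<le> 1" using ab[of p] by linarith
  qed
  have pl: "(\<lambda>p. real p / real p) \<longlonglongrightarrow> 1"
    by (rule tendsto_divide_linear[where C = 0]) auto
  have dpl: "(\<lambda>p. real (d p + p) / real p) \<longlonglongrightarrow> u / 2 + 1"
    using tendsto_add[OF dl pl] by (simp add: add_divide_distrib)
  have akl: "(\<lambda>p. real (a p + k p) / real p) \<longlonglongrightarrow> 1 / 2 + t"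
    using tendsto_add[OF al k] by (simp add: add_divide_distrib)
  \<comment> \<open>Together with \<open>d p < k p\<close> this makes the subtraction
    \<open>a p + k p - 1 - 2 * d p\<close> exact.\<close>
  have da: "d p < a p" if "p > 0" for p
  proof -
    have "u * real p < real p" using u(2) that by simp
    hence "i p < p" using ib(1)[of p] by simp
    thus ?thesis unfolding d_def a_def by presburger
  qed
  have "(\<lambda>p. real (jordan_size p (k p) (i p)) / real p) \<longlonglongrightarrow> exp_limit t u"
  proof -
    consider "u < 2 * t - 1" | "2 * t - 1 < u" "u < 2 * t" | "2 * t < u" using u by linarith
    thus ?thesis
    proof cases
      case 1
      have "eventually (\<lambda>p. d p + p < a p + k p) sequentially"
        by (rule eventually_less_of_tendsto_divide[OF dpl akl]) (use 1 in simp)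
      hence "eventually (\<lambda>p. real p / real p = real (jordan_size p (k p) (i p)) / real p) sequentially"
        by eventually_elim (simp add: j)
      from Lim_transform_eventually[OF pl this] show ?thesis using 1 by (simp add: exp_limit_def)
    next
      case 2
      have e1: "eventually (\<lambda>p. a p + k p < d p + p) sequentially"
        by (rule eventually_less_of_tendsto_divide[OF akl dpl]) (use 2 in simp)
      have e2: "eventually (\<lambda>p. d p < k p) sequentially"
        by (rule eventually_less_of_tendsto_divide[OF dl k]) (use 2 in simp)
      have "(\<lambda>p. real (a p + k p) / real p - 1 / real p - 2 * (real (d p) / real p)) \<longlonglongrightarrow> 1 / 2 + t - 0 - 2 * (u / 2)"
        by (intro tendsto_intros akl dl lim_const_over_n)
      moreover have "eventually (\<lambda>p. real (a p + k p) / real p - 1 / real p - 2 * (real (d p) / real p) = real (jordan_size p (k p) (i p)) / real p) sequentially"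
        using e1 e2 eventually_gt_at_top[of 0]
      proof eventually_elim
        case (elim p)
        have "real (a p + k p - 1 - 2 * d p) = real (a p + k p) - 1 - 2 * real (d p)"
          using da[OF elim(3)] elim by (simp add: of_nat_diff)
        thus ?case using elim by (simp add: j diff_divide_distrib)
      qed
      ultimately have "(\<lambda>p. real (jordan_size p (k p) (i p)) / real p) \<longlonglongrightarrow> 1 / 2 + t - 0 - 2 * (u / 2)"
        by (rule Lim_transform_eventually)
      thus ?thesis using 2 by (simp add: exp_limit_def add.commute)
    next
      case 3
      have e1: "eventually (\<lambda>p. a p + k p < d p + p) sequentially"
        by (rule eventually_less_of_tendsto_divide[OF akl dpl]) (use 3 in simp)
      have e2: "eventually (\<lambda>p. k p < d p) sequentially"
        by (rule eventually_less_of_tendsto_divide[OF k dl]) (use 3 in simp)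
      have "eventually (\<lambda>p. 0 = real (jordan_size p (k p) (i p)) / real p) sequentially"
        using e1 e2 by eventually_elim (simp add: j)
      from Lim_transform_eventually[OF tendsto_const this] show ?thesis using 3 by (simp add: exp_limit_def)
    qed
  qed
  thus ?thesis by (simp add: i_def)
qed

subsection \<open>Evaluation of the limit integrals\<close>

text \<open>Truncated squares and cubes are differentiable at the break point too, so
  antiderivatives can be written without case distinctions. At 0 the difference quotient is bounded
  by |h|.\<close>

lemma DERIV_max_power2 [derivative_intros]:
  assumes "(f has_real_derivative f') (at x within A)"
  shows "((\<lambda>x. (max 0 (f x))\<^sup>2) has_real_derivative 2 * max 0 (f x) * f') (at x within A)"
proof -
  have base: "((\<lambda>x. (max 0 x)\<^sup>2) has_real_derivative 2 * max 0 x) (at x)" for x :: real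
  proof (cases "x = 0")
    case True
    have "((\<lambda>h. ((max 0 (0 + h))\<^sup>2 - (max 0 0)\<^sup>2) / h) \<longlongrightarrow> (0::real)) (at 0)"
    proof (rule Lim_null_comparison)
      show "eventually (\<lambda>h::real. norm (((max 0 (0 + h))\<^sup>2 - (max 0 0)\<^sup>2) / h) \<le> \<bar>h\<bar>) (at 0)"
        by (intro always_eventually allI) (auto simp: max_def power2_eq_square)
      show "((\<lambda>h::real. \<bar>h\<bar>) \<longlongrightarrow> 0) (at 0)" by (intro tendsto_eq_intros) auto
    qed
    thus ?thesis using True by (simp add: DERIV_def)
  next
    case False
    show ?thesis
    proof (cases "x > 0")
      case True
      have "((\<lambda>x. x\<^sup>2) has_real_derivative 2 * max 0 x) (at x)"
        using True by (auto intro!: derivative_eq_intros)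
      thus ?thesis
        by (rule has_field_derivative_transform_within_open[of _ _ _ "{0<..}"]) (use True in auto)
    next
      case F: False
      have "((\<lambda>x. 0) has_real_derivative 2 * max 0 x) (at x)" using F by simp
      thus ?thesis
        by (rule has_field_derivative_transform_within_open[of _ _ _ "{..<0}"]) (use F False in auto)
    qed
  qed
  show ?thesis using DERIV_chain2[OF base[of "f x"] assms] .
qed

lemma DERIV_max_power3 [derivative_intros]:
  assumes "(f has_real_derivative f') (at x within A)"
  shows "((\<lambda>x. (max 0 (f x)) ^ 3) has_real_derivative 3 * (max 0 (f x))\<^sup>2 * f') (at x within A)"
proof -
  have eq: "(max 0 y) ^ 3 = y * (max 0 y)\<^sup>2" for y :: real
    by (auto simp: max_def power2_eq_square power3_eq_cube)
  have "((\<lambda>x. f x * (max 0 (f x))\<^sup>2) has_real_derivative f' * (max 0 (f x))\<^sup>2 + 2 * max 0 (f x) * f' * f x) (at x within A)"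
    by (rule DERIV_mult[OF assms DERIV_max_power2[OF assms]])
  moreover have "f' * (max 0 (f x))\<^sup>2 + 2 * max 0 (f x) * f' * f x = 3 * (max 0 (f x))\<^sup>2 * f'"
    by (auto simp: max_def power2_eq_square)
  ultimately show ?thesis unfolding eq by simp
qed

text \<open>Agreement is asked only on [a, b), because \<open>exp_limit\<close> already takes its
  next branch at a right endpoint.\<close>

lemma has_integral_antiderivative:
  fixes F f :: "real \<Rightarrow> real"
  assumes "a \<le> b" "\<And>x. (F has_real_derivative F' x) (at x)" "\<And>x. a \<le> x \<Longrightarrow> x < b \<Longrightarrow> f x = F' x"
  shows "(f has_integral (F b - F a)) {a..b}"
proof -
  have "(F' has_integral (F b - F a)) {a..b}"
    using assms(1)
    by (intro fundamental_theorem_of_calculus)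
       (auto intro!: has_field_derivative_at_within assms(2) simp flip: has_real_derivative_iff_has_vector_derivative)
  thus ?thesis
    by (rule has_integral_spike_finite[of "{b}", rotated 2]) (use assms(3) in auto)
qed

text \<open>The inner integral of \<open>min 1 (s + M * exp_limit s v)\<close> over v in [0, 1]. The
  truncated squares measure how far the integrand falls below the cap 1 on the sloping part of
  \<open>exp_limit\<close>.\<close>

definition G_limit :: "real \<Rightarrow> real \<Rightarrow> real"
  where "G_limit M s = (if s \<le> 1 / 2 then 3 * s - 2 * s\<^sup>2 - M / 2 * (max 0 (s - 1 / 2 + (1 - s) / M))\<^sup>2
     else 1 - M / 2 * (max 0 (1 / 2 - s + (1 - s) / M))\<^sup>2)"

lemma G_limit_integral:
  assumes M: "M \<ge> 2" and s: "0 \<le> s" "s \<le> 1"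
  shows "((\<lambda>v. min 1 (s + M * exp_limit s v)) has_integral G_limit M s) {0..1}"
proof -
  define q where "q = (1 - s) / M"
  \<comment> \<open>The solution of s + M (s + 1/2 - c) = 1: the sloping part is capped to the left
    of \<open>c\<close>.\<close>
  define c where "c = s + 1 / 2 - q"
  have c: "M * c = M * (s + 1 / 2) - (1 - s)" using M by (simp add: c_def q_def algebra_simps)
  have "q \<le> (1 - s) / 2" unfolding q_def using M s by (intro divide_left_mono) auto
  moreover have "0 \<le> s + s / 2" "0 \<le> 1 - s / 2" using s by auto
  ultimately have c_ge: "0 \<le> c" "2 * s - 1 \<le> c"
    unfolding c_def diff_divide_distrib by linarith+
  have lin: "min 1 (s + M * (s + 1 / 2 - v)) = 1 - M * max 0 (v - c)" for v
  proof -
    have "s + M * (s + 1 / 2 - v) = 1 - M * (v - c)" using c by (simp add: algebra_simps)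
    moreover have "min 1 (1 - M * (v - c)) = 1 - M * max 0 (v - c)"
      using M by (auto simp: min_def max_def mult_le_0_iff zero_le_mult_iff)
    ultimately show ?thesis by simp
  qed
  have der: "((\<lambda>v. v - M / 2 * (max 0 (v - c))\<^sup>2) has_real_derivative 1 - M * max 0 (v - c)) (at v)" for v
    by (auto intro!: derivative_eq_intros)
  show ?thesis
  proof (cases "s \<le> 1 / 2")
    case True
    have "((\<lambda>v. min 1 (s + M * exp_limit s v)) has_integral
       ((2 * s - M / 2 * (max 0 (2 * s - c))\<^sup>2) - (0 - M / 2 * (max 0 (0 - c))\<^sup>2))) {0..2 * s}"
      by (rule has_integral_antiderivative[OF _ der])
        (use s True lin in \<open>auto simp: exp_limit_def\<close>)
    moreover have "((\<lambda>v. min 1 (s + M * exp_limit s v)) has_integral (s * 1 - s * (2 * s))) {2 * s..1}"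
      by (rule has_integral_antiderivative[where F = "\<lambda>v. s * v" and F' = "\<lambda>_. s"])
        (use s True in \<open>auto simp: exp_limit_def intro!: derivative_eq_intros\<close>)
    ultimately have "((\<lambda>v. min 1 (s + M * exp_limit s v)) has_integral
       ((2 * s - M / 2 * (max 0 (2 * s - c))\<^sup>2) - (0 - M / 2 * (max 0 (0 - c))\<^sup>2)) + (s * 1 - s * (2 * s))) {0..1}"
      by (rule has_integral_combine[rotated 2]) (use s True in auto)
    moreover have e1: "max 0 (0 - c) = 0" using c_ge by simp
    have e2: "s - 1 / 2 + (1 - s) / M = 2 * s - c" by (simp add: c_def q_def)
    have "((2 * s - M / 2 * (max 0 (2 * s - c))\<^sup>2) - (0 - M / 2 * (max 0 (0 - c))\<^sup>2)) + (s * 1 - s * (2 * s)) = G_limit M s"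
      unfolding G_limit_def e1 e2 using True by (simp add: power2_eq_square)
    ultimately show ?thesis by (simp only:)
  next
    case False
    have "((\<lambda>v. min 1 (s + M * exp_limit s v)) has_integral ((2 * s - 1) - 0)) {0..2 * s - 1}"
      by (rule has_integral_antiderivative[where F = "\<lambda>v. v" and F' = "\<lambda>_. 1"])
        (use s False M in \<open>auto simp: exp_limit_def\<close>)
    moreover have "((\<lambda>v. min 1 (s + M * exp_limit s v)) has_integral
       ((1 - M / 2 * (max 0 (1 - c))\<^sup>2) - (2 * s - 1 - M / 2 * (max 0 (2 * s - 1 - c))\<^sup>2))) {2 * s - 1..1}"
      by (rule has_integral_antiderivative[OF _ der])
        (use s False lin in \<open>auto simp: exp_limit_def\<close>)
    ultimately have "((\<lambda>v. min 1 (s + M * exp_limit s v)) has_integral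
       ((2 * s - 1) - 0) + ((1 - M / 2 * (max 0 (1 - c))\<^sup>2) - (2 * s - 1 - M / 2 * (max 0 (2 * s - 1 - c))\<^sup>2))) {0..1}"
      by (rule has_integral_combine[rotated 2]) (use s False in auto)
    moreover have e1: "max 0 (2 * s - 1 - c) = 0" using c_ge by simp
    have e2: "1 / 2 - s + (1 - s) / M = 1 - c" by (simp add: c_def q_def)
    have "((2 * s - 1) - 0) + ((1 - M / 2 * (max 0 (1 - c))\<^sup>2) - (2 * s - 1 - M / 2 * (max 0 (2 * s - 1 - c))\<^sup>2)) = G_limit M s"
      unfolding G_limit_def e1 e2 using False by simp
    ultimately show ?thesis by (simp only:)
  qed
qed

text \<open>The outer integral apart from \<open>max 0 (2 * t - 1)\<close>, with m = min(t, 1 - t).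
  The cube with M - 1 stems from exponents s <= 1/2, the one with M + 1 from s >= 1/2. They vanish
  from m = 1/(2(M - 1)) and m = 1/(2(M + 1)) on, the break points of the theorem; 1/8 is the cube of
  1/2 contributed by the end s = 1/2.\<close>

definition H_limit :: "real \<Rightarrow> real \<Rightarrow> real"
  where "H_limit M m = 2 * m - m\<^sup>2 / 2 - 2 * m ^ 3 / 3
    + ((max 0 (1 / 2 - (M - 1) * m)) ^ 3 - 1 / 8) / (6 * (M - 1) * M)
    + ((max 0 (1 / 2 - (M + 1) * m)) ^ 3 - 1 / 8) / (6 * (M + 1) * M)"

lemma max_0_divide: "M > 0 \<Longrightarrow> max 0 (x / M) = max 0 x / (M :: real)"
  by (auto simp: max_def zero_le_divide_iff divide_le_0_iff)

text \<open>The integrand is 1 on [0, t - m] and 0 on [t + m, 1]. In between, s = t + 1/2 - u runs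
  over [1/2 - m, 1/2 + m], so this part depends on m alone; the reflection formula for h
  follows.\<close>

lemma H_limit_integral:
  assumes M: "M \<ge> 2" and t: "0 \<le> t" "t \<le> 1"
  shows "((\<lambda>u. G_limit M (exp_limit t u)) has_integral (max 0 (2 * t - 1) + H_limit M (min t (1 - t)))) {0..1}"
proof -
  define m where "m = min t (1 - t)"
  have m: "0 \<le> m" "m \<le> 1 / 2" using t by (auto simp: m_def min_def)
  \<comment> \<open>Antiderivatives of the two branches of \<open>G_limit\<close>. The truncated
    arguments have slopes (M - 1)/M and -(M + 1)/M, hence the factors M^2/(6(M - 1)) and M^2/(6(M +
    1)).\<close>
  define A1 where "A1 s = 3 / 2 * s\<^sup>2 - 2 / 3 * s ^ 3 - M\<^sup>2 / (6 * (M - 1)) * (max 0 (s - 1 / 2 + (1 - s) / M)) ^ 3" for s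
  define A2 where "A2 s = s + M\<^sup>2 / (6 * (M + 1)) * (max 0 (1 / 2 - s + (1 - s) / M)) ^ 3" for s
  have rev: "((\<lambda>u. t + 1 / 2 - u) has_real_derivative - 1) (at u)" for u
    by (auto intro!: derivative_eq_intros)
  have D1: "(A1 has_real_derivative (3 * s - 2 * s\<^sup>2 - M / 2 * (max 0 (s - 1 / 2 + (1 - s) / M))\<^sup>2)) (at s)" for s
  proof -
    have "((\<lambda>s. s - 1 / 2 + (1 - s) / M) has_real_derivative (1 - 0 + (0 - 1) / M)) (at s)"
      by (intro DERIV_add DERIV_diff DERIV_cdivide DERIV_ident DERIV_const)
    from DERIV_cmult[OF DERIV_max_power3[OF this], of "M\<^sup>2 / (6 * (M - 1))"]
    have "((\<lambda>s. M\<^sup>2 / (6 * (M - 1)) * (max 0 (s - 1 / 2 + (1 - s) / M)) ^ 3) has_real_derivative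
       M / 2 * (max 0 (s - 1 / 2 + (1 - s) / M))\<^sup>2) (at s)"
    proof (rule DERIV_cong)
      have "M\<^sup>2 / (6 * (M - 1)) * (3 * yy * (1 - 0 + (0 - 1) / M)) = M / 2 * yy" for yy
        using M by (simp add: divide_simps power2_eq_square) (simp add: algebra_simps)?
      thus "M\<^sup>2 / (6 * (M - 1)) * (3 * (max 0 (s - 1 / 2 + (1 - s) / M))\<^sup>2 * (1 - 0 + (0 - 1) / M)) = M / 2 * (max 0 (s - 1 / 2 + (1 - s) / M))\<^sup>2" .
    qed
    moreover have "((\<lambda>s. 3 / 2 * s\<^sup>2 - 2 / 3 * s ^ 3) has_real_derivative (3 * s - 2 * s\<^sup>2)) (at s)"
      by (auto intro!: derivative_eq_intros)
    ultimately show ?thesis unfolding A1_def by (rule DERIV_diff[rotated])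
  qed
  have D2: "(A2 has_real_derivative (1 - M / 2 * (max 0 (1 / 2 - s + (1 - s) / M))\<^sup>2)) (at s)" for s
  proof -
    have "((\<lambda>s. 1 / 2 - s + (1 - s) / M) has_real_derivative (0 - 1 + (0 - 1) / M)) (at s)"
      by (intro DERIV_add DERIV_diff DERIV_cdivide DERIV_ident DERIV_const)
    from DERIV_cmult[OF DERIV_max_power3[OF this], of "M\<^sup>2 / (6 * (M + 1))"]
    have "((\<lambda>s. M\<^sup>2 / (6 * (M + 1)) * (max 0 (1 / 2 - s + (1 - s) / M)) ^ 3) has_real_derivative
       - (M / 2 * (max 0 (1 / 2 - s + (1 - s) / M))\<^sup>2)) (at s)"
    proof (rule DERIV_cong)
      have "M\<^sup>2 / (6 * (M + 1)) * (3 * yy * (0 - 1 + (0 - 1) / M)) = - (M / 2 * yy)" for yy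
        using M by (simp add: divide_simps power2_eq_square) (simp add: algebra_simps)?
      thus "M\<^sup>2 / (6 * (M + 1)) * (3 * (max 0 (1 / 2 - s + (1 - s) / M))\<^sup>2 * (0 - 1 + (0 - 1) / M)) = - (M / 2 * (max 0 (1 / 2 - s + (1 - s) / M))\<^sup>2)" .
    qed
    from DERIV_add[OF DERIV_ident this] show ?thesis unfolding A2_def by simp
  qed
  have d1: "((\<lambda>u. - A1 (t + 1 / 2 - u)) has_real_derivative (3 * (t + 1 / 2 - u) - 2 * (t + 1 / 2 - u)\<^sup>2
     - M / 2 * (max 0 ((t + 1 / 2 - u) - 1 / 2 + (1 - (t + 1 / 2 - u)) / M))\<^sup>2)) (at u)" for u
    using DERIV_minus[OF DERIV_chain2[OF D1 rev]] by (simp only: mult_minus_right mult_1_right minus_minus)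
  have d2: "((\<lambda>u. - A2 (t + 1 / 2 - u)) has_real_derivative (1
     - M / 2 * (max 0 (1 / 2 - (t + 1 / 2 - u) + (1 - (t + 1 / 2 - u)) / M))\<^sup>2)) (at u)" for u
    using DERIV_minus[OF DERIV_chain2[OF D2 rev]] by (simp only: mult_minus_right mult_1_right minus_minus)
  have G0: "G_limit M 0 = 0" "G_limit M 1 = 1" using M by (auto simp: G_limit_def max_def field_simps)
  have I1: "((\<lambda>u. G_limit M (exp_limit t u)) has_integral (- A1 (1 / 2 - m) - (- A1 (1 / 2)))) {t..t + m}"
  proof -
    have "((\<lambda>u. G_limit M (exp_limit t u)) has_integral (- A1 (t + 1 / 2 - (t + m)) - (- A1 (t + 1 / 2 - t)))) {t..t + m}"
      by (rule has_integral_antiderivative[OF _ d1])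
        (use t m in \<open>auto simp: exp_limit_def G_limit_def m_def\<close>)
    moreover have "t + 1 / 2 - (t + m) = 1 / 2 - m" "t + 1 / 2 - t = 1 / 2" by auto
    ultimately show ?thesis by (simp only:)
  qed
  have I2: "((\<lambda>u. G_limit M (exp_limit t u)) has_integral (- A2 (1 / 2) - (- A2 (1 / 2 + m)))) {t - m..t}"
  proof -
    have "((\<lambda>u. G_limit M (exp_limit t u)) has_integral (- A2 (t + 1 / 2 - t) - (- A2 (t + 1 / 2 - (t - m))))) {t - m..t}"
      by (rule has_integral_antiderivative[OF _ d2])
        (use t m in \<open>auto simp: exp_limit_def G_limit_def m_def\<close>)
    moreover have "t + 1 / 2 - (t - m) = 1 / 2 + m" "t + 1 / 2 - t = 1 / 2" by auto
    ultimately show ?thesis by (simp only:)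
  qed
  have I0: "((\<lambda>u. G_limit M (exp_limit t u)) has_integral (t - m - 0)) {0..t - m}"
  proof (rule has_integral_antiderivative[where F = "\<lambda>v. v" and F' = "\<lambda>_. 1"])
    fix u assume "0 \<le> u" "u < t - m"
    thus "G_limit M (exp_limit t u) = 1" using t G0 by (auto simp: exp_limit_def m_def min_def split: if_splits)
  qed (use t in \<open>auto simp: m_def\<close>)
  have I3: "((\<lambda>u. G_limit M (exp_limit t u)) has_integral (0 - 0)) {t + m..1}"
  proof (rule has_integral_antiderivative[where F = "\<lambda>v. 0" and F' = "\<lambda>_. 0"])
    fix u assume "t + m \<le> u" "u < 1"
    thus "G_limit M (exp_limit t u) = 0" using t G0 by (auto simp: exp_limit_def m_def min_def split: if_splits)
  qed (use t in \<open>auto simp: m_def\<close>)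
  have "((\<lambda>u. G_limit M (exp_limit t u)) has_integral (t - m - 0) + (- A2 (1 / 2) - (- A2 (1 / 2 + m)))) {0..t}"
    by (rule has_integral_combine[OF _ _ I0 I2]) (use m t in \<open>auto simp: m_def\<close>)
  from has_integral_combine[OF _ _ this I1]
  have "((\<lambda>u. G_limit M (exp_limit t u)) has_integral (t - m - 0) + (- A2 (1 / 2) - (- A2 (1 / 2 + m))) + (- A1 (1 / 2 - m) - (- A1 (1 / 2)))) {0..t + m}"
    using m t by auto
  from has_integral_combine[OF _ _ this I3]
  have main: "((\<lambda>u. G_limit M (exp_limit t u)) has_integral
      (t - m - 0) + (- A2 (1 / 2) - (- A2 (1 / 2 + m))) + (- A1 (1 / 2 - m) - (- A1 (1 / 2))) + (0 - 0)) {0..1}"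
    using m t by (auto simp: m_def)
  have t_m: "t - m = max 0 (2 * t - 1)" by (auto simp: m_def)
  define b where "b x = (max 0 (1 / 2 - x)) ^ 3" for x :: real
  have fr: "x + z / M = (x * M + z) / M" for x z using M by (simp add: add_divide_distrib)
  have p1: "(max 0 ((1 / 2 - m) - 1 / 2 + (1 - (1 / 2 - m)) / M)) ^ 3 = b ((M - 1) * m) / M ^ 3"
  proof -
    have "((1 / 2 - m) - 1 / 2) * M + (1 - (1 / 2 - m)) = 1 / 2 - (M - 1) * m" by (simp add: algebra_simps)
    thus ?thesis unfolding fr using M by (simp only: max_0_divide b_def power_divide)
  qed
  have p2: "(max 0 (1 / 2 - (1 / 2 + m) + (1 - (1 / 2 + m)) / M)) ^ 3 = b ((M + 1) * m) / M ^ 3"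
  proof -
    have "(1 / 2 - (1 / 2 + m)) * M + (1 - (1 / 2 + m)) = 1 / 2 - (M + 1) * m" by (simp add: algebra_simps)
    thus ?thesis unfolding fr using M by (simp only: max_0_divide b_def power_divide)
  qed
  have p3: "(max 0 ((1 / 2) - 1 / 2 + (1 - (1 / 2)) / M)) ^ 3 = (1 / 8) / M ^ 3"
    "(max 0 (1 / 2 - (1 / 2) + (1 - (1 / 2)) / M)) ^ 3 = (1 / 8) / M ^ 3"
  proof -
    have "((1 / 2 - 1 / 2) * M + (1 - 1 / 2)) = 1 / 2" by simp
    hence "(max 0 ((1 / 2) - 1 / 2 + (1 - (1 / 2)) / M)) ^ 3 = (max 0 (1 / 2)) ^ 3 / M ^ 3"
      unfolding fr using M by (simp only: max_0_divide power_divide)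
    thus "(max 0 ((1 / 2) - 1 / 2 + (1 - (1 / 2)) / M)) ^ 3 = (1 / 8) / M ^ 3"
      "(max 0 (1 / 2 - (1 / 2) + (1 - (1 / 2)) / M)) ^ 3 = (1 / 8) / M ^ 3"
      by (simp_all add: power3_eq_cube)
  qed
  have coef: "M\<^sup>2 / (6 * N) * (B / M ^ 3) = B / (6 * N * M)" for N B
    using M by (simp add: power2_eq_square power3_eq_cube)
  have A2d: "A2 (1 / 2 + m) - A2 (1 / 2) = m + (b ((M + 1) * m) - 1 / 8) / (6 * (M + 1) * M)"
    unfolding A2_def p2 p3 coef diff_divide_distrib[of "b ((M + 1) * m)"] by (simp only: algebra_simps)
  have A1d: "A1 (1 / 2) - A1 (1 / 2 - m) = m - m\<^sup>2 / 2 - 2 * m ^ 3 / 3 + (b ((M - 1) * m) - 1 / 8) / (6 * (M - 1) * M)"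
  proof -
    have poly: "3 / 2 * (1 / 2)\<^sup>2 - 2 / 3 * (1 / 2) ^ 3 - (3 / 2 * (1 / 2 - m)\<^sup>2 - 2 / 3 * (1 / 2 - m) ^ 3) = m - m\<^sup>2 / 2 - 2 * m ^ 3 / 3"
      by (simp add: power2_eq_square power3_eq_cube algebra_simps)
    show ?thesis
      unfolding A1_def p1 p3 coef poly[symmetric] diff_divide_distrib[of "b ((M - 1) * m)"] by (simp only: algebra_simps)
  qed
  have "(t - m - 0) + (- A2 (1 / 2) - (- A2 (1 / 2 + m))) + (- A1 (1 / 2 - m) - (- A1 (1 / 2))) + (0 - 0)
     = max 0 (2 * t - 1) + (A2 (1 / 2 + m) - A2 (1 / 2)) + (A1 (1 / 2) - A1 (1 / 2 - m))"
    using t_m by simp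
  also have "\<dots> = max 0 (2 * t - 1) + H_limit M m"
    unfolding A1d A2d H_limit_def b_def by simp
  finally show ?thesis using main by (simp only: m_def)
qed

subsection \<open>The limit of the length sums\<close>

lemma exp_limit_measurable [measurable]: "exp_limit t \<in> borel_measurable borel"
  unfolding exp_limit_def by measurable

lemma G_limit_measurable [measurable]: "G_limit M \<in> borel_measurable borel"
  unfolding G_limit_def by measurable

lemma inner_sum_tendsto:
  assumes M: "M \<ge> 2" and j: "\<And>p. j p \<le> p" "(\<lambda>p. real (j p) / real p) \<longlonglongrightarrow> s"
  shows "(\<lambda>p. real (\<Sum>l<p. min p (j p + M * jordan_size p (j p) l)) / real p ^ 2) \<longlonglongrightarrow> G_limit (real M) s"
proof -
  have s: "0 \<le> s" "s \<le> 1"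
  proof -
    show "0 \<le> s" by (rule LIMSEQ_le_const[OF j(2)]) auto
    show "s \<le> 1" by (rule LIMSEQ_le_const2[OF j(2)]) (use j(1) in \<open>auto simp: divide_le_eq\<close>)
  qed
  have "(\<lambda>p. (\<Sum>l<p. real (min p (j p + M * jordan_size p (j p) l)) / real p) / real p) \<longlonglongrightarrow> G_limit (real M) s"
  proof (rule riemann_sum_tendsto[where A = "{2 * s - 1, 2 * s}"])
    show "\<bar>real (min p (j p + M * jordan_size p (j p) i)) / real p\<bar> \<le> 1" for p i by (simp add: divide_le_eq)
    show "((\<lambda>v. min 1 (s + real M * exp_limit s v)) has_integral G_limit (real M) s) {0..1}"
      using M s by (intro G_limit_integral) auto
    show "(\<lambda>v. min 1 (s + real M * exp_limit s v)) \<in> borel_measurable borel" by measurable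
    fix u :: real assume u: "0 \<le> u" "u < 1" "u \<notin> {2 * s - 1, 2 * s}"
    let ?J = "\<lambda>p. jordan_size p (j p) (nat \<lfloor>u * real p\<rfloor>)"
    have "(\<lambda>p. min 1 (real (j p) / real p + real M * (real (?J p) / real p))) \<longlonglongrightarrow> min 1 (s + real M * exp_limit s u)"
      using u by (intro tendsto_intros j(2) jordan_size_tendsto) auto
    moreover have "eventually (\<lambda>p. min 1 (real (j p) / real p + real M * (real (?J p) / real p)) = real (min p (j p + M * ?J p)) / real p) sequentially"
      using eventually_gt_at_top[of 0]
    proof eventually_elim
      case (elim p)
      define yy where "yy = j p + M * ?J p"
      have "real (j p) / real p + real M * (real (?J p) / real p) = real yy / real p"
        by (simp add: yy_def add_divide_distrib)
      moreover have "min 1 (real yy / real p) = real (min p yy) / real p"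
        using elim by (auto simp: min_def divide_simps)
      ultimately show ?case by (simp only: yy_def)
    qed
    ultimately show "(\<lambda>p. real (min p (j p + M * ?J p)) / real p) \<longlonglongrightarrow> min 1 (s + real M * exp_limit s u)"
      by (rule Lim_transform_eventually)
  qed simp
  thus ?thesis by (simp add: sum_divide_distrib[symmetric] power2_eq_square)
qed

text \<open>Iterated dominated convergence: the normalized inner sums are bounded by 1 and converge
  at almost every u, because the block sizes divided by p do.\<close>

lemma length_sum_tendsto:
  assumes M: "M \<ge> 2" and k: "\<And>p. k p \<le> p" "(\<lambda>p. real (k p) / real p) \<longlonglongrightarrow> t"
  shows "(\<lambda>p. real (length_sum M p (k p)) / real p ^ 3) \<longlonglongrightarrow> max 0 (2 * t - 1) + H_limit (real M) (min t (1 - t))"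
proof -
  have t: "0 \<le> t" "t \<le> 1"
  proof -
    show "0 \<le> t" by (rule LIMSEQ_le_const[OF k(2)]) auto
    show "t \<le> 1" by (rule LIMSEQ_le_const2[OF k(2)]) (use k(1) in \<open>auto simp: divide_le_eq\<close>)
  qed
  define D where "D p j = (\<Sum>l<p. min p (j + M * jordan_size p j l))" for p j
  have "(\<lambda>p. (\<Sum>i<p. real (D p (jordan_size p (k p) i)) / real p ^ 2) / real p) \<longlonglongrightarrow> max 0 (2 * t - 1) + H_limit (real M) (min t (1 - t))"
  proof (rule riemann_sum_tendsto[where A = "{2 * t - 1, 2 * t}"])
    show "\<bar>real (D p (jordan_size p (k p) i)) / real p ^ 2\<bar> \<le> 1" for p i
    proof -
      have "D p (jordan_size p (k p) i) \<le> (\<Sum>l<p. p)" unfolding D_def by (intro sum_mono) simp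
      hence "real (D p (jordan_size p (k p) i)) \<le> real p ^ 2"
        by (metis card_lessThan of_nat_le_iff of_nat_power power2_eq_square sum_constant of_nat_id)
      thus ?thesis by (simp add: divide_le_eq)
    qed
    show "((\<lambda>u. G_limit (real M) (exp_limit t u)) has_integral (max 0 (2 * t - 1) + H_limit (real M) (min t (1 - t)))) {0..1}"
      using M t by (intro H_limit_integral) auto
    show "(\<lambda>u. G_limit (real M) (exp_limit t u)) \<in> borel_measurable borel" by measurable
    fix u :: real assume u: "0 \<le> u" "u < 1" "u \<notin> {2 * t - 1, 2 * t}"
    show "(\<lambda>p. real (D p (jordan_size p (k p) (nat \<lfloor>u * real p\<rfloor>))) / real p ^ 2) \<longlonglongrightarrow> G_limit (real M) (exp_limit t u)"
      unfolding D_def using u by (intro inner_sum_tendsto M jordan_size_le jordan_size_tendsto k(2)) auto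
  qed simp
  moreover have "(\<Sum>i<p. real (D p (jordan_size p (k p) i)) / real p ^ 2) / real p = real (length_sum M p (k p)) / real p ^ 3" for p
    by (simp add: length_sum_def D_def sum_divide_distrib[symmetric] power2_eq_square power3_eq_cube)
  ultimately show ?thesis by simp
qed

subsection \<open>The limit function is twice continuously differentiable\<close>

text \<open>A single formula on [0, 1]: each truncated cube is paired with its reflection t -> 1 -
  t. Truncated cubes are twice continuously differentiable, so the class is visible at all break
  points, including 1/2.\<close>

definition H_smooth :: "real \<Rightarrow> real \<Rightarrow> real \<Rightarrow> real \<Rightarrow> real \<Rightarrow> real \<Rightarrow> real"
  where "H_smooth c a K b N t = t + c - 3 / 2 * (t - 1 / 2)\<^sup>2 + 2 / 3 * ((max 0 (t - 1 / 2)) ^ 3 + (max 0 (1 / 2 - t)) ^ 3)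
    + a * ((max 0 (1 / 2 - K * t)) ^ 3 + (max 0 (1 / 2 - K * (1 - t))) ^ 3)
    + b * ((max 0 (1 / 2 - N * t)) ^ 3 + (max 0 (1 / 2 - N * (1 - t))) ^ 3)"

lemma C_2_onI:
  assumes U: "open U" and g: "\<And>x. x \<in> U \<Longrightarrow> (g has_real_derivative g1 x) (at x)"
    "\<And>x. x \<in> U \<Longrightarrow> (g1 has_real_derivative g2 x) (at x)" and c: "continuous_on U g2"
    and h: "\<And>x. x \<in> U \<Longrightarrow> h x = g x"
  shows "C_k_on 2 h U"
proof -
  have d0: "(h has_real_derivative g1 x) (at x)" if "x \<in> U" for x
    by (rule has_field_derivative_transform_within_open[OF g(1)[OF that] U that]) (simp add: h)
  hence e0: "deriv h x = g1 x" if "x \<in> U" for x using that DERIV_imp_deriv by blast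
  have d1: "(deriv h has_real_derivative g2 x) (at x)" if "x \<in> U" for x
    by (rule has_field_derivative_transform_within_open[OF g(2)[OF that] U that]) (simp add: e0)
  hence e1: "deriv (deriv h) x = g2 x" if "x \<in> U" for x using that DERIV_imp_deriv by blast
  have "continuous_on U (deriv (deriv h))"
    using c by (rule continuous_on_eq) (simp add: e1)
  moreover have "(deriv ^^ i) h field_differentiable at x" if "i < 2" "x \<in> U" for i x
  proof -
    from \<open>i < 2\<close> consider "i = 0" | "i = 1" by linarith
    thus ?thesis using d0[OF that(2)] d1[OF that(2)]
      by cases (auto simp: field_differentiable_def)
  qed
  ultimately show ?thesis by (simp add: C_k_on_def numeral_2_eq_2)
qed

lemma H_smooth_C_2:
  assumes "\<And>t. t \<in> {0<..<1} \<Longrightarrow> h t = H_smooth c a K b N t"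
  shows "C_k_on 2 h {0<..<1}"
proof -
  define g1 where "g1 t = 1 - 3 * (t - 1 / 2) + 2 * ((max 0 (t - 1 / 2))\<^sup>2 - (max 0 (1 / 2 - t))\<^sup>2)
     + a * (3 * K * ((max 0 (1 / 2 - K * (1 - t)))\<^sup>2 - (max 0 (1 / 2 - K * t))\<^sup>2))
     + b * (3 * N * ((max 0 (1 / 2 - N * (1 - t)))\<^sup>2 - (max 0 (1 / 2 - N * t))\<^sup>2))" for t
  define g2 where "g2 t = - 3 + 4 * (max 0 (t - 1 / 2) + max 0 (1 / 2 - t))
     + a * (6 * K\<^sup>2 * (max 0 (1 / 2 - K * (1 - t)) + max 0 (1 / 2 - K * t)))
     + b * (6 * N\<^sup>2 * (max 0 (1 / 2 - N * (1 - t)) + max 0 (1 / 2 - N * t)))" for t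
  have lin: "((\<lambda>t. 1 / 2 - k * t) has_real_derivative - k) (at x)"
    "((\<lambda>t. 1 / 2 - k * (1 - t)) has_real_derivative k) (at x)"
    "((\<lambda>t. t - 1 / 2) has_real_derivative 1) (at x)" "((\<lambda>t. 1 / 2 - t) has_real_derivative - 1) (at x)" for k x :: real
    by (auto intro!: derivative_eq_intros)
  show ?thesis
  proof (rule C_2_onI[of _ "H_smooth c a K b N" g1 g2])
    show "(H_smooth c a K b N has_real_derivative g1 x) (at x)" for x
    proof -
      have "(H_smooth c a K b N has_real_derivative
         (1 + 0 - 3 / 2 * (of_nat 2 * (1 * (x - 1 / 2) ^ (2 - Suc 0))) + 2 / 3 * (3 * (max 0 (x - 1 / 2))\<^sup>2 * 1 + 3 * (max 0 (1 / 2 - x))\<^sup>2 * (- 1))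
         + a * (3 * (max 0 (1 / 2 - K * x))\<^sup>2 * (- K) + 3 * (max 0 (1 / 2 - K * (1 - x)))\<^sup>2 * K)
         + b * (3 * (max 0 (1 / 2 - N * x))\<^sup>2 * (- N) + 3 * (max 0 (1 / 2 - N * (1 - x)))\<^sup>2 * N))) (at x)"
        unfolding H_smooth_def
        by (intro DERIV_add DERIV_diff DERIV_cmult DERIV_max_power3 DERIV_power lin DERIV_ident DERIV_const)
      thus ?thesis by (rule DERIV_cong) (simp add: g1_def algebra_simps diff_divide_distrib)
    qed
    show "(g1 has_real_derivative g2 x) (at x)" for x
    proof -
      have "(g1 has_real_derivative
         (0 - 3 * 1 + 2 * (2 * max 0 (x - 1 / 2) * 1 - 2 * max 0 (1 / 2 - x) * (- 1))
         + a * (3 * K * (2 * max 0 (1 / 2 - K * (1 - x)) * K - 2 * max 0 (1 / 2 - K * x) * (- K)))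
         + b * (3 * N * (2 * max 0 (1 / 2 - N * (1 - x)) * N - 2 * max 0 (1 / 2 - N * x) * (- N))))) (at x)"
        unfolding g1_def
        by (intro DERIV_add DERIV_diff DERIV_cmult DERIV_max_power2 lin DERIV_const)
      thus ?thesis by (rule DERIV_cong) (simp add: g2_def algebra_simps power2_eq_square)
    qed
    show "continuous_on {0<..<1} g2" unfolding g2_def by (intro continuous_intros)
  qed (use assms in auto)
qed

text \<open>Left of 1/2 the reflected cubes vanish, as M - 1 >= 1. The constant 7/24 = 3/8 - 1/12
  balances the square and the cube at m = 0.\<close>

lemma H_limit_eq_H_smooth:
  assumes M: "M \<ge> 2" and m: "0 \<le> m" "m \<le> 1 / 2"
  shows "H_limit M m = H_smooth (7 / 24 - (1 / 8) / (6 * (M - 1) * M) - (1 / 8) / (6 * (M + 1) * M))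
    (1 / (6 * (M - 1) * M)) (M - 1) (1 / (6 * (M + 1) * M)) (M + 1) m"
proof -
  have z: "max 0 (1 / 2 - y * (1 - m)) = 0" if "y \<ge> 1" for y
    using mult_mono[of 1 y "1 / 2" "1 - m"] that m by auto
  have z1: "max 0 (1 / 2 - (M - 1) * (1 - m)) = 0" and z2: "max 0 (1 / 2 - (M + 1) * (1 - m)) = 0"
    using M by (intro z; simp)+
  have z': "max 0 (m - 1 / 2) = 0" "max 0 (1 / 2 - m) = 1 / 2 - m" using m by auto
  have poly: "2 * m - m\<^sup>2 / 2 - 2 * m ^ 3 / 3 = m + 7 / 24 - 3 / 2 * (m - 1 / 2)\<^sup>2 + 2 / 3 * (0 ^ 3 + (1 / 2 - m) ^ 3)"
    by (simp add: power2_eq_square power3_eq_cube algebra_simps)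
  have fr: "(y - 1 / 8) / d = 1 / d * (y + 0 ^ 3) - 1 / 8 / d" for y d :: real
    by (simp add: diff_divide_distrib)
  show ?thesis unfolding H_limit_def H_smooth_def z1 z2 z' poly fr by (simp only: algebra_simps)
qed

text \<open>Everything is invariant under the reflection except the linear term t.\<close>

lemma H_smooth_symmetric: "H_smooth c a K b N (1 - t) = H_smooth c a K b N t - (2 * t - 1)"
proof -
  have e: "(1 - t) - 1 / 2 = 1 / 2 - t" "1 / 2 - (1 - t) = t - 1 / 2" "1 - (1 - t) = t" by auto
  have s: "(1 / 2 - t)\<^sup>2 = (t - 1 / 2)\<^sup>2" by (rule power2_commute)
  show ?thesis unfolding H_smooth_def e s by (simp only: algebra_simps)
qed

text \<open>Clamping to [0, 1] is required because the limit is asserted for every real argument: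
  the values are 0 for t <= 0 and 1 for t >= 1.\<close>

definition h_lim :: "real \<Rightarrow> real \<Rightarrow> real"
  where "h_lim M t = (let s = max 0 (min 1 t) in max 0 (2 * s - 1) + H_limit M (min s (1 - s)))"

lemma h_lim_low: "0 \<le> t \<Longrightarrow> t \<le> 1 / 2 \<Longrightarrow> h_lim M t = H_limit M t"
  by (simp add: h_lim_def Let_def min_def)

lemma h_lim_high:
  assumes "1 / 2 \<le> t" "t \<le> 1"
  shows "h_lim M t = h_lim M (1 - t) + 2 * t - 1"
proof (cases "t = 1 / 2")
  case True
  hence "1 - t = t" "2 * t = 1" by simp_all
  thus ?thesis by (simp only:)
qed (use assms in \<open>auto simp: h_lim_def Let_def min_def\<close>)

lemma h_lim_eq_H_smooth:
  assumes M: "M \<ge> 2"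
  defines "g \<equiv> H_smooth (7 / 24 - (1 / 8) / (6 * (M - 1) * M) - (1 / 8) / (6 * (M + 1) * M))
    (1 / (6 * (M - 1) * M)) (M - 1) (1 / (6 * (M + 1) * M)) (M + 1)"
  shows "h_lim M t = g (max 0 (min 1 t))"
proof -
  define s where "s = max 0 (min 1 t)"
  have s: "0 \<le> s" "s \<le> 1" by (auto simp: s_def)
  have "h_lim M t = h_lim M s" using s by (simp add: h_lim_def Let_def s_def)
  also have "\<dots> = g s"
  proof (cases "s \<le> 1 / 2")
    case True
    thus ?thesis using s by (simp add: h_lim_low H_limit_eq_H_smooth[OF M] g_def)
  next
    case False
    hence "h_lim M s = H_limit M (1 - s) + 2 * s - 1" using s by (simp add: h_lim_high h_lim_low)
    also have "\<dots> = g (1 - s) + 2 * s - 1" using s False by (simp add: H_limit_eq_H_smooth[OF M] g_def)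
    also have "\<dots> = g s" unfolding g_def H_smooth_symmetric by simp
    finally show ?thesis .
  qed
  finally show ?thesis by (simp add: s_def)
qed

lemma h_lim_continuous:
  assumes "M \<ge> 2"
  shows "continuous_on UNIV (h_lim M)"
  unfolding h_lim_eq_H_smooth[OF assms, abs_def] H_smooth_def by (intro continuous_intros)

lemma h_lim_C_2: "M \<ge> 2 \<Longrightarrow> C_k_on 2 (h_lim M) {0<..<1}"
  by (rule H_smooth_C_2) (auto simp: h_lim_eq_H_smooth)

subsection \<open>Closed form on the three intervals\<close>

lemma H_limit_cubic:
  fixes K :: real
  assumes "K > 0" "M > 0"
  shows "((1 / 2 - K * t) ^ 3 - 1 / 8) / (6 * K * M) = (- t / 8 + K * t\<^sup>2 / 4 - K\<^sup>2 * t ^ 3 / 6) / M"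
proof -
  have "(1 / 2 - K * t) ^ 3 - 1 / 8 = (6 * K) * (- t / 8 + K * t\<^sup>2 / 4 - K\<^sup>2 * t ^ 3 / 6)"
    by (simp add: power2_eq_square power3_eq_cube algebra_simps add_divide_distrib diff_divide_distrib)
  thus ?thesis using assms by simp
qed

text \<open>Both truncated cubes are active. With (M - 1)^2 = (M + 1)^2 - 4M, a multiple of M splits
  off and cancels -t^2/2 - 2t^3/3.\<close>

lemma H_limit_first:
  assumes M: "M \<ge> 2" and t: "0 \<le> t" "t \<le> 1 / (2 * (M + 1))"
  shows "H_limit M t = - ((M + 1)\<^sup>2 / (3 * M)) * t ^ 3 + (2 - 1 / (4 * M)) * t"
proof -
  have N: "(M + 1) * t \<le> 1 / 2" using t M by (simp add: field_simps)
  moreover have "(M - 1) * t \<le> (M + 1) * t" using M t by (intro mult_right_mono) auto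
  ultimately have mx: "max 0 (1 / 2 - (M + 1) * t) = 1 / 2 - (M + 1) * t" "max 0 (1 / 2 - (M - 1) * t) = 1 / 2 - (M - 1) * t"
    by auto
  have "H_limit M t = 2 * t - t\<^sup>2 / 2 - 2 * t ^ 3 / 3
     + ((- t / 8 + (M - 1) * t\<^sup>2 / 4 - (M - 1)\<^sup>2 * t ^ 3 / 6) + (- t / 8 + (M + 1) * t\<^sup>2 / 4 - (M + 1)\<^sup>2 * t ^ 3 / 6)) / M"
  proof -
    have "u + v / M + w / M = u + (v + w) / M" for u v w by (simp add: add_divide_distrib)
    thus ?thesis
      unfolding H_limit_def mx using H_limit_cubic[of "M - 1" M t] H_limit_cubic[of "M + 1" M t] M by (simp only:)
  qed
  also have "(- t / 8 + (M - 1) * t\<^sup>2 / 4 - (M - 1)\<^sup>2 * t ^ 3 / 6) + (- t / 8 + (M + 1) * t\<^sup>2 / 4 - (M + 1)\<^sup>2 * t ^ 3 / 6)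
     = M * (t\<^sup>2 / 2 + 2 * t ^ 3 / 3) + (- t / 4 - (M + 1)\<^sup>2 * t ^ 3 / 3)"
    by (simp add: power2_eq_square algebra_simps add_divide_distrib diff_divide_distrib)
  also have "\<dots> / M = t\<^sup>2 / 2 + 2 * t ^ 3 / 3 + (- t / 4 - (M + 1)\<^sup>2 * t ^ 3 / 3) / M"
    using M by (simp add: add_divide_distrib)
  finally show ?thesis by (simp add: diff_divide_distrib algebra_simps)
qed

text \<open>Only the cube with M - 1 is active. After the same cancellation, completing the cube in
  (M + 1) t absorbs the leftover constant of the other cube.\<close>

lemma H_limit_second:
  assumes M: "M \<ge> 2" and t: "1 / (2 * (M + 1)) \<le> t" "t \<le> 1 / (2 * (M - 1))"
  shows "H_limit M t = 1 / (6 * (M + 1) * M) * (- (M + 1) * t - 1 / 2) ^ 3 + 2 * t"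
proof -
  have "1 / 2 \<le> (M + 1) * t" "(M - 1) * t \<le> 1 / 2" using t M by (simp_all add: field_simps)
  hence mx: "max 0 (1 / 2 - (M + 1) * t) = 0" "max 0 (1 / 2 - (M - 1) * t) = 1 / 2 - (M - 1) * t"
    by auto
  have "H_limit M t = 2 * t - t\<^sup>2 / 2 - 2 * t ^ 3 / 3
     + (- t / 8 + (M - 1) * t\<^sup>2 / 4 - (M - 1)\<^sup>2 * t ^ 3 / 6) / M - 1 / 8 / (6 * (M + 1) * M)"
  proof -
    have "u + v + (0 ^ 3 - 1 / 8) / w = u + v - 1 / 8 / w" for u v w :: real by simp
    thus ?thesis
      unfolding H_limit_def mx using H_limit_cubic[of "M - 1" M t] M by (simp only:)
  qed
  also have "- t / 8 + (M - 1) * t\<^sup>2 / 4 - (M - 1)\<^sup>2 * t ^ 3 / 6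
     = M * (t\<^sup>2 / 2 + 2 * t ^ 3 / 3) + (- t / 8 - (M + 1) * t\<^sup>2 / 4 - (M + 1)\<^sup>2 * t ^ 3 / 6)"
    by (simp add: power2_eq_square algebra_simps add_divide_distrib diff_divide_distrib)
  also have "\<dots> / M = t\<^sup>2 / 2 + 2 * t ^ 3 / 3 + (- t / 8 - (M + 1) * t\<^sup>2 / 4 - (M + 1)\<^sup>2 * t ^ 3 / 6) / M"
    using M by (simp add: add_divide_distrib)
  also have "(- t / 8 - (M + 1) * t\<^sup>2 / 4 - (M + 1)\<^sup>2 * t ^ 3 / 6) / M
      = ((6 * (M + 1)) * (- t / 8 - (M + 1) * t\<^sup>2 / 4 - (M + 1)\<^sup>2 * t ^ 3 / 6)) / (6 * (M + 1) * M)"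
    using M by (intro mult_divide_mult_cancel_left[symmetric]) auto
  also have "(6 * (M + 1)) * (- t / 8 - (M + 1) * t\<^sup>2 / 4 - (M + 1)\<^sup>2 * t ^ 3 / 6) = (- (M + 1) * t - 1 / 2) ^ 3 + 1 / 8"
  proof -
    define N where "N = M + 1"
    show ?thesis unfolding N_def[symmetric] by (simp add: power2_eq_square power3_eq_cube algebra_simps add_divide_distrib diff_divide_distrib)
  qed
  finally show ?thesis by (simp add: add_divide_distrib)
qed

text \<open>No cube is active; the two constants merge because (M - 1) + (M + 1) = 2M.\<close>

lemma H_limit_third:
  assumes M: "M \<ge> 2" and t: "1 / (2 * (M - 1)) \<le> t"
  shows "H_limit M t = - (2 / 3) * t ^ 3 - 1 / 2 * t\<^sup>2 + 2 * t - 1 / (24 * (M + 1) * (M - 1))"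
proof -
  have "0 \<le> 1 / (2 * (M - 1))" using M by simp
  hence t0: "0 \<le> t" using t by linarith
  have "0 < 2 * (M - 1)" using M by simp
  hence "1 \<le> t * (2 * (M - 1))" using t by (simp only: pos_divide_le_eq)
  hence K: "1 / 2 \<le> (M - 1) * t" by (simp add: algebra_simps)
  moreover have "(M - 1) * t \<le> (M + 1) * t" using M t0 by (intro mult_right_mono) auto
  ultimately have mx: "max 0 (1 / 2 - (M + 1) * t) = 0" "max 0 (1 / 2 - (M - 1) * t) = 0" by auto
  have "1 / 8 / (6 * K * M) + 1 / 8 / (6 * N * M) = 1 / (24 * N * K)"
    if "K > 0" "N > 0" "N + K = 2 * M" for K N
  proof -
    have "1 / 8 / (6 * K * M) + 1 / 8 / (6 * N * M) = N / (48 * (N * K * M)) + K / (48 * (N * K * M))"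
      using that M by simp
    also have "\<dots> = (2 * M) / (48 * (N * K * M))" by (simp only: add_divide_distrib[symmetric] that(3))
    also have "\<dots> = 1 / (24 * N * K)" using M by simp
    finally show ?thesis .
  qed
  from this[of "M - 1" "M + 1"] M
  have "1 / 8 / (6 * (M - 1) * M) + 1 / 8 / (6 * (M + 1) * M) = 1 / (24 * (M + 1) * (M - 1))" by simp
  moreover have "u + (0 ^ 3 - 1 / 8) / v + (0 ^ 3 - 1 / 8) / w = u - (1 / 8 / v + 1 / 8 / w)" for u v w :: real
    by simp
  ultimately have "H_limit M t = 2 * t - t\<^sup>2 / 2 - 2 * t ^ 3 / 3 - 1 / (24 * (M + 1) * (M - 1))"
    unfolding H_limit_def mx by (simp only:)
  thus ?thesis by simp
qed

subsection \<open>Passing to the limit over the primes\<close>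

text \<open>Both roundings stay within 1 of t p, and for t outside [0, 1] the cut-off to [0, p] is
  exact.\<close>

lemma clamp_tendsto:
  assumes "\<And>p. r p = nat \<lfloor>t * real p\<rfloor> \<or> r p = nat \<lceil>t * real p\<rceil>"
  shows "(\<lambda>p. real (min p (r p)) / real p) \<longlonglongrightarrow> max 0 (min 1 t)"
proof (rule tendsto_divide_linear[where C = 1])
  fix p
  consider "t \<le> 0" | "0 < t" "t < 1" | "1 \<le> t" by linarith
  thus "\<bar>real (min p (r p)) - max 0 (min 1 t) * real p\<bar> \<le> 1"
  proof cases
    case 1
    hence "t * real p \<le> 0" by (intro mult_nonpos_nonneg) auto
    hence "r p = 0" using assms[of p] by (auto simp: floor_le_iff ceiling_le_iff nat_eq_iff)
    thus ?thesis using 1 by simp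
  next
    case 2
    have le: "t * real p \<le> 1 * real p" using 2 by (intro mult_right_mono) auto
    have nn: "0 \<le> t * real p" using 2 by simp
    have "\<bar>real (r p) - t * real p\<bar> \<le> 1" "real (r p) \<le> of_int \<lceil>t * real p\<rceil>"
      using assms[of p] nn ceiling_mono[OF nn] floor_le_ceiling[of "t * real p"] by (auto simp: abs_le_iff) linarith+
    moreover have "\<lceil>t * real p\<rceil> \<le> int p" using le by (simp add: ceiling_le_iff)
    ultimately have "r p \<le> p" by linarith
    thus ?thesis using 2 \<open>\<bar>real (r p) - t * real p\<bar> \<le> 1\<close> by simp
  next
    case 3
    have "1 * real p \<le> t * real p" using 3 by (intro mult_right_mono) auto
    hence "int p \<le> \<lfloor>t * real p\<rfloor>" by (simp add: le_floor_iff)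
    hence "p \<le> r p" using assms[of p] floor_le_ceiling[of "t * real p"] by linarith
    thus ?thesis using 3 by simp
  qed
qed

lemma is_limit_h_function_D_poly:
  assumes n: "n \<ge> 4"
  shows "is_limit_h_function (coeff_map of_int (D_poly n)) (h_lim (real (n - 2)))"
proof -
  obtain H where H: "\<And>p. Factorial_Ring.prime p \<Longrightarrow> is_h_function (residue_ring (int p)) p (coeff_map (\<lambda>x. x mod int p) (D_poly n)) (H p)"
    "\<And>p t. Factorial_Ring.prime p \<Longrightarrow> odd p \<Longrightarrow> real (length_sum (n - 2) p (min p (nat \<lfloor>t * real p\<rfloor>))) / real p ^ 3 \<le> H p t"
    "\<And>p t. Factorial_Ring.prime p \<Longrightarrow> odd p \<Longrightarrow> H p t \<le> real (length_sum (n - 2) p (min p (nat \<lceil>t * real p\<rceil>))) / real p ^ 3"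
    using h_function_D_poly[of n] n by auto
  let ?F = "inf sequentially (principal {p. Factorial_Ring.prime p})"
  have "((\<lambda>p. H p t) \<longlongrightarrow> h_lim (real (n - 2)) t) ?F" for t
  proof (rule tendsto_sandwich)
    have M: "n - 2 \<ge> 2" using n by simp
    have lim: "((\<lambda>p. real (length_sum (n - 2) p (min p (r p))) / real p ^ 3) \<longlongrightarrow> h_lim (real (n - 2)) t) ?F"
      if "\<And>p. r p = nat \<lfloor>t * real p\<rfloor> \<or> r p = nat \<lceil>t * real p\<rceil>" for r
      unfolding h_lim_def Let_def
      by (rule tendsto_mono[OF inf_le1 length_sum_tendsto[OF M _ clamp_tendsto[OF that]]]) simp
    show "((\<lambda>p. real (length_sum (n - 2) p (min p (nat \<lfloor>t * real p\<rfloor>))) / real p ^ 3) \<longlongrightarrow> h_lim (real (n - 2)) t) ?F"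
      "((\<lambda>p. real (length_sum (n - 2) p (min p (nat \<lceil>t * real p\<rceil>))) / real p ^ 3) \<longlongrightarrow> h_lim (real (n - 2)) t) ?F"
      by (rule lim; simp)+
    \<comment> \<open>The length sums bound \<open>H p t\<close> for odd primes only; p = 2 is left
      behind along the filter.\<close>
    have ev: "eventually (\<lambda>p. Factorial_Ring.prime p \<and> odd p) ?F"
      unfolding eventually_inf_principal using eventually_gt_at_top[of 2]
      by eventually_elim (auto dest: prime_odd_nat)
    show "eventually (\<lambda>p. real (length_sum (n - 2) p (min p (nat \<lfloor>t * real p\<rfloor>))) / real p ^ 3 \<le> H p t) ?F"
      "eventually (\<lambda>p. H p t \<le> real (length_sum (n - 2) p (min p (nat \<lceil>t * real p\<rceil>))) / real p ^ 3) ?F"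
      using ev by (eventually_elim, use H in blast)+
  qed
  thus ?thesis
    unfolding is_limit_h_function_def using H(1)
    by (intro exI[of _ "\<lambda>a. coeff3 (D_poly n) (a 0) (a 1) (a 2)"] exI[of _ H]) (auto simp: coeff_map_def)
qed

theorem theorem4p3:
  fixes n :: nat and S :: "((3 \<Rightarrow> nat) \<Rightarrow> complex) ring" and x y z f :: "(3 \<Rightarrow> nat) \<Rightarrow> complex"
  assumes "n \<ge> 4"
    and "S = mpowser_ring ring_of_type_algebra"
    and "x = mvar ring_of_type_algebra 0"
    and "y = mvar ring_of_type_algebra 1"
    and "z = mvar ring_of_type_algebra 2"
    and "f = x [^]\<^bsub>S\<^esub> (2::nat) \<oplus>\<^bsub>S\<^esub> y [^]\<^bsub>S\<^esub> (2::nat) \<otimes>\<^bsub>S\<^esub> z \<oplus>\<^bsub>S\<^esub> z [^]\<^bsub>S\<^esub> (n - 1)"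
  shows "\<exists>h :: real \<Rightarrow> real.
    is_limit_h_function f h \<and>
    (\<forall>t \<in> {0 .. 1 / (2 * (real n - 1))}.
       h t = - ((real n - 1)\<^sup>2 / (3 * (real n - 2))) * t ^ 3 + (2 - 1 / (4 * (real n - 2))) * t) \<and>
    (\<forall>t \<in> {1 / (2 * (real n - 1)) .. 1 / (2 * (real n - 3))}.
       h t = 1 / (6 * (real n - 1) * (real n - 2)) * ((1 - real n) * t - 1 / 2) ^ 3 + 2 * t) \<and>
    (\<forall>t \<in> {1 / (2 * (real n - 3)) .. 1 / 2}.
       h t = - (2 / 3) * t ^ 3 - 1 / 2 * t\<^sup>2 + 2 * t - 1 / (24 * (real n - 1) * (real n - 3))) \<and>
    (\<forall>t \<in> {1 / 2 .. 1}. h t = h (1 - t) + 2 * t - 1) \<and>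
    continuous_on UNIV h \<and> C_k_on 2 h {0 <..< 1}"
proof -
  define M where "M = real (n - 2)"
  have M: "M \<ge> 2" using assms(1) by (simp add: M_def)
  \<comment> \<open>With M = n - 2, the slopes M + 1 and M - 1 become the n - 1 and n - 3 of the
    statement.\<close>
  have nM: "real n - 1 = M + 1" "real n - 2 = M" "real n - 3 = M - 1" "1 - real n = - (M + 1)"
    using assms(1) by (auto simp: M_def of_nat_diff)
  have cring: "ring (ring_of_type_algebra :: complex ring)" by (rule ring_from_type_algebra)
  have "f = coeff_map of_int (D_poly n)"
    unfolding assms(3-6)
    by (rule coeff_map_D_poly[OF cring _ _ _ _ _ assms(2), symmetric]) (simp_all add: ring_of_type_algebra_def)
  hence lim: "is_limit_h_function f (h_lim M)"
    using is_limit_h_function_D_poly[OF assms(1)] by (simp add: M_def)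
  have b: "0 \<le> 1 / (2 * (M + 1))" "1 / (2 * (M + 1)) \<le> 1 / 2" "0 \<le> 1 / (2 * (M - 1))" "1 / (2 * (M - 1)) \<le> 1 / 2"
    using M by (simp_all add: divide_simps)
  show ?thesis
    unfolding nM
  proof (intro exI[of _ "h_lim M"] conjI ballI lim h_lim_continuous[OF M] h_lim_C_2[OF M])
    fix t assume "t \<in> {0 .. 1 / (2 * (M + 1))}"
    hence t: "0 \<le> t" "t \<le> 1 / (2 * (M + 1))" by (simp_all only: atLeastAtMost_iff)
    hence "h_lim M t = H_limit M t" using b by (intro h_lim_low) linarith+
    thus "h_lim M t = - ((M + 1)\<^sup>2 / (3 * M)) * t ^ 3 + (2 - 1 / (4 * M)) * t"
      by (simp only: H_limit_first[OF M t])
  next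
    fix t assume "t \<in> {1 / (2 * (M + 1)) .. 1 / (2 * (M - 1))}"
    hence t: "1 / (2 * (M + 1)) \<le> t" "t \<le> 1 / (2 * (M - 1))" by (simp_all only: atLeastAtMost_iff)
    hence "h_lim M t = H_limit M t" using b by (intro h_lim_low) linarith+
    thus "h_lim M t = 1 / (6 * (M + 1) * M) * (- (M + 1) * t - 1 / 2) ^ 3 + 2 * t"
      by (simp only: H_limit_second[OF M t])
  next
    fix t assume "t \<in> {1 / (2 * (M - 1)) .. 1 / 2}"
    hence t: "1 / (2 * (M - 1)) \<le> t" "t \<le> 1 / 2" by (simp_all only: atLeastAtMost_iff)
    hence "h_lim M t = H_limit M t" using b by (intro h_lim_low) linarith+
    thus "h_lim M t = - (2 / 3) * t ^ 3 - 1 / 2 * t\<^sup>2 + 2 * t - 1 / (24 * (M + 1) * (M - 1))"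
      by (simp only: H_limit_third[OF M t(1)])
  next
    fix t :: real assume "t \<in> {1 / 2 .. 1}"
    thus "h_lim M t = h_lim M (1 - t) + 2 * t - 1" by (intro h_lim_high) auto
  qed
qed

end
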